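(* Let $\{X,X_1,X_2,\ldots\}$ and $\{Y,Y_1,Y_2,\ldots\}$ be two independent sequences of i.i.d. random variables, with $X$ distributed as $F$ on $\mathbb{R}$ and $Y$ distributed as $G$ on $(0,\infty)$. Let $\alpha\ge 0$ and assume that for every $0<p<1$ the distribution $pF+(1-p)G$ belongs to the class $\mathcal{R}_{-\alpha}^{\ast}$. Write $\overline F=1-F$, $\overline G=1-G$, $\mu_\alpha=\mathrm{E}Y^\alpha$, and $$S_0=0,\quad S_n=\sum_{i=1}^n X_i\prod_{j=1}^i Y_j,\qquad M_n=\max_{0\le k\le n}S_k,\qquad n\in\mathbb{N}.$$ For $n\in\mathbb{N}$ put $$A_n=\sum_{i=1}^n\mu_\alpha^i,\qquad B_n=\sum_{i=1}^n\mu_\alpha^{i-2}\,\mathrm{E}M_{n-i+1}^\alpha,\qquad C_n=\sum_{i=1}^n\mu_\alpha^{i-2}\,\mathrm{E}S_{n-i+1,+}^\alpha .$$ Then, as $x\to\infty$: (a) For every $n\in\mathbb{N}$, $$\Pr(M_n>x)\sim A_n\overline F(x)+B_n\overline G(x)\quad\text{and}\quad \Pr(S_n>x)\sim A_n\overline F(x)+C_n\overline G(x).$$ (b) If $\mu_\alpha<1$, then $$\Pr(M_\infty>x)\sim A_\infty\overline F(x)+B_\infty\overline G(x),$$ where $M_\infty$ is the a.s. limit of $M_n$ as $n\to\infty$, $A_\infty=\dfrac{\mu_\alpha}{1-\mu_\alpha}$ and $B_\infty=\dfrac{\mathrm{E}M_\infty^\alpha}{\mu_\alpha(1-\mu_\alpha)}$.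 (c) If $\mu_\alpha<1$ and $\mathrm{E}\ln(X_-\vee 1)<\infty$, then $$\Pr(S_\infty>x)\sim A_\infty\overline F(x)+C_\infty\overline G(x),$$ where $S_\infty$ is the a.s. limit of $S_n$ as $n\to\infty$, $A_\infty=\dfrac{\mu_\alpha}{1-\mu_\alpha}$ and $C_\infty=\dfrac{\mathrm{E}S_{\infty,+}^\alpha}{\mu_\alpha(1-\mu_\alpha)}$.
   Context: Notation: $x_+=x\vee 0$, $x_-=-(x\wedge 0)$, $S_{n,+}=(S_n)_+$. For a distribution $U$, $\overline U=1-U$. The relation $a(x)\sim b(x)$ (as $x\to\infty$) means $a(x)/b(x)\to1$, i.e. $a(x)=(1+o(1))b(x)$, the latter form being used if both functions vanish for all large $x$. When $\alpha=0$, $\mathrm{E}\xi_+^0$ is understood as $\Pr(\xi>0)$ (convention $0^0=0$). Under the hypotheses of (b), respectively (c), the a.s. limit $M_\infty$, respectively $S_\infty$, exists and is finite. Convolution equivalence: a distribution $V$ on $[0,\infty)$ belongs to $\mathcal{S}(\alpha)$, $\alpha\ge0$, if $\overline V(x)>0$ for all $x$, $\lim_{x\to\infty}\overline V(x-y)/\overline V(x)=\mathrm{e}^{\alpha y}$ for every $y\in\mathbb{R}$, and $\lim_{x\to\infty}\overline{V^{2\ast}}(x)/\overline V(x)$ exists and is finite, where $V^{2\ast}$ is the 2-fold convolution of $V$ with itself. A distribution $V$ on $\mathbb{R}$ belongs to $\mathcal{S}(\alpha)$ if the distribution $V(x)\mathbf{1}_{(x\ge0)}$ on $[0,\infty)$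 does. Strongly regular variation: a distribution $U$ on $\mathbb{R}$ belongs to $\mathcal{R}_{-\alpha}^{\ast}$, $\alpha\ge0$, if the distribution $V(x)=1-\overline U(\mathrm{e}^x)/\overline U(0)$, $x\in\mathbb{R}$, belongs to $\mathcal{S}(\alpha)$. (If $\xi$ has distribution $U$, then $V$ is the conditional distribution of $\ln\xi$ given $\xi>0$.) *)

theory Defs
  imports "HOL-Probability.Probability" "HOL-Library.Landau_Symbols"
begin

text \<open>A distribution is represented by its distribution function, as in the notation
  \<open>V(x) 1(x \<ge> 0)\<close> and \<open>1 - tail U (e^x) / tail U 0\<close> used below.\<close>

definition distribution :: "(real \<Rightarrow> real) \<Rightarrow> bool" where
  "distribution U \<longleftrightarrow> (\<exists>D. real_distribution D \<and> cdf D = U)"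

definition tail :: "(real \<Rightarrow> real) \<Rightarrow> real \<Rightarrow> real" where
  "tail U x = 1 - U x"

definition conv2 :: "(real \<Rightarrow> real) \<Rightarrow> real \<Rightarrow> real" where
  "conv2 V = cdf (interval_measure V \<star> interval_measure V)"

definition conv_equiv_nonneg :: "real \<Rightarrow> (real \<Rightarrow> real) set" where
  "conv_equiv_nonneg \<alpha> = {V. distribution V \<and> (\<forall>x<0. V x = 0) \<and>
     (\<forall>x. tail V x > 0) \<and>
     (\<forall>y. ((\<lambda>x. tail V (x - y) / tail V x) \<longlongrightarrow> exp (\<alpha> * y)) at_top) \<and>
     (\<exists>L. ((\<lambda>x. tail (conv2 V) x / tail V x) \<longlongrightarrow> L) at_top)}"

definition conv_equiv :: "real \<Rightarrow> (real \<Rightarrow> real) set" where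
  "conv_equiv \<alpha> = {V. distribution V \<and> (\<lambda>x. if x \<ge> 0 then V x else 0) \<in> conv_equiv_nonneg \<alpha>}"

text \<open>The class of index \<open>-\<alpha>\<close>. If \<open>tail U 0 = 0\<close>, division by zero makes the transformed function
  constantly 1, which is not a distribution function, so such \<open>U\<close> are excluded.\<close>

definition strong_reg_var :: "real \<Rightarrow> (real \<Rightarrow> real) set" where
  "strong_reg_var \<alpha> =
     {U. distribution U \<and> (\<lambda>x. 1 - tail U (exp x) / tail U 0) \<in> conv_equiv \<alpha>}"

text \<open>Sequences are indexed so that \<open>X 0\<close>, \<open>Y 0\<close> are the generic variables \<open>X\<close>, \<open>Y\<close> in
  \<open>{X, X\<^sub>1, X\<^sub>2, \<dots>}\<close> and \<open>{Y, Y\<^sub>1, Y\<^sub>2, \<dots>}\<close>; they do not enter the sums.\<close>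

definition S_sum :: "(nat \<Rightarrow> 'a \<Rightarrow> real) \<Rightarrow> (nat \<Rightarrow> 'a \<Rightarrow> real) \<Rightarrow> nat \<Rightarrow> 'a \<Rightarrow> real" where
  "S_sum X Y n \<omega> = (\<Sum>i=1..n. X i \<omega> * (\<Prod>j=1..i. Y j \<omega>))"

definition M_max :: "(nat \<Rightarrow> 'a \<Rightarrow> real) \<Rightarrow> (nat \<Rightarrow> 'a \<Rightarrow> real) \<Rightarrow> nat \<Rightarrow> 'a \<Rightarrow> real" where
  "M_max X Y n \<omega> = Max ((\<lambda>k. S_sum X Y k \<omega>) ` {0..n})"

definition S_lim :: "(nat \<Rightarrow> 'a \<Rightarrow> real) \<Rightarrow> (nat \<Rightarrow> 'a \<Rightarrow> real) \<Rightarrow> 'a \<Rightarrow> real" where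
  "S_lim X Y \<omega> = lim (\<lambda>n. S_sum X Y n \<omega>)"

definition M_lim :: "(nat \<Rightarrow> 'a \<Rightarrow> real) \<Rightarrow> (nat \<Rightarrow> 'a \<Rightarrow> real) \<Rightarrow> 'a \<Rightarrow> real" where
  "M_lim X Y \<omega> = lim (\<lambda>n. M_max X Y n \<omega>)"

text \<open>The \<open>\<alpha>\<close>-moment of the positive part. Since \<open>0 powr 0 = 0\<close> in HOL, for \<open>\<alpha> = 0\<close> this is the
  probability of \<open>\<xi> > 0\<close>. It is applied only to \<open>Y\<close>, which is almost surely positive, to the
  maxima, which are nonnegative because \<open>S\<^sub>0 = 0\<close>, and to the sums, where the positive part
  matters; under the hypothesis that all mixtures lie in \<open>strong_reg_var \<alpha>\<close> the moments of
  \<open>Y\<close>, \<open>M\<^sub>n\<close> and \<open>S\<^sub>n\<close>, and those of the limits if \<open>\<mu> < 1\<close>, are finite.\<close>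

definition pos_moment :: "'a measure \<Rightarrow> real \<Rightarrow> ('a \<Rightarrow> real) \<Rightarrow> real" where
  "pos_moment M \<alpha> \<xi> = (\<integral>\<omega>. max (\<xi> \<omega>) 0 powr \<alpha> \<partial>M)"

definition A_coeff :: "real \<Rightarrow> nat \<Rightarrow> real" where
  "A_coeff \<mu> n = (\<Sum>i=1..n. \<mu> ^ i)"

text \<open>With \<open>m k\<close> the moment of \<open>M\<^sub>k\<close>, respectively \<open>S\<^sub>k\<close>, this is \<open>B\<^sub>n\<close>, respectively \<open>C\<^sub>n\<close>. The
  exponent \<open>i - 2\<close> is an integer, equal to \<open>-1\<close> for \<open>i = 1\<close>.\<close>

definition BC_coeff :: "real \<Rightarrow> (nat \<Rightarrow> real) \<Rightarrow> nat \<Rightarrow> real" where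
  "BC_coeff \<mu> m n = (\<Sum>i=1..n. \<mu> powi (int i - 2) * m (n - i + 1))"

end

theory Submission
  imports Defs
begin

text \<open>Let \<open>h\<close> be the tail of the even mixture \<open>H\<close> of \<open>F\<close> and \<open>G\<close>. Convolution equivalence of the logarithm
  of \<open>H\<close>, with the limit of the tail ratio identified as twice the exponential moment, says that
  a product \<open>Y Z\<close> of independent variables with tails of order \<open>h\<close> is large only because one of the
  factors is large while the other is moderate. If the tail of \<open>W\<close> is \<open>a F + b G\<close>
  up to an error \<open>D h\<close>, then one step \<open>W \<mapsto> Y (X + W)\<close> of the recursion that generates
  the sums (and, after taking positive parts, the maxima) gives the tail
  \<open>\<mu> (a + 1) F + (\<mu> b + E (X + W)\<^sub>+\<^sup>\<alpha>) G\<close> up to an error \<open>\<mu> D h\<close>. Starting from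
  \<open>W = 0\<close> and \<open>D = 0\<close>, induction yields the result for finite \<open>n\<close>. If \<open>\<mu> < 1\<close>, the same one-step
  estimates bound the tails of all \<open>M\<^sub>n\<close> by a common multiple of \<open>h\<close>; the limits are fixed points of
  the recursion with finite error \<open>D\<close>, so \<open>D \<le> \<mu> D\<close> forces \<open>D = 0\<close>.\<close>

text \<open>The hypothesis concerns mixtures of F and G only and gives no regular variation of
  either tail with respect to itself. Hence all errors are measured against h: solving two mixtures
  for the single tails yields \<open>ccdf LF (x / y) = y powr \<alpha> * ccdf LF x + o(h x)\<close>,
  and likewise for G. Asymptotic equivalence is recovered only at the end, when both coefficients
  are positive and the right-hand side dominates a multiple of h. If the coefficient of G vanishes
  this breaks down; then X \<le> 0 almost surely has to be derived, so that both sides vanish for x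
  \<ge> 0. The definition of the class postulates only that the limit L of the convolution ratio
  exists. The bound of L by twice the exponential moment m has to be proved, because it is what
  makes the event that both factors are large negligible. The range of x in which the expansion for
  n is accurate depends on n, so the limit in n cannot be taken inside it. This is why the limits
  are treated as fixed points, with a separate bound valid for all x > 0 and all n.\<close>

section \<open>Product measures, layer-cake integration and tails of real distributions\<close>

lemma measure_pair_eq_integral:
  assumes "prob_space M1" "prob_space M2" and Q: "Q \<in> sets (M1 \<Otimes>\<^sub>M M2)"
  shows "measure (M1 \<Otimes>\<^sub>M M2) Q = (\<integral>x. measure M2 (Pair x -` Q) \<partial>M1)"
proof -
  interpret M1: prob_space M1 by fact
  interpret M2: prob_space M2 by fact
  interpret P: pair_prob_space M1 M2 ..
  have [measurable]: "(\<lambda>x. measure M2 (Pair x -` Q)) \<in> borel_measurable M1"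
    unfolding measure_def using M2.measurable_emeasure_Pair[OF Q] by measurable
  have "emeasure (M1 \<Otimes>\<^sub>M M2) Q = (\<integral>\<^sup>+x. ennreal (measure M2 (Pair x -` Q)) \<partial>M1)"
    using M2.emeasure_pair_measure_alt[OF Q] by (simp add: M2.emeasure_eq_measure)
  then show "measure (M1 \<Otimes>\<^sub>M M2) Q = (\<integral>x. measure M2 (Pair x -` Q) \<partial>M1)"
    by (subst integral_eq_nn_integral) (auto simp: measure_def[of "M1 \<Otimes>\<^sub>M M2"])
qed

lemma nn_integral_layer_cake:
  fixes f :: "'a \<Rightarrow> real"
  assumes "sigma_finite_measure M" and [measurable]: "f \<in> borel_measurable M" and "\<And>x. f x \<ge> 0"
  shows "(\<integral>\<^sup>+x. ennreal (f x) \<partial>M) = (\<integral>\<^sup>+s. emeasure M {x\<in>space M. s < f x} * indicator {0..} s \<partial>lborel)"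
proof -
  interpret M: sigma_finite_measure M by fact
  interpret P: pair_sigma_finite M lborel ..
  have "(\<integral>\<^sup>+x. ennreal (f x) \<partial>M) = (\<integral>\<^sup>+x. (\<integral>\<^sup>+s. indicator {0..<f x} s \<partial>lborel) \<partial>M)"
    using assms(3) by (intro nn_integral_cong) simp
  also have "\<dots> = (\<integral>\<^sup>+x. (\<integral>\<^sup>+s. (if 0 \<le> s \<and> s < f x then 1 else 0) \<partial>lborel) \<partial>M)"
    by (intro nn_integral_cong) (auto split: split_indicator)
  also have "\<dots> = (\<integral>\<^sup>+s. (\<integral>\<^sup>+x. (if 0 \<le> s \<and> s < f x then 1 else 0) \<partial>M) \<partial>lborel)"
    by (rule P.Fubini'[symmetric]) measurable
  also have "\<dots> = (\<integral>\<^sup>+s. emeasure M {x\<in>space M. s < f x} * indicator {0..} s \<partial>lborel)"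
  proof (intro nn_integral_cong)
    fix s :: real
    have "(\<integral>\<^sup>+x. (if 0 \<le> s \<and> s < f x then 1 else 0) \<partial>M)
        = (\<integral>\<^sup>+x. indicator {0..} s * indicator {x\<in>space M. s < f x} x \<partial>M)"
      by (intro nn_integral_cong) (auto split: split_indicator)
    also have "\<dots> = indicator {0..} s * emeasure M {x\<in>space M. s < f x}"
      by (subst nn_integral_cmult_indicator) auto
    finally show "(\<integral>\<^sup>+x. (if 0 \<le> s \<and> s < f x then 1 else 0) \<partial>M)
        = emeasure M {x\<in>space M. s < f x} * indicator {0..} s" by (simp add: mult.commute)
  qed
  finally show ?thesis .
qed

lemma open_upclosed_real:
  fixes U :: "real set"
  assumes "open U" "\<And>x y. x \<in> U \<Longrightarrow> x \<le> y \<Longrightarrow> y \<in> U" "U \<subseteq> {x0<..}"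
  obtains "U = {}" | a where "a \<ge> x0" "U = {a<..}"
proof (cases "U = {}")
  case False
  have bdd: "bdd_below U" using assms(3) by (auto intro!: bdd_belowI[of _ x0])
  have "Inf U \<ge> x0" using False assms(3) by (intro cInf_greatest) auto
  moreover have "U = {Inf U<..}"
  proof safe
    fix y assume "y \<in> U"
    then obtain e where e: "e > 0" "ball y e \<subseteq> U" using \<open>open U\<close> openE by blast
    then have "y - e/2 \<in> U" by (auto simp: dist_real_def subset_eq)
    then have "Inf U \<le> y - e/2" using bdd by (rule cInf_lower)
    then show "y > Inf U" using e by auto
  next
    fix y assume "y > Inf U"
    then obtain x where "x \<in> U" "x < y" using False bdd by (meson cInf_less_iff)
    then show "y \<in> U" using assms(2) by auto
  qed
  ultimately show ?thesis using that by blast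
qed (use that in auto)

text \<open>Layer cake: by continuity and monotonicity every strict superlevel set of \<phi> is an
  open half-line. For levels s \<ge> \<phi> x0 it starts at or beyond x0, where the tails are
  comparable; the levels below \<phi> x0 contribute at most \<phi> x0.\<close>

lemma nn_integral_tail_comparison:
  fixes \<phi> :: "real \<Rightarrow> real"
  assumes "real_distribution N1" "real_distribution N2"
    and mono: "mono \<phi>" and nonneg: "\<And>x. \<phi> x \<ge> 0" and cont: "continuous_on UNIV \<phi>" and "C \<ge> 0"
    and le: "\<And>x. x \<ge> x0 \<Longrightarrow> measure N1 {x<..} \<le> C * measure N2 {x<..}"
  shows "(\<integral>\<^sup>+x. \<phi> x \<partial>N1) \<le> \<phi> x0 + C * (\<integral>\<^sup>+x. \<phi> x \<partial>N2)"
proof -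
  interpret N1: real_distribution N1 by fact
  interpret N2: real_distribution N2 by fact
  have [measurable]: "\<phi> \<in> borel_measurable borel" using cont by (rule borel_measurable_continuous_onI)
  have meas: "(\<lambda>s. emeasure N2 {x. s < \<phi> x}) \<in> borel_measurable borel"
  proof -
    have "emeasure N2 {x. s < \<phi> x} = (\<integral>\<^sup>+x. (if s < \<phi> x then 1 else 0) \<partial>N2)" for s
    proof -
      have "(\<integral>\<^sup>+x. (if s < \<phi> x then 1 else 0) \<partial>N2) = (\<integral>\<^sup>+x. indicator {x. s < \<phi> x} x \<partial>N2)"
        by (intro nn_integral_cong) (auto split: split_indicator)
      then show ?thesis by simp
    qed
    moreover have "(\<lambda>s. (\<integral>\<^sup>+x. (if s < \<phi> x then 1 else 0) \<partial>N2)) \<in> borel_measurable borel"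
      by measurable
    ultimately show ?thesis by simp
  qed
  have key: "emeasure N1 {x. s < \<phi> x} \<le> C * emeasure N2 {x. s < \<phi> x}" if s: "s \<ge> \<phi> x0" for s
  proof -
    have "open {x. s < \<phi> x}" using cont by (intro open_Collect_less) auto
    moreover have "y \<in> {x. s < \<phi> x}" if "x \<in> {x. s < \<phi> x}" "x \<le> y" for x y
      using that monoD[OF mono that(2)] by auto
    moreover have "{x. s < \<phi> x} \<subseteq> {x0<..}"
    proof safe
      fix y assume "s < \<phi> y"
      then show "x0 < y" using s monoD[OF mono, of y x0] by (cases "x0 < y") auto
    qed
    ultimately show ?thesis
    proof (rule open_upclosed_real)
      fix a assume "x0 \<le> a" "{x. s < \<phi> x} = {a<..}"
      then show ?thesis using le[of a] \<open>C \<ge> 0\<close>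
        by (simp add: N1.emeasure_eq_measure N2.emeasure_eq_measure ennreal_mult'[symmetric])
    qed auto
  qed
  have "(\<integral>\<^sup>+x. \<phi> x \<partial>N1) = (\<integral>\<^sup>+s. emeasure N1 {x. s < \<phi> x} * indicator {0..} s \<partial>lborel)"
    by (subst nn_integral_layer_cake) (auto intro: nonneg simp: N1.sigma_finite_measure_axioms)
  also have "\<dots> \<le> (\<integral>\<^sup>+s. indicator {0..<\<phi> x0} s + C * (emeasure N2 {x. s < \<phi> x} * indicator {0..} s) \<partial>lborel)"
  proof (intro nn_integral_mono)
    fix s :: real
    show "emeasure N1 {x. s < \<phi> x} * indicator {0..} s
        \<le> indicator {0..<\<phi> x0} s + C * (emeasure N2 {x. s < \<phi> x} * indicator {0..} s)"
      using key[of s] N1.emeasure_le_1[of "{x. s < \<phi> x}"]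
      by (auto split: split_indicator intro: add_increasing2)
  qed
  also have "\<dots> = \<phi> x0 + C * (\<integral>\<^sup>+s. emeasure N2 {x. s < \<phi> x} * indicator {0..} s \<partial>lborel)"
    using meas nonneg by (subst nn_integral_add) (auto simp: nn_integral_cmult)
  also have "(\<integral>\<^sup>+s. emeasure N2 {x. s < \<phi> x} * indicator {0..} s \<partial>lborel) = (\<integral>\<^sup>+x. \<phi> x \<partial>N2)"
    by (subst nn_integral_layer_cake) (auto intro: nonneg simp: N2.sigma_finite_measure_axioms)
  finally show ?thesis .
qed

abbreviation ccdf :: "real measure \<Rightarrow> real \<Rightarrow> real" where
  "ccdf N x \<equiv> measure N {x<..}"

lemma ccdf_mono: "real_distribution N \<Longrightarrow> x \<le> y \<Longrightarrow> ccdf N y \<le> ccdf N x"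
proof -
  assume "real_distribution N"
  then interpret real_distribution N .
  show "x \<le> y \<Longrightarrow> ccdf N y \<le> ccdf N x" by (intro finite_measure_mono) auto
qed

lemma ccdf_le_1: "real_distribution N \<Longrightarrow> ccdf N x \<le> 1"
  using prob_space.prob_le_1 real_distribution.axioms(1) by blast

lemma ccdf_measurable: "real_distribution N \<Longrightarrow> ccdf N \<in> borel_measurable borel"
proof -
  assume N: "real_distribution N"
  have "mono (\<lambda>x. - ccdf N x)" by (intro monoI) (auto intro: ccdf_mono[OF N])
  then have "(\<lambda>x. - ccdf N x) \<in> borel_measurable borel" by (rule borel_measurable_mono)
  then show ?thesis by (rule borel_measurable_uminus_eq[THEN iffD1])
qed

lemma ccdf_eq: "real_distribution N \<Longrightarrow> ccdf N x = 1 - cdf N x"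
proof -
  assume "real_distribution N"
  then interpret real_distribution N .
  have "ccdf N x = prob (space N - {..x})" by (rule arg_cong[where f=prob]) auto
  then show ?thesis by (subst (asm) prob_compl) (auto simp: cdf_def)
qed

lemma ccdf_tendsto_0: "real_distribution N \<Longrightarrow> (ccdf N \<longlongrightarrow> 0) at_top"
proof -
  assume N: "real_distribution N"
  then interpret real_distribution N .
  have "((\<lambda>x. 1 - cdf N x) \<longlongrightarrow> 1 - 1) at_top" by (intro tendsto_intros cdf_lim_at_top_prob)
  then show ?thesis by (simp add: ccdf_eq[OF N])
qed

lemma sets_pair_Collect:
  assumes "real_distribution N1" "real_distribution N2"
    and P: "Measurable.pred (borel \<Otimes>\<^sub>M borel) P"
  shows "{p. P p} \<in> sets (N1 \<Otimes>\<^sub>M N2)"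
proof -
  have "sets (N1 \<Otimes>\<^sub>M N2) = sets (borel \<Otimes>\<^sub>M borel)"
    by (intro sets_pair_measure_cong real_distribution.events_eq_borel assms)
  then show ?thesis using P by (simp add: pred_def space_pair_measure)
qed

lemma measure_pair_eq_integral_right:
  assumes M1: "prob_space M1" and M2: "prob_space M2" and Q: "Q \<in> sets (M1 \<Otimes>\<^sub>M M2)"
  shows "measure (M1 \<Otimes>\<^sub>M M2) Q = (\<integral>y. measure M1 {x. (x, y) \<in> Q} \<partial>M2)"
proof -
  interpret M1: prob_space M1 by fact
  interpret M2: prob_space M2 by fact
  interpret P: pair_prob_space M1 M2 ..
  interpret P': pair_prob_space M2 M1 ..
  let ?s = "\<lambda>(x, y). (y, x)"
  have Q': "?s -` Q \<inter> space (M2 \<Otimes>\<^sub>M M1) \<in> sets (M2 \<Otimes>\<^sub>M M1)"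
    using Q by (rule measurable_sets[OF measurable_pair_swap'])
  have "measure (M1 \<Otimes>\<^sub>M M2) Q = measure (distr (M2 \<Otimes>\<^sub>M M1) (M1 \<Otimes>\<^sub>M M2) ?s) Q"
    using P.distr_pair_swap by simp
  also have "\<dots> = measure (M2 \<Otimes>\<^sub>M M1) (?s -` Q \<inter> space (M2 \<Otimes>\<^sub>M M1))"
    by (rule measure_distr[OF measurable_pair_swap' Q])
  also have "\<dots> = (\<integral>y. measure M1 (Pair y -` (?s -` Q \<inter> space (M2 \<Otimes>\<^sub>M M1))) \<partial>M2)"
    by (rule measure_pair_eq_integral[OF M2 M1 Q'])
  also have "\<dots> = (\<integral>y. measure M1 {x. (x, y) \<in> Q} \<partial>M2)"
  proof (rule Bochner_Integration.integral_cong)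
    fix y assume "y \<in> space M2"
    then have "Pair y -` (?s -` Q \<inter> space (M2 \<Otimes>\<^sub>M M1)) = {x. (x, y) \<in> Q}"
      using sets.sets_into_space[OF Q] by (auto simp: space_pair_measure)
    then show "measure M1 (Pair y -` (?s -` Q \<inter> space (M2 \<Otimes>\<^sub>M M1))) = measure M1 {x. (x, y) \<in> Q}"
      by simp
  qed simp
  finally show ?thesis .
qed

lemma measure_pair_Times:
  assumes "prob_space M1" "prob_space M2" "A \<in> sets M1" "B \<in> sets M2"
  shows "measure (M1 \<Otimes>\<^sub>M M2) (A \<times> B) = measure M1 A * measure M2 B"
proof -
  interpret M1: prob_space M1 by fact
  interpret M2: prob_space M2 by fact
  show ?thesis using M2.emeasure_pair_measure_Times[OF assms(3,4)] by (simp add: measure_def enn2real_mult)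
qed

lemma real_distribution_binop:
  assumes "real_distribution N1" "real_distribution N2"
    and f: "(\<lambda>p. f (fst p) (snd p)) \<in> borel_measurable (borel \<Otimes>\<^sub>M borel)"
  shows "real_distribution (distr (N1 \<Otimes>\<^sub>M N2) borel (\<lambda>(x, y). f x y))"
    and "ccdf (distr (N1 \<Otimes>\<^sub>M N2) borel (\<lambda>(x, y). f x y)) t = measure (N1 \<Otimes>\<^sub>M N2) {(x, y). f x y > t}"
proof -
  interpret N1: real_distribution N1 by fact
  interpret N2: real_distribution N2 by fact
  interpret P: pair_prob_space N1 N2 ..
  have "sets (N1 \<Otimes>\<^sub>M N2) = sets (borel \<Otimes>\<^sub>M borel)"
    by (intro sets_pair_measure_cong) auto
  then have m: "(\<lambda>(x, y). f x y) \<in> borel_measurable (N1 \<Otimes>\<^sub>M N2)"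
    using f by (simp add: case_prod_unfold cong: measurable_cong_sets)
  then show "real_distribution (distr (N1 \<Otimes>\<^sub>M N2) borel (\<lambda>(x, y). f x y))"
    by (rule P.real_distribution_distr)
  have "ccdf (distr (N1 \<Otimes>\<^sub>M N2) borel (\<lambda>(x, y). f x y)) t
      = measure (N1 \<Otimes>\<^sub>M N2) ((\<lambda>(x, y). f x y) -` {t<..} \<inter> space (N1 \<Otimes>\<^sub>M N2))"
    by (rule measure_distr[OF m]) simp
  also have "(\<lambda>(x, y). f x y) -` {t<..} \<inter> space (N1 \<Otimes>\<^sub>M N2) = {(x, y). f x y > t}"
    by (auto simp: space_pair_measure)
  finally show "ccdf (distr (N1 \<Otimes>\<^sub>M N2) borel (\<lambda>(x, y). f x y)) t = measure (N1 \<Otimes>\<^sub>M N2) {(x, y). f x y > t}" .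
qed

lemma real_distribution_conv:
  "real_distribution N1 \<Longrightarrow> real_distribution N2 \<Longrightarrow> real_distribution (N1 \<star> N2)"
  unfolding convolution_def by (rule real_distribution_binop) measurable

lemma ccdf_conv:
  "real_distribution N1 \<Longrightarrow> real_distribution N2 \<Longrightarrow>
    ccdf (N1 \<star> N2) x = measure (N1 \<Otimes>\<^sub>M N2) {(y, z). y + z > x}"
  unfolding convolution_def by (rule real_distribution_binop) measurable

section \<open>Convolution equivalence\<close>

text \<open>As in the definition of the class, L is just some finite limit; its relation to the
  exponential moment of \<nu> is derived below.\<close>

locale conv_equiv_law = real_distribution \<nu> for \<nu> :: "real measure" +
  fixes \<alpha> L :: real
  assumes \<alpha>_nonneg: "\<alpha> \<ge> 0"
    and supp: "measure \<nu> {..<0} = 0"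
    and pos: "\<And>x. measure \<nu> {x<..} > 0"
    and long: "\<And>y. ((\<lambda>x. measure \<nu> {x - y<..} / measure \<nu> {x<..}) \<longlongrightarrow> exp (\<alpha> * y)) at_top"
    and conv: "((\<lambda>x. measure (\<nu> \<star> \<nu>) {x<..} / measure \<nu> {x<..}) \<longlongrightarrow> L) at_top"
begin

abbreviation T :: "real \<Rightarrow> real" where "T x \<equiv> measure \<nu> {x<..}"

lemmas T_mono = ccdf_mono[OF real_distribution_axioms]
lemmas T_meas [measurable] = ccdf_measurable[OF real_distribution_axioms]
lemmas pair_pred = sets_pair_Collect[OF real_distribution_axioms real_distribution_axioms]
lemmas measure_conv = ccdf_conv[OF real_distribution_axioms real_distribution_axioms]

lemma AE_nonneg: "AE v in \<nu>. v \<ge> 0"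
proof -
  have "AE v in \<nu>. v \<notin> {..<0}"
    by (rule AE_not_in) (use supp in \<open>auto simp: null_sets_def emeasure_eq_measure\<close>)
  then show ?thesis by eventually_elim auto
qed

sublocale PP: pair_prob_space \<nu> \<nu> ..

definition trunc_m :: "real \<Rightarrow> real" where
  "trunc_m A = (\<integral>a. indicator {..A} a * exp (\<alpha> * a) \<partial>\<nu>)"

lemma measure_head:
  "measure (\<nu> \<Otimes>\<^sub>M \<nu>) {(a, b). a \<le> A \<and> a + b > x} = (\<integral>a. indicator {..A} a * T (x - a) \<partial>\<nu>)"
proof -
  have eq: "measure \<nu> (Pair a -` {(a, b). a \<le> A \<and> a + b > x}) = indicator {..A} a * T (x - a)" for a
  proof -
    have "Pair a -` {(a, b). a \<le> A \<and> a + b > x} = (if a \<le> A then {x - a<..} else {})" by auto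
    then show ?thesis by (auto split: split_indicator)
  qed
  have Q: "{(a, b). a \<le> A \<and> a + b > x} \<in> sets (\<nu> \<Otimes>\<^sub>M \<nu>)"
    by (rule pair_pred) measurable
  show ?thesis
    using measure_pair_eq_integral[OF prob_space_axioms prob_space_axioms Q] unfolding eq .
qed

text \<open>Dominated convergence: for a \<le> A the ratio \<open>T (x - a) / T x\<close> is at most
  its value at a = A, which stays bounded for large x.\<close>

lemma head_tendsto:
  "((\<lambda>x. measure (\<nu> \<Otimes>\<^sub>M \<nu>) {(a, b). a \<le> A \<and> a + b > x} / T x) \<longlongrightarrow> trunc_m A) at_top"
proof -
  have "((\<lambda>x. \<integral>a. indicator {..A} a * (T (x - a) / T x) \<partial>\<nu>) \<longlongrightarrow> trunc_m A) at_top"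
    unfolding trunc_m_def
  proof (rule integral_dominated_convergence_at_top)
    show "integrable \<nu> (\<lambda>_. exp (\<alpha> * A) + 1)" by simp
    have "eventually (\<lambda>x. T (x - A) / T x < exp (\<alpha> * A) + 1) at_top"
      by (rule order_tendstoD(2)[OF long]) simp
    then show "\<forall>\<^sub>F x in at_top. AE a in \<nu>. norm (indicator {..A} a * (T (x - a) / T x)) \<le> exp (\<alpha> * A) + 1"
    proof eventually_elim
      case (elim x)
      have "norm (indicator {..A} a * (T (x - a) / T x)) \<le> exp (\<alpha> * A) + 1" for a
      proof (cases "a \<le> A")
        case True
        then have "T (x - a) / T x \<le> T (x - A) / T x"
          by (intro divide_right_mono T_mono) auto
        then show ?thesis using True elim by auto
      qed (auto intro: add_nonneg_nonneg)
      then show ?case by simp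
    qed
    show "AE a in \<nu>. ((\<lambda>x. indicator {..A} a * (T (x - a) / T x)) \<longlongrightarrow> indicator {..A} a * exp (\<alpha> * a)) at_top"
      by (intro always_eventually allI tendsto_intros long)
  qed measurable
  moreover have "(\<integral>a. indicator {..A} a * (T (x - a) / T x) \<partial>\<nu>)
      = measure (\<nu> \<Otimes>\<^sub>M \<nu>) {(a, b). a \<le> A \<and> a + b > x} / T x" for x
    unfolding measure_head by simp
  ultimately show ?thesis by (simp only:)
qed

lemma trunc_le: "trunc_m A \<le> L"
proof (rule tendsto_le[OF _ conv head_tendsto])
  have "measure (\<nu> \<Otimes>\<^sub>M \<nu>) {(a, b). a \<le> A \<and> a + b > x} \<le> measure (\<nu> \<Otimes>\<^sub>M \<nu>) {(a, b). a + b > x}" for x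
    by (intro PP.finite_measure_mono pair_pred) (auto, measurable)
  then show "\<forall>\<^sub>F x in at_top. measure (\<nu> \<Otimes>\<^sub>M \<nu>) {(a, b). a \<le> A \<and> a + b > x} / T x
      \<le> measure (\<nu> \<star> \<nu>) {x<..} / T x"
    by (intro always_eventually allI divide_right_mono) (auto simp: measure_conv)
qed auto

text \<open>The truncated moments increase with the truncation level and are all at most L, so
  monotone convergence applies.\<close>

lemma exp_integrable: "integrable \<nu> (\<lambda>a. exp (\<alpha> * a))"
  and trunc_tendsto: "(\<lambda>n. trunc_m (real n)) \<longlonglongrightarrow> (\<integral>a. exp (\<alpha> * a) \<partial>\<nu>)"
proof -
  have int: "integrable \<nu> (\<lambda>a. indicator {..A} a * exp (\<alpha> * a))" for A
    by (rule integrable_const_bound[where B="exp (\<alpha> * A)"])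
       (auto split: split_indicator intro: mult_left_mono \<alpha>_nonneg)
  have "incseq (\<lambda>n. trunc_m (real n))"
    unfolding trunc_m_def by (intro incseq_SucI integral_mono int) (auto split: split_indicator)
  then obtain l where l: "(\<lambda>n. trunc_m (real n)) \<longlonglongrightarrow> l"
    by (rule incseq_convergent) (use trunc_le in auto)
  have lim: "AE a in \<nu>. (\<lambda>n. indicator {..real n} a * exp (\<alpha> * a)) \<longlonglongrightarrow> exp (\<alpha> * a)"
  proof (intro always_eventually allI)
    fix a :: real
    have "\<forall>\<^sub>F n in sequentially. indicator {..real n} a * exp (\<alpha> * a) = exp (\<alpha> * a)"
      using eventually_ge_at_top[of "nat \<lceil>a\<rceil>"]
    proof eventually_elim
      case (elim n)
      then have "a \<le> real n" by linarith
      then show ?case by simp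
    qed
    then show "(\<lambda>n. indicator {..real n} a * exp (\<alpha> * a)) \<longlonglongrightarrow> exp (\<alpha> * a)"
      by (rule tendsto_eventually)
  qed
  have mono: "AE a in \<nu>. mono (\<lambda>n::nat. indicator {..real n} a * exp (\<alpha> * a))"
    by (intro always_eventually allI monoI) (auto split: split_indicator)
  show "integrable \<nu> (\<lambda>a. exp (\<alpha> * a))"
    by (rule integrable_monotone_convergence[OF int mono lim l[unfolded trunc_m_def]]) measurable
  have "(\<integral>a. exp (\<alpha> * a) \<partial>\<nu>) = l"
    by (rule integral_monotone_convergence[OF int mono lim l[unfolded trunc_m_def]]) measurable
  then show "(\<lambda>n. trunc_m (real n)) \<longlonglongrightarrow> (\<integral>a. exp (\<alpha> * a) \<partial>\<nu>)" using l by simp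
qed

section \<open>The limit constant of a convolution equivalent law\<close>

definition m :: real where "m = (\<integral>a. exp (\<alpha> * a) \<partial>\<nu>)"

text \<open>As \<open>\<epsilon> \<rightarrow> 0\<close>, with \<open>t\<close> chosen so that the mean of \<open>\<psi> \<epsilon> t\<close> under \<open>\<nu>\<close> stays near a fixed
  \<open>\<delta> > 0\<close>, all of this mean comes from arbitrarily large \<open>v\<close>, where the tail of \<open>\<nu> \<star> \<nu>\<close> is about
  \<open>L\<close> times that of \<open>\<nu>\<close>. Hence the mean under \<open>\<nu> \<star> \<nu>\<close> is about \<open>L \<delta>\<close>, whereas submultiplicativity
  of \<open>exp (\<epsilon> min v t)\<close> bounds it by \<open>(m + \<delta>)\<^sup>2 - m\<^sup>2\<close>. This gives \<open>L \<le> 2 m + \<delta>\<close>.\<close>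

definition \<psi> :: "real \<Rightarrow> nat \<Rightarrow> real \<Rightarrow> real" where
  "\<psi> \<epsilon> t v = exp (\<alpha> * max v 0) * (exp (\<epsilon> * min (max v 0) (real t)) - 1)"

lemma \<psi>_nonneg: "\<epsilon> \<ge> 0 \<Longrightarrow> \<psi> \<epsilon> t v \<ge> 0"
  unfolding \<psi>_def by auto

lemma \<psi>_mono: "\<epsilon> \<ge> 0 \<Longrightarrow> mono (\<psi> \<epsilon> t)"
  unfolding \<psi>_def by (intro monoI mult_mono) (auto intro!: mult_left_mono simp: \<alpha>_nonneg)

lemma \<psi>_cont: "continuous_on UNIV (\<psi> \<epsilon> t)"
  unfolding \<psi>_def by (intro continuous_intros)

lemma \<psi>_meas [measurable]: "\<psi> \<epsilon> t \<in> borel_measurable borel"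
  using \<psi>_cont by (rule borel_measurable_continuous_onI)

lemma \<psi>_integrable: "\<epsilon> \<ge> 0 \<Longrightarrow> integrable \<nu> (\<psi> \<epsilon> t)"
proof (rule Bochner_Integration.integrable_bound)
  assume \<epsilon>: "\<epsilon> \<ge> 0"
  show "integrable \<nu> (\<lambda>a. exp (\<epsilon> * real t) * exp (\<alpha> * a))" using exp_integrable by simp
  show "AE v in \<nu>. norm (\<psi> \<epsilon> t v) \<le> norm (exp (\<epsilon> * real t) * exp (\<alpha> * v))"
    using AE_nonneg
  proof eventually_elim
    case (elim v)
    have "exp (\<epsilon> * min v (real t)) - 1 \<le> exp (\<epsilon> * real t)"
    proof -
      have "exp (\<epsilon> * min v (real t)) \<le> exp (\<epsilon> * real t)" using \<epsilon> by (auto intro: mult_left_mono)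
      then show ?thesis by linarith
    qed
    then show ?case using elim \<epsilon> unfolding \<psi>_def by (auto simp: mult.commute)
  qed
qed measurable

definition D :: "real \<Rightarrow> nat \<Rightarrow> real" where "D \<epsilon> t = (\<integral>v. \<psi> \<epsilon> t v \<partial>\<nu>)"

lemma D_0: "D \<epsilon> 0 = 0" unfolding D_def \<psi>_def by simp

text \<open>Raising the level t by one multiplies \<open>exp (\<epsilon> * min v t)\<close> by at
  most \<open>exp \<epsilon>\<close>; adding m cancels the -1 in \<open>\<psi>\<close>. For small
  \<epsilon> the means thus grow in small steps and cannot jump far over a prescribed value.\<close>

lemma D_Suc: assumes "\<epsilon> \<ge> 0" shows "D \<epsilon> (Suc t) + m \<le> exp \<epsilon> * (D \<epsilon> t + m)"
proof -
  have "D \<epsilon> (Suc t) + m = (\<integral>v. \<psi> \<epsilon> (Suc t) v + exp (\<alpha> * v) \<partial>\<nu>)"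
    unfolding D_def m_def using assms by (simp add: \<psi>_integrable exp_integrable)
  also have "\<dots> \<le> (\<integral>v. exp \<epsilon> * (\<psi> \<epsilon> t v + exp (\<alpha> * v)) \<partial>\<nu>)"
  proof (rule integral_mono_AE)
    show "AE v in \<nu>. \<psi> \<epsilon> (Suc t) v + exp (\<alpha> * v) \<le> exp \<epsilon> * (\<psi> \<epsilon> t v + exp (\<alpha> * v))"
      using AE_nonneg
    proof eventually_elim
      case (elim v)
      have "\<epsilon> * min v (real (Suc t)) \<le> \<epsilon> * (1 + min v (real t))" using assms by (intro mult_left_mono) auto
      then have "exp (\<epsilon> * min v (real (Suc t))) \<le> exp \<epsilon> * exp (\<epsilon> * min v (real t))"
        by (simp add: exp_add[symmetric] algebra_simps)
      then have "exp (\<alpha> * v) * exp (\<epsilon> * min v (real (Suc t))) \<le> exp (\<alpha> * v) * (exp \<epsilon> * exp (\<epsilon> * min v (real t)))"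
        by (rule mult_left_mono) simp
      then show ?case using elim unfolding \<psi>_def by (simp add: algebra_simps)
    qed
  qed (use assms \<psi>_integrable exp_integrable in auto)
  also have "\<dots> = exp \<epsilon> * (D \<epsilon> t + m)"
    unfolding D_def m_def using assms by (simp add: \<psi>_integrable exp_integrable)
  finally show ?thesis .
qed

text \<open>Boundedness would, by a Markov-type estimate, make \<open>T t\<close> of order
  \<open>exp (- (\<alpha> + \<epsilon>) * t)\<close>. But \<open>T (x + 1) / T x\<close> tends to
  \<open>exp (- \<alpha>)\<close>, so T cannot decay at an exponential rate larger than
  \<alpha>.\<close>

lemma D_unbounded:
  assumes "\<epsilon> > 0" "\<delta> > 0" shows "\<exists>t. D \<epsilon> t \<ge> \<delta>"
proof (rule ccontr)
  assume "\<nexists>t. D \<epsilon> t \<ge> \<delta>"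
  then have lt: "D \<epsilon> t < \<delta>" for t by (meson not_le)
  have mk: "exp (\<alpha> * real t) * (exp (\<epsilon> * real t) - 1) * T (real t) < \<delta>" for t
  proof -
    have "exp (\<alpha> * real t) * (exp (\<epsilon> * real t) - 1) * T (real t)
        = (\<integral>v. \<psi> \<epsilon> t (real t) * indicator {real t<..} v \<partial>\<nu>)"
      by (simp add: \<psi>_def)
    also have "\<dots> \<le> D \<epsilon> t" unfolding D_def
    proof (rule integral_mono)
      show "\<psi> \<epsilon> t (real t) * indicator {real t<..} v \<le> \<psi> \<epsilon> t v" for v
        using \<psi>_mono[of \<epsilon> t] \<psi>_nonneg[of \<epsilon> t v] assms
        by (auto split: split_indicator intro: monoD)
      have "integrable \<nu> (indicator {real t<..} :: real \<Rightarrow> real)"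
        by (rule integrable_const_bound[where B=1]) auto
      then show "integrable \<nu> (\<lambda>v. \<psi> \<epsilon> t (real t) * indicator {real t<..} v)" by simp
      show "integrable \<nu> (\<psi> \<epsilon> t)" using assms by (intro \<psi>_integrable) simp
    qed
    finally show ?thesis using lt[of t] by simp
  qed
  \<comment> \<open>Any decay rate strictly between \<alpha> and \<alpha> + \<epsilon> serves; the
    midpoint is taken.\<close>
  define q where "q = exp (- (\<alpha> + \<epsilon>/2))"
  have "\<forall>\<^sub>F x in at_top. T (x + 1) / T x > q"
  proof -
    have "((\<lambda>x. T (x - (-1)) / T x) \<longlongrightarrow> exp (\<alpha> * (-1))) at_top" by (rule long)
    moreover have "q < exp (\<alpha> * (-1))" using assms by (simp add: q_def)
    ultimately show ?thesis by (auto dest: order_tendstoD(1))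
  qed
  then obtain x0 where x0: "\<And>x. x \<ge> x0 \<Longrightarrow> T (x + 1) / T x > q" by (auto simp: eventually_at_top_linorder)
  obtain n0 :: nat where n0: "real n0 \<ge> x0" using real_arch_simple by blast
  have geo: "T (real (n0 + k)) \<ge> q ^ k * T (real n0)" for k
  proof (induction k)
    case (Suc k)
    have "T (real (n0 + k) + 1) \<ge> q * T (real (n0 + k))"
      using x0[of "real (n0 + k)"] n0 pos[of "real (n0 + k)"] by (auto simp: field_simps)
    moreover have "q * T (real (n0 + k)) \<ge> q * (q ^ k * T (real n0))" using Suc by (intro mult_left_mono) (auto simp: q_def)
    ultimately show ?case by (simp add: ac_simps)
  qed simp
  define c where "c = T (real n0) / q ^ n0"
  have c: "c > 0" using pos by (simp add: c_def q_def)
  have "exp (\<epsilon> / 2 * real k) \<le> \<delta> / c + 1" if "k \<ge> n0" for k :: nat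
  proof -
    define j where "j = k - n0"
    have j: "k = n0 + j" using that by (simp add: j_def)
    have "q ^ k * c \<le> T (real k)"
      using geo[of j] by (simp add: j c_def power_add q_def)
    moreover have "q ^ k = exp (- (\<alpha> + \<epsilon>/2) * real k)"
      unfolding q_def by (subst exp_of_nat_mult[symmetric]) (simp only: mult.commute)
    ultimately have "exp (\<alpha> * real k) * (exp (\<epsilon> * real k) - 1) * (exp (- (\<alpha> + \<epsilon>/2) * real k) * c)
        \<le> exp (\<alpha> * real k) * (exp (\<epsilon> * real k) - 1) * T (real k)"
      using assms by (intro mult_left_mono) auto
    then have "exp (\<alpha> * real k) * (exp (\<epsilon> * real k) - 1) * (exp (- (\<alpha> + \<epsilon>/2) * real k) * c) < \<delta>"
      using mk[of k] by (rule le_less_trans)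
    moreover have "exp (\<alpha> * real k) * (exp (\<epsilon> * real k) - 1) * (exp (- (\<alpha> + \<epsilon>/2) * real k) * c)
      = (exp (\<epsilon>/2 * real k) - exp (- (\<epsilon>/2) * real k)) * c"
    proof -
      have "exp (\<alpha> * real k) * exp (\<epsilon> * real k) * exp (- (\<alpha> + \<epsilon>/2) * real k) = exp (\<epsilon>/2 * real k)"
        "exp (\<alpha> * real k) * exp (- (\<alpha> + \<epsilon>/2) * real k) = exp (- (\<epsilon>/2) * real k)"
        unfolding exp_add[symmetric] by (rule arg_cong[where f=exp], simp add: field_simps)+
      moreover have "u * (v - 1) * (w * c) = (u * v * w - u * w) * c" for u v w :: real
        by (simp add: algebra_simps)
      ultimately show ?thesis by (simp only:)
    qed
    ultimately have "(exp (\<epsilon>/2 * real k) - exp (- (\<epsilon>/2) * real k)) * c < \<delta>" by (simp only:)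
    then have "exp (\<epsilon>/2 * real k) - exp (- (\<epsilon>/2) * real k) < \<delta> / c" using c by (simp add: field_simps)
    moreover have "exp (- (\<epsilon>/2) * real k) \<le> 1" using assms by simp
    ultimately show ?thesis by linarith
  qed
  moreover have "filterlim (\<lambda>k::nat. exp (\<epsilon> / 2 * real k)) at_top sequentially"
    using assms by real_asymp
  then have "\<forall>\<^sub>F k in sequentially. exp (\<epsilon> / 2 * real k) > \<delta> / c + 1" by (auto simp: filterlim_at_top_dense)
  ultimately show False
    by (metis (no_types, lifting) eventually_sequentially linorder_not_less nle_le)
qed

text \<open>With \<open>e a = exp (\<alpha> * a)\<close>, submultiplicativity bounds
  \<open>\<psi> (a + b)\<close> by \<open>(\<psi> a + e a) * (\<psi> b + e b) - e a * e b\<close>.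
  Expanding and integrating over both variables gives
  \<open>(D + m)\<^sup>2 - m\<^sup>2\<close>.\<close>

lemma nn_conv_bound:
  assumes "\<epsilon> \<ge> 0"
  shows "(\<integral>\<^sup>+v. \<psi> \<epsilon> t v \<partial>(\<nu> \<star> \<nu>)) \<le> ennreal (2 * m * D \<epsilon> t + (D \<epsilon> t)\<^sup>2)"
proof -
  let ?g = "\<lambda>a. \<psi> \<epsilon> t a" and ?e = "\<lambda>a. exp (\<alpha> * a)"
  have fin: "finite_measure \<nu>" by (rule finite_measure_axioms)
  have D0: "D \<epsilon> t \<ge> 0" unfolding D_def using assms by (intro integral_nonneg_AE) (simp add: \<psi>_nonneg)
  have m0: "m \<ge> 0" unfolding m_def by (intro integral_nonneg_AE) simp
  have ig: "(\<integral>\<^sup>+a. ?g a \<partial>\<nu>) = D \<epsilon> t" unfolding D_def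
    using assms by (intro nn_integral_eq_integral \<psi>_integrable) (auto simp: \<psi>_nonneg)
  have ie: "(\<integral>\<^sup>+a. ?e a \<partial>\<nu>) = m" unfolding m_def
    by (intro nn_integral_eq_integral exp_integrable) auto
  have "(\<integral>\<^sup>+v. \<psi> \<epsilon> t v \<partial>(\<nu> \<star> \<nu>)) = (\<integral>\<^sup>+a. \<integral>\<^sup>+b. \<psi> \<epsilon> t (a + b) \<partial>\<nu> \<partial>\<nu>)"
    by (rule nn_integral_convolution) (auto simp: fin)
  also have "\<dots> \<le> (\<integral>\<^sup>+a. \<integral>\<^sup>+b. ennreal (?g a * ?e b + ?e a * ?g b + ?g a * ?g b) \<partial>\<nu> \<partial>\<nu>)"
  proof (rule nn_integral_mono_AE, rule AE_mp[OF AE_nonneg], intro AE_I2 impI)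
    fix a :: real assume a: "a \<ge> 0"
    show "(\<integral>\<^sup>+b. \<psi> \<epsilon> t (a + b) \<partial>\<nu>) \<le> (\<integral>\<^sup>+b. ennreal (?g a * ?e b + ?e a * ?g b + ?g a * ?g b) \<partial>\<nu>)"
    proof (rule nn_integral_mono_AE, rule AE_mp[OF AE_nonneg], intro AE_I2 impI ennreal_leI)
      fix b :: real assume b: "b \<ge> 0"
      have "\<epsilon> * min (a + b) (real t) \<le> \<epsilon> * (min a (real t) + min b (real t))"
        using a b assms by (intro mult_left_mono) auto
      then have "exp (\<epsilon> * min (a + b) (real t)) \<le> exp (\<epsilon> * min a (real t)) * exp (\<epsilon> * min b (real t))"
        by (simp add: exp_add[symmetric] algebra_simps)
      then have "?e a * ?e b * exp (\<epsilon> * min (a + b) (real t)) \<le> ?e a * ?e b * (exp (\<epsilon> * min a (real t)) * exp (\<epsilon> * min b (real t)))"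
        by (rule mult_left_mono) simp
      then show "\<psi> \<epsilon> t (a + b) \<le> ?g a * ?e b + ?e a * ?g b + ?g a * ?g b"
        using a b by (simp add: \<psi>_def algebra_simps exp_add)
    qed
  qed
  also have "\<dots> = (\<integral>\<^sup>+a. ennreal (?g a * m + ?e a * D \<epsilon> t + ?g a * D \<epsilon> t) \<partial>\<nu>)"
  proof (intro nn_integral_cong)
    fix a :: real
    show "(\<integral>\<^sup>+b. ennreal (?g a * ?e b + ?e a * ?g b + ?g a * ?g b) \<partial>\<nu>) = ennreal (?g a * m + ?e a * D \<epsilon> t + ?g a * D \<epsilon> t)"
      using assms D0 m0 by (simp add: \<psi>_nonneg nn_integral_add nn_integral_cmult ig ie ennreal_mult')
  qed
  also have "\<dots> = ennreal (D \<epsilon> t * m + m * D \<epsilon> t + D \<epsilon> t * D \<epsilon> t)"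
  proof -
    have "(\<integral>\<^sup>+a. ennreal (?g a * m + ?e a * D \<epsilon> t + ?g a * D \<epsilon> t) \<partial>\<nu>)
        = ennreal (\<integral>a. ?g a * m + ?e a * D \<epsilon> t + ?g a * D \<epsilon> t \<partial>\<nu>)"
    proof (rule nn_integral_eq_integral)
      show "integrable \<nu> (\<lambda>a. ?g a * m + ?e a * D \<epsilon> t + ?g a * D \<epsilon> t)"
        using assms by (simp add: \<psi>_integrable exp_integrable)
    qed (use assms D0 m0 in \<open>auto intro!: add_nonneg_nonneg mult_nonneg_nonneg \<psi>_nonneg\<close>)
    also have "(\<integral>a. ?g a * m + ?e a * D \<epsilon> t + ?g a * D \<epsilon> t \<partial>\<nu>) = D \<epsilon> t * m + m * D \<epsilon> t + D \<epsilon> t * D \<epsilon> t"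
      using assms by (simp add: \<psi>_integrable exp_integrable D_def[symmetric] m_def[symmetric])
    finally show ?thesis .
  qed
  also have "D \<epsilon> t * m + m * D \<epsilon> t + D \<epsilon> t * D \<epsilon> t = 2 * m * D \<epsilon> t + (D \<epsilon> t)\<^sup>2"
    by (simp add: power2_eq_square)
  finally show ?thesis .
qed

text \<open>For 2 m < L' < L, the tail comparison beyond x0 gives
  \<open>L' * D \<le> L' * B + 2 * m * D + D\<^sup>2\<close>, where B bounds the contribution of
  levels below \<open>\<psi> \<epsilon> t x0\<close>. Since B is negligible for small \<epsilon>
  while D stays between \<delta> and 2 \<delta>, this is contradictory.\<close>

lemma L_le: "L \<le> 2 * m"
proof (rule ccontr)
  assume "\<not> L \<le> 2 * m"
  then obtain L' where L': "2 * m < L'" "L' < L" using dense not_le by meson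
  have m0: "m \<ge> 0" unfolding m_def by (intro integral_nonneg_AE) simp
  have "\<forall>\<^sub>F x in at_top. measure (\<nu> \<star> \<nu>) {x<..} / T x > L'"
    by (rule order_tendstoD(1)[OF conv L'(2)])
  then obtain x1 where x1: "\<And>x. x \<ge> x1 \<Longrightarrow> measure (\<nu> \<star> \<nu>) {x<..} / T x > L'"
    by (auto simp: eventually_at_top_linorder)
  define x0 where "x0 = max x1 0"
  have dom: "T x \<le> (1 / L') * measure (\<nu> \<star> \<nu>) {x<..}" if "x \<ge> x0" for x
    using x1[of x] that pos[of x] m0 L' by (simp add: x0_def field_simps)
  \<comment> \<open>Now L' - 2 m = 4 \<delta>, so D \<le> 2 \<delta> leaves L' - 2 m - D \<ge> 2
    \<delta>. The first condition on \<epsilon> below keeps L' B under 2 \<delta>^2; the second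
    limits the overshoot of D to 2 \<delta>.\<close>
  define \<delta> where "\<delta> = (L' - 2 * m) / 4"
  have \<delta>: "\<delta> > 0" using L' by (simp add: \<delta>_def)
  have "\<forall>\<^sub>F \<epsilon> in at_right 0. L' * (exp (\<alpha> * x0) * (exp (\<epsilon> * x0) - 1)) < 2 * \<delta>\<^sup>2 \<and> exp \<epsilon> * (\<delta> + m) < 2 * \<delta> + m \<and> \<epsilon> > 0"
  proof (intro eventually_conj)
    have "((\<lambda>\<epsilon>. L' * (exp (\<alpha> * x0) * (exp (\<epsilon> * x0) - 1))) \<longlongrightarrow> L' * (exp (\<alpha> * x0) * (exp (0 * x0) - 1))) (at_right 0)"
      by (intro tendsto_intros)
    then show "\<forall>\<^sub>F \<epsilon> in at_right 0. L' * (exp (\<alpha> * x0) * (exp (\<epsilon> * x0) - 1)) < 2 * \<delta>\<^sup>2"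
      by (rule order_tendstoD) (use \<delta> in simp)
    have "((\<lambda>\<epsilon>. exp \<epsilon> * (\<delta> + m)) \<longlongrightarrow> exp 0 * (\<delta> + m)) (at_right 0)"
      by (intro tendsto_intros)
    then show "\<forall>\<^sub>F \<epsilon> in at_right 0. exp \<epsilon> * (\<delta> + m) < 2 * \<delta> + m"
      by (rule order_tendstoD) (use \<delta> in simp)
    show "\<forall>\<^sub>F \<epsilon>::real in at_right 0. \<epsilon> > 0" by (simp add: eventually_at_right_less)
  qed
  then obtain \<epsilon> where e: "L' * (exp (\<alpha> * x0) * (exp (\<epsilon> * x0) - 1)) < 2 * \<delta>\<^sup>2" "exp \<epsilon> * (\<delta> + m) < 2 * \<delta> + m" "\<epsilon> > 0"
    by (auto dest: eventually_happens'[rotated])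
  \<comment> \<open>Minimality keeps the preceding value of D below \<delta>; a predecessor exists
    because D is 0 at level 0.\<close>
  define t where "t = (LEAST t. D \<epsilon> t \<ge> \<delta>)"
  have t: "D \<epsilon> t \<ge> \<delta>" unfolding t_def by (rule LeastI_ex) (rule D_unbounded[OF e(3) \<delta>])
  then obtain s where s: "t = Suc s" using \<delta> D_0 by (cases t) auto
  have "D \<epsilon> s < \<delta>" using not_less_Least[of s "\<lambda>t. D \<epsilon> t \<ge> \<delta>"] s t_def by auto
  then have "exp \<epsilon> * (D \<epsilon> s + m) \<le> exp \<epsilon> * (\<delta> + m)" by simp
  then have D2: "D \<epsilon> t \<le> 2 * \<delta>" using D_Suc[of \<epsilon> s] e(2,3) unfolding s by linarith
  define B where "B = exp (\<alpha> * x0) * (exp (\<epsilon> * x0) - 1)"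
  have rd: "real_distribution (\<nu> \<star> \<nu>)"
    by (rule real_distribution_conv[OF real_distribution_axioms real_distribution_axioms])
  have "ennreal (D \<epsilon> t) = (\<integral>\<^sup>+v. \<psi> \<epsilon> t v \<partial>\<nu>)" unfolding D_def
    using e by (intro nn_integral_eq_integral[symmetric] \<psi>_integrable) (auto simp: \<psi>_nonneg)
  also have "\<dots> \<le> \<psi> \<epsilon> t x0 + ennreal (1 / L') * (\<integral>\<^sup>+v. \<psi> \<epsilon> t v \<partial>(\<nu> \<star> \<nu>))"
    using e m0 L' by (intro nn_integral_tail_comparison real_distribution_axioms rd \<psi>_mono \<psi>_cont dom) (auto simp: \<psi>_nonneg)
  also have "\<dots> \<le> \<psi> \<epsilon> t x0 + ennreal (1 / L') * ennreal (2 * m * D \<epsilon> t + (D \<epsilon> t)\<^sup>2)"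
    using e by (intro add_left_mono mult_left_mono nn_conv_bound) auto
  also have "\<dots> = ennreal (\<psi> \<epsilon> t x0 + (1 / L') * (2 * m * D \<epsilon> t + (D \<epsilon> t)\<^sup>2))"
  proof -
    have "ennreal (1 / L') * ennreal (2 * m * D \<epsilon> t + (D \<epsilon> t)\<^sup>2) = ennreal ((1 / L') * (2 * m * D \<epsilon> t + (D \<epsilon> t)\<^sup>2))"
      using m0 L' t \<delta> by (intro ennreal_mult[symmetric]) auto
    then show ?thesis using e m0 L' t \<delta> by (simp only:) (intro ennreal_plus[symmetric], auto simp: \<psi>_nonneg)
  qed
  finally have "D \<epsilon> t \<le> \<psi> \<epsilon> t x0 + (1 / L') * (2 * m * D \<epsilon> t + (D \<epsilon> t)\<^sup>2)"
    using e m0 L' t \<delta> by (subst (asm) ennreal_le_iff) (auto intro!: add_nonneg_nonneg \<psi>_nonneg)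
  also have "\<psi> \<epsilon> t x0 \<le> B" unfolding \<psi>_def B_def x0_def using e by (auto intro!: mult_left_mono)
  finally have "L' * D \<epsilon> t \<le> L' * B + (2 * m * D \<epsilon> t + (D \<epsilon> t)\<^sup>2)"
    using L' m0 by (simp add: field_simps)
  then have "D \<epsilon> t * (L' - 2 * m - D \<epsilon> t) \<le> L' * B" by (simp add: algebra_simps power2_eq_square)
  moreover have "D \<epsilon> t * (L' - 2 * m - D \<epsilon> t) \<ge> \<delta> * (2 * \<delta>)"
    using t D2 \<delta> by (intro mult_mono) (auto simp: \<delta>_def)
  ultimately show False using e(1) by (simp add: B_def power2_eq_square)
qed

text \<open>The whole event has probability about \<open>L * T x\<close>, and each of the two events
  with one coordinate at most A has about \<open>trunc_m A * T x\<close>. As L \<le> 2 m and the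
  truncated moments tend to m, little is left for two large coordinates.\<close>

lemma middle_negligible:
  assumes "\<epsilon> > 0"
  shows "\<exists>A\<ge>0. \<forall>\<^sub>F x in at_top. measure (\<nu> \<Otimes>\<^sub>M \<nu>) {(a, b). A < a \<and> a \<le> x - A \<and> a + b > x} \<le> \<epsilon> * T x"
proof -
  have "\<forall>\<^sub>F n in sequentially. trunc_m (real n) > m - \<epsilon> / 2"
    by (rule order_tendstoD(1)[OF trunc_tendsto]) (use assms in \<open>simp add: m_def\<close>)
  then obtain n :: nat where n: "trunc_m (real n) > m - \<epsilon> / 2" by (auto simp: eventually_sequentially)
  define A where "A = real n"
  let ?P = "measure (\<nu> \<Otimes>\<^sub>M \<nu>)"
  let ?E1 = "\<lambda>x. {(a, b). a \<le> A \<and> a + b > x}"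
  let ?E2 = "\<lambda>x. {(a, b). b \<le> A \<and> a + b > x}"
  let ?E3 = "\<lambda>x. {(a, b). A < a \<and> a \<le> x - A \<and> a + b > x}"
  have swap: "?P (?E2 x) = ?P (?E1 x)" for x
  proof -
    have E: "?E1 x \<in> sets (\<nu> \<Otimes>\<^sub>M \<nu>)" by (rule pair_pred) measurable
    have "?P (?E1 x) = measure (distr (\<nu> \<Otimes>\<^sub>M \<nu>) (\<nu> \<Otimes>\<^sub>M \<nu>) (\<lambda>(x, y). (y, x))) (?E1 x)"
      using PP.distr_pair_swap by simp
    also have "\<dots> = ?P ((\<lambda>(x, y). (y, x)) -` ?E1 x \<inter> space (\<nu> \<Otimes>\<^sub>M \<nu>))"
      by (rule measure_distr[OF _ E]) measurable
    also have "(\<lambda>(x, y). (y, x)) -` ?E1 x \<inter> space (\<nu> \<Otimes>\<^sub>M \<nu>) = ?E2 x"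
      by (auto simp: space_pair_measure add.commute)
    finally show ?thesis by simp
  qed
  have "((\<lambda>x. measure (\<nu> \<star> \<nu>) {x<..} / T x - 2 * (?P (?E1 x) / T x)) \<longlongrightarrow> L - 2 * trunc_m A) at_top"
    by (intro tendsto_intros conv head_tendsto)
  moreover have "L - 2 * trunc_m A < \<epsilon>" using L_le n by (simp add: A_def)
  ultimately have "\<forall>\<^sub>F x in at_top. measure (\<nu> \<star> \<nu>) {x<..} / T x - 2 * (?P (?E1 x) / T x) < \<epsilon>"
    by (rule order_tendstoD(2))
  then have "\<forall>\<^sub>F x in at_top. ?P (?E3 x) \<le> \<epsilon> * T x"
    using eventually_gt_at_top[of "2 * A"]
  proof eventually_elim
    case (elim x)
    have [measurable]: "?E1 x \<in> sets (\<nu> \<Otimes>\<^sub>M \<nu>)" "?E2 x \<in> sets (\<nu> \<Otimes>\<^sub>M \<nu>)" "?E3 x \<in> sets (\<nu> \<Otimes>\<^sub>M \<nu>)"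
      by (rule pair_pred; measurable)+
    \<comment> \<open>The three events are disjoint: \<open>?E1\<close> and \<open>?E2\<close>
      because x > 2 A, \<open>?E3\<close> and \<open>?E1\<close> because of a > A,
      \<open>?E3\<close> and \<open>?E2\<close> because a \<le> x - A and a + b > x force b >
      A.\<close>
    have "?P (?E1 x) + ?P (?E2 x) + ?P (?E3 x) = ?P (?E1 x \<union> ?E2 x \<union> ?E3 x)"
    proof -
      have "?P (?E1 x \<union> ?E2 x \<union> ?E3 x) = ?P (?E1 x \<union> ?E2 x) + ?P (?E3 x)"
        by (rule PP.finite_measure_Union) (measurable, auto)
      also have "?P (?E1 x \<union> ?E2 x) = ?P (?E1 x) + ?P (?E2 x)"
        using elim(2) by (intro PP.finite_measure_Union) (measurable, auto)
      finally show ?thesis by simp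
    qed
    also have "\<dots> \<le> ?P {(a, b). a + b > x}"
    proof (rule PP.finite_measure_mono)
      show "{(a, b). a + b > x} \<in> sets (\<nu> \<Otimes>\<^sub>M \<nu>)" by (rule pair_pred) measurable
    qed auto
    finally have "?P (?E3 x) \<le> measure (\<nu> \<star> \<nu>) {x<..} - 2 * ?P (?E1 x)"
      by (simp add: swap measure_conv)
    also have "\<dots> \<le> \<epsilon> * T x" using elim(1) pos[of x] by (simp add: field_simps)
    finally show ?case .
  qed
  then show ?thesis by (intro exI[of _ A]) (simp add: A_def)
qed

end

section \<open>Products and sums of independent variables\<close>

abbreviation (input) mom :: "real \<Rightarrow> real measure \<Rightarrow> real" where
  "mom \<alpha> N \<equiv> pos_moment N \<alpha> (\<lambda>z. z)"

text \<open>A restricted multiplicative convolution: if f is the tail of Z, independent of Y with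
  law N, and S consists of positive numbers, this is the probability that Y lies in S and Y Z >
  x.\<close>

abbreviation (input) mconv :: "real measure \<Rightarrow> (real \<Rightarrow> real) \<Rightarrow> real set \<Rightarrow> real \<Rightarrow> real" where
  "mconv N f S x \<equiv> \<integral>y. indicator S y * f (x / y) \<partial>N"

definition prod_law :: "real measure \<Rightarrow> real measure \<Rightarrow> real measure" where
  "prod_law N1 N2 = distr (N1 \<Otimes>\<^sub>M N2) borel (\<lambda>(y, z). y * z)"

lemma real_distribution_prod_law:
  "real_distribution N1 \<Longrightarrow> real_distribution N2 \<Longrightarrow> real_distribution (prod_law N1 N2)"
  unfolding prod_law_def by (rule real_distribution_binop) measurable

lemma ccdf_prod_law:
  "real_distribution N1 \<Longrightarrow> real_distribution N2 \<Longrightarrow>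
    ccdf (prod_law N1 N2) x = measure (N1 \<Otimes>\<^sub>M N2) {(y, z). y * z > x}"
  unfolding prod_law_def by (rule real_distribution_binop) measurable

text \<open>\<open>RVF\<close> and \<open>RVG\<close> compare the deviation from regular variation
  with the mixture tail, since the tail of LF or of LG may be negligible against it or vanish.
  \<open>middle\<close> is the multiplicative form of the statement that two large coordinates are
  negligible.\<close>

locale tail_pair =
  fixes LF LG H :: "real measure" and \<alpha> :: real
  assumes LF: "real_distribution LF" and LG: "real_distribution LG" and H: "real_distribution H"
    and \<alpha>_nonneg: "\<alpha> \<ge> 0"
    and LG_pos: "measure LG {..0} = 0"
    and H_eq: "\<And>x. ccdf H x = (ccdf LF x + ccdf LG x) / 2"
    and H_pos: "\<And>x. ccdf H x > 0"
    and RVF: "\<And>y. y > 0 \<Longrightarrow> ((\<lambda>x. (ccdf LF (x / y) - y powr \<alpha> * ccdf LF x) / ccdf H x) \<longlongrightarrow> 0) at_top"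
    and RVG: "\<And>y. y > 0 \<Longrightarrow> ((\<lambda>x. (ccdf LG (x / y) - y powr \<alpha> * ccdf LG x) / ccdf H x) \<longlongrightarrow> 0) at_top"
    and H_moment: "integrable H (\<lambda>z. max z 0 powr \<alpha>)"
    and middle: "\<And>\<epsilon>. \<epsilon> > 0 \<Longrightarrow> \<exists>A\<ge>1. \<forall>\<^sub>F x in at_top.
       mconv LG (ccdf H) {A<..x / A} x \<le> \<epsilon> * ccdf H x"
begin

interpretation LF: real_distribution LF by (rule LF)
interpretation LG: real_distribution LG by (rule LG)
interpretation H: real_distribution H by (rule H)

abbreviation h :: "real \<Rightarrow> real" where "h \<equiv> ccdf H"

lemma TF_le: "ccdf LF x \<le> 2 * h x" and TG_le: "ccdf LG x \<le> 2 * h x"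
  by (simp_all add: H_eq)

lemma h_RV0: "y > 0 \<Longrightarrow> ((\<lambda>x. (h (x / y) - y powr \<alpha> * h x) / h x) \<longlongrightarrow> 0) at_top"
proof -
  assume y: "y > 0"
  have "((\<lambda>x. ((ccdf LF (x / y) - y powr \<alpha> * ccdf LF x) / h x + (ccdf LG (x / y) - y powr \<alpha> * ccdf LG x) / h x) / 2) \<longlongrightarrow> (0 + 0) / 2) at_top"
    by (intro tendsto_intros RVF RVG y) simp
  moreover have "((ccdf LF (x / y) - y powr \<alpha> * ccdf LF x) / h x + (ccdf LG (x / y) - y powr \<alpha> * ccdf LG x) / h x) / 2
     = (h (x / y) - y powr \<alpha> * h x) / h x" for x
  proof -
    have "(h (x / y) - y powr \<alpha> * h x) * 2 = (ccdf LF (x / y) - y powr \<alpha> * ccdf LF x) + (ccdf LG (x / y) - y powr \<alpha> * ccdf LG x)"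
      unfolding H_eq[of x] H_eq[of "x / y"] by (simp add: field_simps)
    then show ?thesis unfolding add_divide_distrib[symmetric] by (metis divide_divide_eq_left' nonzero_mult_div_cancel_right zero_neq_numeral divide_divide_eq_left)
  qed
  ultimately show ?thesis by simp
qed

lemma h_RV: "y > 0 \<Longrightarrow> ((\<lambda>x. h (x / y) / h x) \<longlongrightarrow> y powr \<alpha>) at_top"
proof -
  assume "y > 0"
  then have "((\<lambda>x. (h (x / y) - y powr \<alpha> * h x) / h x + y powr \<alpha>) \<longlongrightarrow> 0 + y powr \<alpha>) at_top"
    by (intro tendsto_add h_RV0 tendsto_const)
  moreover have "(h (x / y) - y powr \<alpha> * h x) / h x + y powr \<alpha> = h (x / y) / h x" for x
    using H_pos[of x] by (simp add: field_simps)
  ultimately show ?thesis by simp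
qed

lemma h_scale_le:
  assumes "y > 0" "c > y powr \<alpha>" shows "\<forall>\<^sub>F x in at_top. h (x / y) \<le> c * h x"
proof -
  have "\<forall>\<^sub>F x in at_top. h (x / y) / h x < c" using order_tendstoD(2)[OF h_RV[OF assms(1)] assms(2)] .
  then show ?thesis
  proof eventually_elim
    case (elim x) then show ?case using H_pos[of x] by (simp add: field_simps)
  qed
qed

lemma moment_integrable:
  assumes N: "real_distribution N" and K: "\<And>x. x \<ge> x0 \<Longrightarrow> ccdf N x \<le> K * h x"
  shows "integrable N (\<lambda>z. max z 0 powr \<alpha>)"
\<comment> \<open>For \<alpha> = 0 the integrand is the discontinuous indicator of z > 0, to which
  the tail comparison does not apply.\<close>
proof (cases "\<alpha> = 0")
  case True
  interpret real_distribution N by fact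
  show ?thesis unfolding True
    by (rule integrable_const_bound[where B=1]) (auto simp: max_def)
next
  case False
  interpret real_distribution N by fact
  have [measurable]: "(\<lambda>z. max z 0 powr \<alpha>) \<in> borel_measurable borel" by measurable
  have "(\<integral>\<^sup>+z. ennreal (max z 0 powr \<alpha>) \<partial>N) \<le> ennreal (max x0 0 powr \<alpha>) + ennreal (max K 0) * (\<integral>\<^sup>+z. ennreal (max z 0 powr \<alpha>) \<partial>H)"
  proof (rule nn_integral_tail_comparison[OF N H])
    show "mono (\<lambda>z. max z 0 powr \<alpha>)" using \<alpha>_nonneg by (intro monoI powr_mono2) auto
    show "continuous_on UNIV (\<lambda>z. max z 0 powr \<alpha>)"
      using False \<alpha>_nonneg by (intro continuous_on_powr' continuous_intros) auto
    show "ccdf N x \<le> max K 0 * h x" if "x \<ge> x0" for x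
      using K[OF that] H_pos[of x] by (auto intro!: order_trans[OF K[OF that]] mult_right_mono)
  qed auto
  also have "(\<integral>\<^sup>+z. ennreal (max z 0 powr \<alpha>) \<partial>H) = ennreal (\<integral>z. max z 0 powr \<alpha> \<partial>H)"
    by (intro nn_integral_eq_integral H_moment) auto
  also have "ennreal (max x0 0 powr \<alpha>) + ennreal (max K 0) * ennreal (\<integral>z. max z 0 powr \<alpha> \<partial>H) < \<infinity>"
    by (simp add: ennreal_mult_less_top)
  finally show ?thesis by (intro integrableI_bounded) auto
qed

lemma LG_moment: "integrable LG (\<lambda>z. max z 0 powr \<alpha>)"
  by (rule moment_integrable[OF LG TG_le])

definition tmom :: "real measure \<Rightarrow> real \<Rightarrow> real" where
  "tmom N A = (\<integral>y. indicator {0<..A} y * y powr \<alpha> \<partial>N)"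

lemma tmom_integrable:
  assumes "real_distribution N" "A \<ge> 0"
  shows "integrable N (\<lambda>y. indicator {0<..A} y * y powr \<alpha>)"
proof -
  interpret real_distribution N by fact
  show ?thesis
    by (rule integrable_const_bound[where B="A powr \<alpha>"])
       (auto split: split_indicator intro!: AE_I2 powr_mono2 \<alpha>_nonneg)
qed

text \<open>Dominated convergence over the bounded factor: the integrand tends to 0 for each y > 0,
  and for y \<le> A monotonicity gives \<open>f (x / y) \<le> 2 * h (x / A)\<close>, which is of
  order \<open>h x\<close>. The abstract f covers LF, LG and H at once.\<close>

lemma restricted_product:
  assumes N: "real_distribution N" and [measurable]: "f \<in> borel_measurable borel"
    and f: "\<And>x. 0 \<le> f x" "\<And>x. f x \<le> 2 * h x"
    and RV: "\<And>y. y > 0 \<Longrightarrow> ((\<lambda>x. (f (x / y) - y powr \<alpha> * f x) / h x) \<longlongrightarrow> 0) at_top"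
    and A: "A > 0"
  shows "((\<lambda>x. (mconv N f {0<..A} x - tmom N A * f x) / h x) \<longlongrightarrow> 0) at_top"
proof -
  interpret N: real_distribution N by fact
  have f2: "f x \<le> 2" for x using f(2)[of x] H.prob_le_1[of "{x<..}"] by linarith
  have int1: "integrable N (\<lambda>y. indicator {0<..A} y * f (x / y))" for x
    by (rule N.integrable_const_bound[where B=2]) (use f2 f(1) in \<open>auto split: split_indicator\<close>)
  have eq: "(\<integral>y. indicator {0<..A} y * ((f (x / y) - y powr \<alpha> * f x) / h x) \<partial>N)
      = (mconv N f {0<..A} x - tmom N A * f x) / h x" for x
  proof -
    have "(\<integral>y. indicator {0<..A} y * ((f (x / y) - y powr \<alpha> * f x) / h x) \<partial>N)
      = (\<integral>y. (indicator {0<..A} y * f (x / y) - (indicator {0<..A} y * y powr \<alpha>) * f x) / h x \<partial>N)"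
      by (intro Bochner_Integration.integral_cong) (auto split: split_indicator)
    also have "\<dots> = (\<integral>y. indicator {0<..A} y * f (x / y) - (indicator {0<..A} y * y powr \<alpha>) * f x \<partial>N) / h x"
      by simp
    also have "\<dots> = (mconv N f {0<..A} x - tmom N A * f x) / h x"
      unfolding tmom_def using A by (subst Bochner_Integration.integral_diff) (auto intro!: int1 tmom_integrable N)
    finally show ?thesis .
  qed
  have "((\<lambda>x. \<integral>y. indicator {0<..A} y * ((f (x / y) - y powr \<alpha> * f x) / h x) \<partial>N) \<longlongrightarrow> (\<integral>y. 0 \<partial>N)) at_top"
  proof (rule integral_dominated_convergence_at_top)
    show "integrable N (\<lambda>_. 4 * (A powr \<alpha> + 1))" by simp
    show "\<forall>\<^sub>F x in at_top. AE y in N. norm (indicator {0<..A} y * ((f (x / y) - y powr \<alpha> * f x) / h x)) \<le> 4 * (A powr \<alpha> + 1)"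
      using h_scale_le[OF A, of "A powr \<alpha> + 1", simplified] eventually_ge_at_top[of 0]
    proof eventually_elim
      case (elim x)
      have "norm (indicator {0<..A} y * ((f (x / y) - y powr \<alpha> * f x) / h x)) \<le> 4 * (A powr \<alpha> + 1)" for y
      proof (cases "y \<in> {0<..A}")
        case True
        have "x / A \<le> x / y" using True elim A by (intro divide_left_mono) auto
        then have "h (x / y) \<le> h (x / A)" by (rule ccdf_mono[OF H])
        then have 1: "f (x / y) \<le> 2 * (A powr \<alpha> + 1) * h x" using f(2)[of "x / y"] elim by (simp only: mult.assoc)
        have "y powr \<alpha> * f x \<le> A powr \<alpha> * (2 * h x)"
          using True \<alpha>_nonneg f by (intro mult_mono powr_mono2) auto
        then have 2: "y powr \<alpha> * f x \<le> 2 * (A powr \<alpha> + 1) * h x" using H_pos[of x] by (simp add: algebra_simps)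
        have "\<bar>f (x / y) - y powr \<alpha> * f x\<bar> \<le> 4 * (A powr \<alpha> + 1) * h x"
          using 1 2 f(1)[of "x/y"] mult_nonneg_nonneg[OF powr_ge_zero f(1)[of x], of y \<alpha>] by linarith
        then show ?thesis using True H_pos[of x] by (simp add: field_simps)
      qed simp
      then show ?case by simp
    qed
    show "AE y in N. ((\<lambda>x. indicator {0<..A} y * ((f (x / y) - y powr \<alpha> * f x) / h x)) \<longlongrightarrow> 0) at_top"
    proof (intro always_eventually allI)
      fix y show "((\<lambda>x. indicator {0<..A} y * ((f (x / y) - y powr \<alpha> * f x) / h x)) \<longlongrightarrow> 0) at_top"
        using RV[of y] by (cases "y \<in> {0<..A}") auto
    qed
  qed (measurable)
  then show ?thesis unfolding eq by simp
qed

lemma negligible_eventually: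
  assumes "((\<lambda>x. f x / h x) \<longlongrightarrow> 0) at_top" "\<eta> > 0"
  shows "\<forall>\<^sub>F x in at_top. \<bar>f x\<bar> \<le> \<eta> * h x"
proof -
  have "\<forall>\<^sub>F x in at_top. \<bar>f x / h x\<bar> < \<eta>"
    using tendsto_rabs_zero[OF assms(1)] assms(2) by (rule order_tendstoD(2))
  then show ?thesis
  proof eventually_elim
    case (elim x) then show ?case using H_pos[of x] by (simp add: field_simps abs_divide)
  qed
qed

lemma
  assumes N: "real_distribution N" and A: "A > 0" and \<eta>: "\<eta> > 0"
  shows restricted_LF: "\<forall>\<^sub>F x in at_top. \<bar>mconv N (ccdf LF) {0<..A} x - tmom N A * ccdf LF x\<bar> \<le> \<eta> * h x"
    and restricted_LG: "\<forall>\<^sub>F x in at_top. \<bar>mconv N (ccdf LG) {0<..A} x - tmom N A * ccdf LG x\<bar> \<le> \<eta> * h x"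
    and restricted_H: "\<forall>\<^sub>F x in at_top. \<bar>mconv N h {0<..A} x - tmom N A * h x\<bar> \<le> \<eta> * h x"
  by (rule negligible_eventually[OF restricted_product[OF N] \<eta>];
      use ccdf_measurable[OF LF] ccdf_measurable[OF LG] ccdf_measurable[OF H] in
        \<open>auto intro: TF_le TG_le RVF RVG h_RV0 A\<close>)+

text \<open>The last inequality is Markov's estimate applied to the moment beyond A. It compensates
  the factor \<open>A powr \<alpha>\<close> that arises from \<open>h (x / A)\<close> when both
  factors of a product exceed A.\<close>

lemma tmom_le:
  assumes N: "real_distribution N" and I: "integrable N (\<lambda>z. max z 0 powr \<alpha>)" and A: "A \<ge> 0"
  shows "tmom N A \<le> mom \<alpha> N" and "0 \<le> tmom N A"
    and "A powr \<alpha> * ccdf N A \<le> mom \<alpha> N - tmom N A"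
proof -
  interpret real_distribution N by fact
  show "tmom N A \<le> mom \<alpha> N" unfolding tmom_def pos_moment_def
    by (intro integral_mono tmom_integrable N A I) (auto split: split_indicator)
  show "0 \<le> tmom N A" unfolding tmom_def by (intro integral_nonneg_AE) auto
  have iA: "integrable N (indicator {A<..} :: real \<Rightarrow> real)"
    by (rule integrable_const_bound[where B=1]) auto
  have "tmom N A + A powr \<alpha> * ccdf N A = (\<integral>y. indicator {0<..A} y * y powr \<alpha> + A powr \<alpha> * indicator {A<..} y \<partial>N)"
    unfolding tmom_def by (subst Bochner_Integration.integral_add) (auto intro!: tmom_integrable N A iA)
  also have "\<dots> \<le> mom \<alpha> N" unfolding pos_moment_def
    by (intro integral_mono I Bochner_Integration.integrable_add tmom_integrable N A integrable_mult_right iA)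
       (use A \<alpha>_nonneg in \<open>auto split: split_indicator intro!: powr_mono2\<close>)
  finally show "A powr \<alpha> * ccdf N A \<le> mom \<alpha> N - tmom N A" by simp
qed

lemma tmom_tendsto:
  assumes N: "real_distribution N" and I: "integrable N (\<lambda>z. max z 0 powr \<alpha>)"
  shows "(tmom N \<longlongrightarrow> mom \<alpha> N) at_top"
proof -
  interpret real_distribution N by fact
  show ?thesis unfolding tmom_def[abs_def] pos_moment_def
  proof (rule integral_dominated_convergence_at_top[OF _ _ I])
    show "AE y in N. ((\<lambda>A. indicator {0<..A} y * y powr \<alpha>) \<longlongrightarrow> max y 0 powr \<alpha>) at_top"
    proof (intro always_eventually allI)
      fix y :: real
      have "\<forall>\<^sub>F A in at_top. indicator {0<..A} y * y powr \<alpha> = max y 0 powr \<alpha>"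
        using eventually_ge_at_top[of y] by eventually_elim (auto split: split_indicator)
      then show "((\<lambda>A. indicator {0<..A} y * y powr \<alpha>) \<longlongrightarrow> max y 0 powr \<alpha>) at_top" by (rule tendsto_eventually)
    qed
  qed (auto intro!: always_eventually split: split_indicator)
qed

text \<open>Up to the null event Y \<le> 0, the event Y Z > x splits into Y \<le> A, A < Y \<le>
  x/A, 0 < Z \<le> A, and the corner Y > x/A, Z > A. In the third case Y > x/A is automatic, and x >
  A^2, that is x/A > A, makes the pieces disjoint.\<close>

lemma product_split:
  assumes N: "real_distribution N" and A: "A \<ge> 1" and x: "x > A\<^sup>2"
  shows "ccdf (prod_law LG N) x =
      mconv LG (ccdf N) {0<..A} x + mconv LG (ccdf N) {A<..x / A} x
      + mconv N (ccdf LG) {0<..A} x + ccdf LG (x / A) * ccdf N A"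
proof -
  interpret N: real_distribution N by fact
  interpret P: pair_prob_space LG N ..
  have x0: "x > 0" using x A by (smt (verit) zero_le_power2)
  have xA: "x / A > A" using x A by (simp add: field_simps power2_eq_square)
  let ?P = "measure (LG \<Otimes>\<^sub>M N)"
  define E0 E1 E2 E3 E4 where "E0 = {(y, z). y \<le> 0 \<and> y * z > x}"
    and "E1 = {(y, z). 0 < y \<and> y \<le> A \<and> y * z > x}"
    and "E2 = {(y, z). A < y \<and> y \<le> x / A \<and> y * z > x}"
    and "E3 = {(y, z). 0 < z \<and> z \<le> A \<and> y * z > x}"
    and "E4 = {x / A<..} \<times> {A<..}"
  have E0: "E0 \<in> sets (LG \<Otimes>\<^sub>M N)" unfolding E0_def by (rule sets_pair_Collect[OF LG N]) measurable
  have E1: "E1 \<in> sets (LG \<Otimes>\<^sub>M N)" unfolding E1_def by (rule sets_pair_Collect[OF LG N]) measurable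
  have E2: "E2 \<in> sets (LG \<Otimes>\<^sub>M N)" unfolding E2_def by (rule sets_pair_Collect[OF LG N]) measurable
  have E3: "E3 \<in> sets (LG \<Otimes>\<^sub>M N)" unfolding E3_def by (rule sets_pair_Collect[OF LG N]) measurable
  have E4: "E4 \<in> sets (LG \<Otimes>\<^sub>M N)" unfolding E4_def by (rule pair_measureI) auto
  have big: "y > x / A" if "y * z > x" "0 < z" "z \<le> A" for y z
  proof -
    have "y > 0" using that x0 by (smt (verit) mult_nonpos_nonneg)
    then have "y * z \<le> y * A" using that by (intro mult_left_mono) auto
    then show ?thesis using that A by (simp add: field_simps)
  qed
  have eq: "{(y, z). y * z > x} = E0 \<union> E1 \<union> E2 \<union> E3 \<union> E4"
  proof (intro equalityI subsetI)
    fix p assume p: "p \<in> {(y, z). y * z > x}"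
    obtain y z where yz: "p = (y, z)" "y * z > x" using p by auto
    show "p \<in> E0 \<union> E1 \<union> E2 \<union> E3 \<union> E4"
    proof (cases "y \<le> 0")
      case False
      then have "z > 0" using yz(2) x0 by (smt (verit) mult_nonneg_nonpos)
      then show ?thesis using yz False by (auto simp: E0_def E1_def E2_def E3_def E4_def)
    qed (use yz in \<open>auto simp: E0_def\<close>)
  next
    fix p assume p: "p \<in> E0 \<union> E1 \<union> E2 \<union> E3 \<union> E4"
    have "y * z > x" if "y > x / A" "z > A" for y z
    proof -
      have "(x / A) * A < y * z" using that A x0 xA by (intro mult_strict_mono) auto
      then show ?thesis using A by simp
    qed
    then show "p \<in> {(y, z). y * z > x}" using p by (auto simp: E0_def E1_def E2_def E3_def E4_def)
  qed
  have z0: "?P E0 = 0"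
  proof -
    have "?P E0 \<le> ?P ({..0} \<times> UNIV)"
      by (rule P.finite_measure_mono) (auto simp: E0_def)
    also have "\<dots> = 0" using LG_pos
      by (subst measure_pair_Times) (auto simp: LG.prob_space_axioms N.prob_space_axioms)
    finally show ?thesis using measure_nonneg[of "LG \<Otimes>\<^sub>M N" E0] by simp
  qed
  have d: "E0 \<inter> E1 = {}" "(E0 \<union> E1) \<inter> E2 = {}" "(E0 \<union> E1 \<union> E2) \<inter> E3 = {}" "(E0 \<union> E1 \<union> E2 \<union> E3) \<inter> E4 = {}"
  proof -
    show "E0 \<inter> E1 = {}" "(E0 \<union> E1) \<inter> E2 = {}" using A by (auto simp: E0_def E1_def E2_def)
    show "(E0 \<union> E1 \<union> E2) \<inter> E3 = {}"
      using big xA A by (fastforce simp: E0_def E1_def E2_def E3_def)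
    show "(E0 \<union> E1 \<union> E2 \<union> E3) \<inter> E4 = {}"
      using xA A by (auto simp: E0_def E1_def E2_def E3_def E4_def)
  qed
  have "ccdf (prod_law LG N) x = ?P (E0 \<union> E1 \<union> E2 \<union> E3 \<union> E4)"
    by (simp add: ccdf_prod_law[OF LG N] eq)
  also have "\<dots> = ?P (E0 \<union> E1 \<union> E2 \<union> E3) + ?P E4"
    by (intro P.finite_measure_Union sets.Un E0 E1 E2 E3 E4 d)
  also have "?P (E0 \<union> E1 \<union> E2 \<union> E3) = ?P (E0 \<union> E1 \<union> E2) + ?P E3"
    by (intro P.finite_measure_Union sets.Un E0 E1 E2 E3 E4 d)
  also have "?P (E0 \<union> E1 \<union> E2) = ?P (E0 \<union> E1) + ?P E2"
    by (intro P.finite_measure_Union sets.Un E0 E1 E2 E3 E4 d)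
  also have "?P (E0 \<union> E1) = ?P E0 + ?P E1"
    by (intro P.finite_measure_Union sets.Un E0 E1 E2 E3 E4 d)
  also have "?P E4 = ccdf LG (x / A) * ccdf N A" unfolding E4_def
    by (rule measure_pair_Times) (auto simp: LG.prob_space_axioms N.prob_space_axioms)
  also have "?P E1 = mconv LG (ccdf N) {0<..A} x"
    unfolding measure_pair_eq_integral[OF LG.prob_space_axioms N.prob_space_axioms E1]
  proof (intro Bochner_Integration.integral_cong refl)
    fix y
    have "Pair y -` E1 = (if y \<in> {0<..A} then {x / y<..} else {})"
      by (auto simp: E1_def field_simps)
    then show "N.prob (Pair y -` E1) = indicator {0<..A} y * ccdf N (x / y)" by (auto split: split_indicator)
  qed
  also have "?P E2 = mconv LG (ccdf N) {A<..x / A} x"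
    unfolding measure_pair_eq_integral[OF LG.prob_space_axioms N.prob_space_axioms E2]
  proof (intro Bochner_Integration.integral_cong refl)
    fix y
    have "Pair y -` E2 = (if y \<in> {A<..x / A} then {x / y<..} else {})"
      using A by (auto simp: E2_def field_simps)
    then show "N.prob (Pair y -` E2) = indicator {A<..x / A} y * ccdf N (x / y)" by (auto split: split_indicator)
  qed
  also have "?P E3 = mconv N (ccdf LG) {0<..A} x"
    unfolding measure_pair_eq_integral_right[OF LG.prob_space_axioms N.prob_space_axioms E3]
  proof (intro Bochner_Integration.integral_cong refl)
    fix z
    have "{y. (y, z) \<in> E3} = (if z \<in> {0<..A} then {x / z<..} else {})"
      by (auto simp: E3_def field_simps)
    then show "LG.prob {y. (y, z) \<in> E3} = indicator {0<..A} z * ccdf LG (x / z)" by (auto split: split_indicator)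
  qed
  finally show ?thesis by (simp add: z0)
qed

lemma middle_mono:
  assumes "1 \<le> A" "A \<le> A'" "x > 0"
  shows "mconv LG h {A'<..x / A'} x \<le> mconv LG h {A<..x / A} x"
proof (rule integral_mono)
  have [measurable]: "h \<in> borel_measurable borel" by (rule ccdf_measurable[OF H])
  have int: "integrable LG (\<lambda>y. indicator {A<..x / A} y * h (x / y))" for A
    by (rule LG.integrable_const_bound[where B=1]) (auto split: split_indicator)
  show "integrable LG (\<lambda>y. indicator {A<..x / A} y * h (x / y))"
    "integrable LG (\<lambda>y. indicator {A'<..x / A'} y * h (x / y))" by (rule int)+
  have "x / A' \<le> x / A" using assms by (intro divide_left_mono) auto
  then show "indicator {A'<..x / A'} y * h (x / y) \<le> indicator {A<..x / A} y * h (x / y)" for y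
    using assms by (auto split: split_indicator)
qed

section \<open>Tail expansions relative to the mixture tail, under scaling and addition\<close>

definition approx :: "real measure \<Rightarrow> real \<Rightarrow> real \<Rightarrow> real \<Rightarrow> bool" where
  "approx N a b D \<longleftrightarrow> (\<forall>\<eta>>0. \<forall>\<^sub>F x in at_top. \<bar>ccdf N x - (a * ccdf LF x + b * ccdf LG x)\<bar> \<le> (D + \<eta>) * h x)"

lemma approx_bound:
  assumes "approx N a b D" "a \<ge> 0" "b \<ge> 0"
  shows "\<forall>\<^sub>F x in at_top. ccdf N x \<le> (2 * a + 2 * b + D + 1) * h x"
proof -
  have "\<forall>\<^sub>F x in at_top. \<bar>ccdf N x - (a * ccdf LF x + b * ccdf LG x)\<bar> \<le> (D + 1) * h x"
    using assms(1) by (simp add: approx_def)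
  then show ?thesis
  proof eventually_elim
    case (elim x)
    have "a * ccdf LF x \<le> a * (2 * h x)" "b * ccdf LG x \<le> b * (2 * h x)"
      by (intro mult_left_mono TF_le TG_le assms)+
    then show ?case using elim by (simp add: algebra_simps)
  qed
qed

lemma approx_moment:
  assumes "real_distribution N" "approx N a b D" "a \<ge> 0" "b \<ge> 0"
  shows "integrable N (\<lambda>z. max z 0 powr \<alpha>)"
proof -
  obtain x0 where "\<And>x. x \<ge> x0 \<Longrightarrow> ccdf N x \<le> (2 * a + 2 * b + D + 1) * h x"
    using approx_bound[OF assms(2-4)] by (auto simp: eventually_at_top_linorder)
  then show ?thesis by (rule moment_integrable[OF assms(1)])
qed

lemma RV_eventually:
  assumes "y > 0" "\<eta> > 0"
  shows "\<forall>\<^sub>F x in at_top. \<bar>ccdf LF (x / y) - y powr \<alpha> * ccdf LF x\<bar> \<le> \<eta> * h x"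
    and "\<forall>\<^sub>F x in at_top. \<bar>ccdf LG (x / y) - y powr \<alpha> * ccdf LG x\<bar> \<le> \<eta> * h x"
  by (rule negligible_eventually[OF RVF[OF assms(1)] assms(2)] negligible_eventually[OF RVG[OF assms(1)] assms(2)])+

lemma scale_at_top:
  assumes "c > 0" "eventually P at_top" shows "\<forall>\<^sub>F x in at_top. P (x / c :: real)"
proof -
  have "filterlim (\<lambda>x. x / c) at_top at_top" using assms(1) by real_asymp
  then show ?thesis using assms(2) by (rule eventually_compose_filterlim[rotated])
qed

text \<open>Replacing x by x/y multiplies h, and with it the error bound, by
  \<open>y powr \<alpha>\<close> asymptotically; the tails of LF and LG are rescaled at the cost of
  o(h) each.\<close>

lemma approx_scale:
  assumes ap: "approx N a b D" "a \<ge> 0" "b \<ge> 0" "D \<ge> 0" and y: "y > 0" and \<eta>: "\<eta> > 0"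
  shows "\<forall>\<^sub>F x in at_top. \<bar>ccdf N (x / y) - y powr \<alpha> * (a * ccdf LF x + b * ccdf LG x)\<bar> \<le> (y powr \<alpha> * D + \<eta>) * h x"
proof -
  let ?p = "y powr \<alpha>"
  \<comment> \<open>The small errors add up to
    \<open>\<eta>1 * (a + b + D + y powr \<alpha> + \<eta>1)\<close>; the minimum with 1 turns the
    last summand into 1.\<close>
  define \<eta>1 where "\<eta>1 = min 1 (\<eta> / (a + b + D + ?p + 1))"
  have p: "?p > 0" using y by simp
  have pos: "a + b + D + ?p + 1 > 0" using ap(2-4) p by linarith
  have \<eta>1: "\<eta>1 > 0" "\<eta>1 \<le> 1" using \<eta> pos by (auto simp: \<eta>1_def)
  have C: "\<eta>1 * (a + b + D + ?p + 1) \<le> \<eta>"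
  proof -
    have "\<eta>1 \<le> \<eta> / (a + b + D + ?p + 1)" by (simp add: \<eta>1_def)
    then show ?thesis using pos by (simp only: pos_le_divide_eq)
  qed
  have "\<forall>\<^sub>F x in at_top. \<bar>ccdf N (x / y) - (a * ccdf LF (x / y) + b * ccdf LG (x / y))\<bar> \<le> (D + \<eta>1) * h (x / y)"
    using ap(1) \<eta>1 by (intro scale_at_top y) (simp add: approx_def)
  moreover have "\<forall>\<^sub>F x in at_top. h (x / y) \<le> (?p + \<eta>1) * h x"
    using y \<eta>1 by (intro h_scale_le) auto
  ultimately show ?thesis using RV_eventually[OF y \<eta>1(1)]
  proof eventually_elim
    case (elim x)
    have 1: "\<bar>a * ccdf LF (x / y) - a * (?p * ccdf LF x)\<bar> \<le> a * (\<eta>1 * h x)"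
      using mult_left_mono[OF elim(3) ap(2)] ap(2) by (simp add: abs_mult right_diff_distrib[symmetric])
    have 2: "\<bar>b * ccdf LG (x / y) - b * (?p * ccdf LG x)\<bar> \<le> b * (\<eta>1 * h x)"
      using mult_left_mono[OF elim(4) ap(3)] ap(3) by (simp add: abs_mult right_diff_distrib[symmetric])
    have 3: "(D + \<eta>1) * h (x / y) \<le> (D + \<eta>1) * ((?p + \<eta>1) * h x)"
      using elim(2) ap \<eta>1 by (intro mult_left_mono) auto
    have "\<bar>ccdf N (x / y) - ?p * (a * ccdf LF x + b * ccdf LG x)\<bar>
        \<le> \<bar>ccdf N (x / y) - (a * ccdf LF (x / y) + b * ccdf LG (x / y))\<bar>
          + \<bar>a * ccdf LF (x / y) - a * (?p * ccdf LF x)\<bar> + \<bar>b * ccdf LG (x / y) - b * (?p * ccdf LG x)\<bar>"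
      by (simp add: algebra_simps)
    also have "\<dots> \<le> (D + \<eta>1) * ((?p + \<eta>1) * h x) + a * (\<eta>1 * h x) + b * (\<eta>1 * h x)"
      using 1 2 3 elim(1) by linarith
    also have "\<dots> = (?p * D + \<eta>1 * (a + b + D + ?p + \<eta>1)) * h x" by (simp add: algebra_simps)
    also have "\<dots> \<le> (?p * D + \<eta>1 * (a + b + D + ?p + 1)) * h x"
      using \<eta>1 H_pos[of x] by (intro mult_right_mono add_left_mono mult_left_mono) auto
    also have "\<dots> \<le> (?p * D + \<eta>) * h x"
      using C H_pos[of x] by (intro mult_right_mono) auto
    finally show ?case .
  qed
qed

text \<open>If the sum exceeds x while both summands are at most (1 - \<delta>) x, then each of them
  exceeds \<delta> x.\<close>

lemma sum_upper:
  assumes N: "real_distribution N" and \<delta>: "0 < \<delta>" "\<delta> < 1"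
  shows "ccdf (LF \<star> N) x \<le> ccdf N ((1 - \<delta>) * x) + ccdf LF ((1 - \<delta>) * x) + ccdf LF (\<delta> * x) * ccdf N (\<delta> * x)"
proof -
  interpret N: real_distribution N by fact
  interpret P: pair_prob_space LF N ..
  let ?P = "measure (LF \<Otimes>\<^sub>M N)"
  have s: "A \<times> B \<in> sets (LF \<Otimes>\<^sub>M N)" if "A \<in> sets borel" "B \<in> sets borel" for A B
    using that by (intro pair_measureI) auto
  have T: "?P (A \<times> B) = LF.prob A * N.prob B" if "A \<in> sets borel" "B \<in> sets borel" for A B
    using that by (intro measure_pair_Times) (auto simp: LF.prob_space_axioms N.prob_space_axioms)
  let ?E1 = "UNIV \<times> {(1 - \<delta>) * x<..}" and ?E2 = "{(1 - \<delta>) * x<..} \<times> UNIV" and ?E3 = "{\<delta> * x<..} \<times> {\<delta> * x<..}"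
  have sub: "{(y, z). y + z > x} \<subseteq> (?E1 \<union> ?E2) \<union> ?E3"
    by (auto simp: algebra_simps)
  have "ccdf (LF \<star> N) x \<le> ?P ((?E1 \<union> ?E2) \<union> ?E3)"
    unfolding ccdf_conv[OF LF N] using sub by (rule P.finite_measure_mono) (intro sets.Un s; simp)
  also have "\<dots> \<le> ?P (?E1 \<union> ?E2) + ?P ?E3" by (rule measure_Un_le) (intro sets.Un s; simp)+
  also have "?P (?E1 \<union> ?E2) \<le> ?P ?E1 + ?P ?E2" by (rule measure_Un_le) (intro s; simp)+
  finally show ?thesis using N.prob_space LF.prob_space by (simp add: T)
qed

text \<open>The sum exceeds x once one summand exceeds (1 + \<delta>) x and the other - \<delta> x.
  The subtracted term is the overlap of these two events.\<close>

lemma sum_lower: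
  assumes N: "real_distribution N" and \<delta>: "0 < \<delta>" and x: "x > 0"
  shows "ccdf (LF \<star> N) x \<ge> ccdf N ((1 + \<delta>) * x) * ccdf LF (- \<delta> * x) + ccdf LF ((1 + \<delta>) * x) * ccdf N (- \<delta> * x)
     - ccdf LF ((1 + \<delta>) * x) * ccdf N ((1 + \<delta>) * x)"
proof -
  interpret N: real_distribution N by fact
  interpret P: pair_prob_space LF N ..
  let ?P = "measure (LF \<Otimes>\<^sub>M N)"
  have s: "A \<times> B \<in> sets (LF \<Otimes>\<^sub>M N)" if "A \<in> sets borel" "B \<in> sets borel" for A B
    using that by (intro pair_measureI) auto
  have T: "?P (A \<times> B) = LF.prob A * N.prob B" if "A \<in> sets borel" "B \<in> sets borel" for A B
    using that by (intro measure_pair_Times) (auto simp: LF.prob_space_axioms N.prob_space_axioms)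
  let ?E1 = "{- \<delta> * x<..} \<times> {(1 + \<delta>) * x<..}" and ?E2 = "{(1 + \<delta>) * x<..} \<times> {- \<delta> * x<..}"
    and ?E3 = "{(1 + \<delta>) * x<..} \<times> {(1 + \<delta>) * x<..}"
  have less: "- \<delta> * x < (1 + \<delta>) * x" using \<delta> x by (intro mult_strict_right_mono) auto
  have "?P (?E1 \<union> ?E2) = ?P (?E1 - ?E3) + ?P ?E2"
  proof -
    have "?E1 \<union> ?E2 = (?E1 - ?E3) \<union> ?E2" using less by auto
    moreover have "?P ((?E1 - ?E3) \<union> ?E2) = ?P (?E1 - ?E3) + ?P ?E2"
    proof (rule P.finite_measure_Union)
      show "(?E1 - ?E3) \<inter> ?E2 = {}" using less by auto
    qed (intro sets.Diff s; simp)+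
    ultimately show ?thesis by simp
  qed
  also have "?P (?E1 - ?E3) = ?P ?E1 - ?P ?E3"
    using less by (intro P.finite_measure_Diff s) auto
  finally have "?P (?E1 \<union> ?E2) = ?P ?E1 + ?P ?E2 - ?P ?E3" by simp
  moreover have "?P (?E1 \<union> ?E2) \<le> ccdf (LF \<star> N) x"
    unfolding ccdf_conv[OF LF N]
  proof (rule P.finite_measure_mono)
    show "?E1 \<union> ?E2 \<subseteq> {(y, z). y + z > x}" by (auto simp: algebra_simps)
    show "{(y, z). y + z > x} \<in> P.events" by (rule sets_pair_Collect[OF LF N]) measurable
  qed
  ultimately show ?thesis by (simp add: T mult.commute)
qed

lemma h_tendsto_0: "(h \<longlongrightarrow> 0) at_top" by (rule ccdf_tendsto_0[OF H])

text \<open>The tail of LF at x/c is of order \<open>h x\<close>, and the tail of N at x/c tends to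
  0.\<close>

lemma product_small:
  assumes N: "real_distribution N" and K: "\<forall>\<^sub>F x in at_top. ccdf N x \<le> K * h x" and c: "c > 0" and \<eta>: "\<eta> > 0"
  shows "\<forall>\<^sub>F x in at_top. ccdf LF (x / c) * ccdf N (x / c) \<le> \<eta> * h x"
proof -
  have "((\<lambda>x. ccdf N (x / c) * (2 * (c powr \<alpha> + 1))) \<longlongrightarrow> 0 * (2 * (c powr \<alpha> + 1))) at_top"
  proof (intro tendsto_intros)
    have "filterlim (\<lambda>x. x / c) at_top at_top" using c by real_asymp
    then show "((\<lambda>x. ccdf N (x / c)) \<longlongrightarrow> 0) at_top" by (rule filterlim_compose[OF ccdf_tendsto_0[OF N]])
  qed
  then have "\<forall>\<^sub>F x in at_top. ccdf N (x / c) * (2 * (c powr \<alpha> + 1)) < \<eta>"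
    by (rule order_tendstoD(2)) (use \<eta> in simp)
  moreover have "\<forall>\<^sub>F x in at_top. h (x / c) \<le> (c powr \<alpha> + 1) * h x" using c by (intro h_scale_le) auto
  ultimately show ?thesis
  proof eventually_elim
    case (elim x)
    have "ccdf LF (x / c) \<le> 2 * ((c powr \<alpha> + 1) * h x)" using TF_le[of "x/c"] elim(2) by linarith
    then have "ccdf LF (x / c) * ccdf N (x / c) \<le> 2 * ((c powr \<alpha> + 1) * h x) * ccdf N (x / c)"
      by (rule mult_right_mono) simp
    also have "\<dots> = (ccdf N (x / c) * (2 * (c powr \<alpha> + 1))) * h x" by (simp add: ac_simps)
    also have "\<dots> \<le> \<eta> * h x" using elim(1) H_pos[of x] by (intro mult_right_mono) auto
    finally show ?case .
  qed
qed

lemma ccdf_neg_tendsto: "real_distribution N \<Longrightarrow> \<delta> > 0 \<Longrightarrow> ((\<lambda>x. ccdf N (- \<delta> * x)) \<longlongrightarrow> 1) at_top"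
proof -
  assume N: "real_distribution N" and \<delta>: "\<delta> > 0"
  then interpret real_distribution N by simp
  have "filterlim (\<lambda>x. - \<delta> * x) at_bot at_top" using \<delta> by real_asymp
  then have "((\<lambda>x. 1 - cdf N (- \<delta> * x)) \<longlongrightarrow> 1 - 0) at_top"
    by (intro tendsto_intros filterlim_compose[OF cdf_lim_at_bot])
  then show ?thesis by (simp add: ccdf_eq[OF N])
qed

lemma approx_LF: "approx LF 1 0 0"
  unfolding approx_def by (auto intro!: always_eventually)

lemma approx_H: "approx H (1 / 2) (1 / 2) 0"
proof -
  have "1 / 2 * ccdf LF x + 1 / 2 * ccdf LG x = h x" for x by (simp add: H_eq)
  then show ?thesis unfolding approx_def by (simp only:) (auto intro!: always_eventually)
qed

text \<open>\<open>approx_scale\<close> with y = 1 / (1 - \<delta>) and y = 1 / (1 + \<delta>),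
  using that \<open>y powr \<alpha>\<close> tends to 1 as y does. The order of quantifiers matters:
  \<delta> is fixed before x tends to infinity.\<close>

lemma approx_near:
  assumes ap: "approx N a b D" "a \<ge> 0" "b \<ge> 0" "D \<ge> 0" and \<eta>: "\<eta> > 0"
  shows "\<forall>\<^sub>F \<delta> in at_right 0.
    (\<forall>\<^sub>F x in at_top. \<bar>ccdf N ((1 - \<delta>) * x) - (a * ccdf LF x + b * ccdf LG x)\<bar> \<le> (D + \<eta>) * h x) \<and>
    (\<forall>\<^sub>F x in at_top. \<bar>ccdf N ((1 + \<delta>) * x) - (a * ccdf LF x + b * ccdf LG x)\<bar> \<le> (D + \<eta>) * h x)"
proof -
  define C where "C = 2 * a + 2 * b + D + 1"
  define \<eta>1 where "\<eta>1 = \<eta> / C"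
  have C: "C > 0" using ap by (simp add: C_def)
  then have \<eta>1: "\<eta>1 > 0" "\<eta>1 * C = \<eta>" using \<eta> by (auto simp: \<eta>1_def)
  have near: "\<forall>\<^sub>F x in at_top. \<bar>ccdf N (x / y) - (a * ccdf LF x + b * ccdf LG x)\<bar> \<le> (D + \<eta>) * h x"
    if y: "y > 0" "\<bar>y powr \<alpha> - 1\<bar> < \<eta>1" for y
    using approx_scale[OF ap y(1) \<eta>1(1)]
  proof eventually_elim
    case (elim x)
    let ?G = "a * ccdf LF x + b * ccdf LG x"
    have "a * ccdf LF x \<le> a * (2 * h x)" "b * ccdf LG x \<le> b * (2 * h x)"
      by (intro mult_left_mono TF_le TG_le ap)+
    then have G: "0 \<le> ?G" "?G \<le> (2 * a + 2 * b) * h x" using ap by (auto simp: algebra_simps)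
    have gen: "\<bar>u * v - v\<bar> = \<bar>u - 1\<bar> * v" if "v \<ge> 0" for u v :: real
      using that by (metis abs_mult abs_of_nonneg left_diff_distrib mult_1)
    have "\<bar>y powr \<alpha> * ?G - ?G\<bar> = \<bar>y powr \<alpha> - 1\<bar> * ?G" by (rule gen[OF G(1)])
    also have "\<dots> \<le> \<eta>1 * ((2 * a + 2 * b) * h x)" using y(2) G \<eta>1 by (intro mult_mono) auto
    finally have 1: "\<bar>y powr \<alpha> * ?G - ?G\<bar> \<le> \<eta>1 * ((2 * a + 2 * b) * h x)" .
    have "y powr \<alpha> * D \<le> (1 + \<eta>1) * D" using y(2) ap by (intro mult_right_mono) auto
    then have "(y powr \<alpha> * D + \<eta>1) * h x \<le> ((1 + \<eta>1) * D + \<eta>1) * h x" by (intro mult_right_mono) auto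
    then have "\<bar>ccdf N (x / y) - ?G\<bar> \<le> ((1 + \<eta>1) * D + \<eta>1) * h x + \<eta>1 * ((2 * a + 2 * b) * h x)"
      using elim 1 by linarith
    also have "\<dots> = (D + \<eta>1 * C) * h x" by (simp add: C_def algebra_simps)
    finally show ?case by (simp only: \<eta>1)
  qed
  have 1: "((\<lambda>\<delta>. \<bar>(1 / (1 - \<delta>)) powr \<alpha> - 1\<bar>) \<longlongrightarrow> \<bar>(1 / (1 - 0)) powr \<alpha> - 1\<bar>) (at_right 0)"
    by (intro tendsto_intros) auto
  have 2: "((\<lambda>\<delta>. \<bar>(1 / (1 + \<delta>)) powr \<alpha> - 1\<bar>) \<longlongrightarrow> \<bar>(1 / (1 + 0)) powr \<alpha> - 1\<bar>) (at_right 0)"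
    by (intro tendsto_intros) auto
  have "\<forall>\<^sub>F \<delta> in at_right 0. \<bar>(1 / (1 - \<delta>)) powr \<alpha> - 1\<bar> < \<eta>1" "\<forall>\<^sub>F \<delta> in at_right 0. \<bar>(1 / (1 + \<delta>)) powr \<alpha> - 1\<bar> < \<eta>1"
    by (rule order_tendstoD(2)[OF 1] order_tendstoD(2)[OF 2]; use \<eta>1 in simp)+
  moreover have "\<forall>\<^sub>F \<delta> in at_right 0. \<delta> \<in> {0<..<1::real}" by (rule eventually_at_right_real) simp
  ultimately show ?thesis
  proof eventually_elim
    case (elim \<delta>)
    have e: "x / (1 / (1 - \<delta>)) = (1 - \<delta>) * x" "x / (1 / (1 + \<delta>)) = (1 + \<delta>) * x" for x
      using elim(3) by (auto simp: field_simps)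
    show ?case using near[OF _ elim(1)] near[OF _ elim(2)] elim(3) unfolding e by auto
  qed
qed

text \<open>One big summand: the bounds of \<open>sum_upper\<close> and \<open>sum_lower\<close>
  agree up to o(h) once \<delta> is small. A large X adds 1 to the coefficient of LF, while the
  error of N is carried over unchanged.\<close>

lemma approx_sum:
  assumes N: "real_distribution N" and ap: "approx N a b D" and nn: "a \<ge> 0" "b \<ge> 0" "D \<ge> 0"
  shows "approx (LF \<star> N) (a + 1) b D"
  unfolding approx_def
proof (intro allI impI)
  fix \<eta> :: real assume \<eta>: "\<eta> > 0"
  define K where "K = 2 * a + 2 * b + D + 1"
  have K: "\<forall>\<^sub>F x in at_top. ccdf N x \<le> K * h x" unfolding K_def by (rule approx_bound[OF ap nn(1,2)])
  have K0: "K \<ge> 1" using nn by (simp add: K_def)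
  \<comment> \<open>K + 6 collects the error terms of the lower bound: 1 from the expansion of N, 1
    from LF, K + 3 from the factors at - \<delta> x, and 1 from the overlap.\<close>
  define \<eta>1 where "\<eta>1 = min 1 (\<eta> / (K + 6))"
  have "\<eta>1 \<le> \<eta> / (K + 6)" by (simp add: \<eta>1_def)
  then have "\<eta>1 * (K + 6) \<le> \<eta>" using K0 by (simp add: pos_le_divide_eq)
  moreover have "\<eta>1 > 0" "\<eta>1 \<le> 1" using \<eta> K0 by (auto simp: \<eta>1_def)
  ultimately have \<eta>1: "\<eta>1 > 0" "\<eta>1 \<le> 1" "\<eta>1 * (K + 6) \<le> \<eta>" by auto
  have "\<forall>\<^sub>F \<delta> in at_right 0. \<delta> \<in> {0<..<1::real}" by (rule eventually_at_right_real) simp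
  then have "\<forall>\<^sub>F \<delta> in at_right 0. \<delta> \<in> {0<..<1} \<and>
    (\<forall>\<^sub>F x in at_top. \<bar>ccdf N ((1 - \<delta>) * x) - (a * ccdf LF x + b * ccdf LG x)\<bar> \<le> (D + \<eta>1) * h x) \<and>
    (\<forall>\<^sub>F x in at_top. \<bar>ccdf N ((1 + \<delta>) * x) - (a * ccdf LF x + b * ccdf LG x)\<bar> \<le> (D + \<eta>1) * h x) \<and>
    (\<forall>\<^sub>F x in at_top. \<bar>ccdf LF ((1 - \<delta>) * x) - ccdf LF x\<bar> \<le> \<eta>1 * h x) \<and>
    (\<forall>\<^sub>F x in at_top. \<bar>ccdf LF ((1 + \<delta>) * x) - ccdf LF x\<bar> \<le> \<eta>1 * h x)"
    using approx_near[OF ap nn \<eta>1(1)] approx_near[OF approx_LF zero_le_one order_refl order_refl \<eta>1(1)]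
    by eventually_elim simp
  then obtain \<delta> where \<delta>: "0 < \<delta>" "\<delta> < 1"
    and ev: "\<forall>\<^sub>F x in at_top. \<bar>ccdf N ((1 - \<delta>) * x) - (a * ccdf LF x + b * ccdf LG x)\<bar> \<le> (D + \<eta>1) * h x"
      "\<forall>\<^sub>F x in at_top. \<bar>ccdf N ((1 + \<delta>) * x) - (a * ccdf LF x + b * ccdf LG x)\<bar> \<le> (D + \<eta>1) * h x"
      "\<forall>\<^sub>F x in at_top. \<bar>ccdf LF ((1 - \<delta>) * x) - ccdf LF x\<bar> \<le> \<eta>1 * h x"
      "\<forall>\<^sub>F x in at_top. \<bar>ccdf LF ((1 + \<delta>) * x) - ccdf LF x\<bar> \<le> \<eta>1 * h x"
    using eventually_happens'[OF trivial_limit_at_right_real] by (metis (no_types, lifting) greaterThanLessThan_iff)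
  have e: "x / (1 / \<delta>) = \<delta> * x" "x / (1 / (1 + \<delta>)) = (1 + \<delta>) * x" for x using \<delta> by (auto simp: field_simps)
  have y: "1 / \<delta> > 0" "1 / (1 + \<delta>) > 0" using \<delta> by auto
  note sm = product_small[OF N K y(1) \<eta>1(1), unfolded e] product_small[OF N K y(2) \<eta>1(1), unfolded e]
  have l1: "\<forall>\<^sub>F x in at_top. ccdf LF (- \<delta> * x) > 1 - \<eta>1" "\<forall>\<^sub>F x in at_top. ccdf N (- \<delta> * x) > 1 - \<eta>1"
    by (rule order_tendstoD(1)[OF ccdf_neg_tendsto[OF LF \<delta>(1)]], use \<eta>1 in simp)
       (rule order_tendstoD(1)[OF ccdf_neg_tendsto[OF N \<delta>(1)]], use \<eta>1 in simp)
  show "\<forall>\<^sub>F x in at_top. \<bar>ccdf (LF \<star> N) x - ((a + 1) * ccdf LF x + b * ccdf LG x)\<bar> \<le> (D + \<eta>) * h x"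
    using ev sm l1 eventually_gt_at_top[of 0]
  proof eventually_elim
    case (elim x)
    let ?G = "a * ccdf LF x + b * ccdf LG x" and ?NP = "ccdf N ((1 + \<delta>) * x)" and ?FP = "ccdf LF ((1 + \<delta>) * x)"
    have "a * ccdf LF x \<le> a * (2 * h x)" "b * ccdf LG x \<le> b * (2 * h x)" "\<eta>1 * h x \<le> 1 * h x"
      by (intro mult_left_mono mult_right_mono TF_le TG_le nn \<eta>1; simp)+
    then have "?NP \<le> K * h x" "?FP \<le> 3 * h x"
      using elim(2,4) TF_le[of x] by (auto simp: K_def algebra_simps abs_le_iff)
    then have k: "\<eta>1 * ?NP \<le> \<eta>1 * (K * h x)" "\<eta>1 * ?FP \<le> \<eta>1 * (3 * h x)"
      using \<eta>1 by (intro mult_left_mono; simp)+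
    have f1: "?NP * ccdf LF (- \<delta> * x) \<ge> ?NP * (1 - \<eta>1)" and f2: "?FP * ccdf N (- \<delta> * x) \<ge> ?FP * (1 - \<eta>1)"
      using elim(7,8) by (intro mult_left_mono; simp)+
    have up: "ccdf (LF \<star> N) x \<le> ?G + ccdf LF x + (D + \<eta>1) * h x + \<eta>1 * h x + \<eta>1 * h x"
      using sum_upper[OF N \<delta>, of x] elim(1,3,5) by linarith
    have lo: "ccdf (LF \<star> N) x \<ge> ?G + ccdf LF x - (D + \<eta>1) * h x - \<eta>1 * h x - \<eta>1 * (K * h x) - \<eta>1 * (3 * h x) - \<eta>1 * h x"
      using sum_lower[OF N \<delta>(1) elim(9)] elim(2,4,6) f1 f2 k unfolding right_diff_distrib mult_1_right mult.commute[of _ \<eta>1] by linarith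
    have "\<bar>ccdf (LF \<star> N) x - (?G + ccdf LF x)\<bar> \<le> (D + \<eta>1) * h x + \<eta>1 * h x + \<eta>1 * (K * h x) + \<eta>1 * (3 * h x) + \<eta>1 * h x"
      using up lo K0 \<eta>1 by (intro abs_leI) (smt (verit) mult_nonneg_nonneg measure_nonneg)+
    also have "\<dots> = (D + \<eta>1 * (K + 6)) * h x" by (simp add: algebra_simps)
    also have "\<dots> \<le> (D + \<eta>) * h x" using \<eta>1 by (intro mult_right_mono) auto
    finally show ?case by (simp add: algebra_simps)
  qed
qed

section \<open>Tail expansions of products\<close>

lemma ind_integrable:
  assumes "real_distribution N" "real_distribution N'" "S \<in> sets borel"
  shows "integrable N' (\<lambda>y. indicator S y * ccdf N (x / y))"
proof -
  interpret N': real_distribution N' by fact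
  note assms(3)[measurable]
  have [measurable]: "ccdf N \<in> borel_measurable borel" by (rule ccdf_measurable) fact
  show ?thesis
    by (rule N'.integrable_const_bound[where B=1]) (auto split: split_indicator intro: ccdf_le_1 assms)
qed

lemma middle_eventually:
  assumes "\<epsilon> > 0"
  shows "\<forall>\<^sub>F A in at_top. \<forall>\<^sub>F x in at_top. mconv LG h {A<..x / A} x \<le> \<epsilon> * h x"
proof -
  obtain A0 where A0: "A0 \<ge> 1" "\<forall>\<^sub>F x in at_top. mconv LG h {A0<..x / A0} x \<le> \<epsilon> * h x"
    using middle[OF assms] by blast
  show ?thesis using eventually_ge_at_top[of A0]
  proof eventually_elim
    case (elim A)
    show ?case using A0(2) eventually_gt_at_top[of 0]
    proof eventually_elim
      case (elim x)
      then show ?case using middle_mono[OF A0(1) \<open>A0 \<le> A\<close> elim(2)] by linarith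
    qed
  qed
qed

lemma ind_mono:
  assumes N: "real_distribution N" and S: "S \<in> sets borel" and K: "\<And>y. y \<in> S \<Longrightarrow> ccdf N (x / y) \<le> K * h (x / y)"
  shows "mconv LG (ccdf N) S x \<le> K * mconv LG h S x"
proof -
  have "mconv LG (ccdf N) S x \<le> (\<integral>y. K * (indicator S y * h (x / y)) \<partial>LG)"
    by (intro integral_mono ind_integrable integrable_mult_right N LG H S) (use K in \<open>auto split: split_indicator\<close>)
  then show ?thesis by simp
qed

lemma middle_arg: "A \<ge> 1 \<Longrightarrow> x > 0 \<Longrightarrow> y \<in> {A<..x / A} \<Longrightarrow> x / y \<ge> A" for A x y :: real
  by (simp add: field_simps)

text \<open>For a bounded factor y the expansion of the tail of N holds at all arguments x/y
  simultaneously, so it can be integrated over y; the three integrals that arise are those of the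
  restricted products.\<close>

lemma head_approx:
  assumes N: "real_distribution N" and ap: "approx N a b D" and nn: "a \<ge> 0" "b \<ge> 0" "D \<ge> 0" and A: "A > 0" and \<eta>: "\<eta> > 0"
  shows "\<forall>\<^sub>F x in at_top. \<bar>mconv LG (ccdf N) {0<..A} x - tmom LG A * (a * ccdf LF x + b * ccdf LG x)\<bar>
    \<le> ((D + \<eta>) * (tmom LG A + \<eta>) + (a + b) * \<eta>) * h x"
proof -
  have "\<forall>\<^sub>F x in at_top. \<bar>ccdf N x - (a * ccdf LF x + b * ccdf LG x)\<bar> \<le> (D + \<eta>) * h x"
    using ap \<eta> by (simp add: approx_def)
  then obtain x1 where x1: "\<And>x. x \<ge> x1 \<Longrightarrow> \<bar>ccdf N x - (a * ccdf LF x + b * ccdf LG x)\<bar> \<le> (D + \<eta>) * h x"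
    by (auto simp: eventually_at_top_linorder)
  let ?J = "\<lambda>N x. mconv LG (ccdf N) {0<..A} x"
  \<comment> \<open>As 0 < y \<le> A, the condition x \<ge> A x1 puts every x/y beyond x1; the
    maximum with 0 takes care of a negative x1.\<close>
  show ?thesis
    using restricted_LF[OF LG A \<eta>]
      restricted_LG[OF LG A \<eta>]
      restricted_H[OF LG A \<eta>]
      eventually_ge_at_top[of "max 0 (A * x1)"]
  proof eventually_elim
    case (elim x)
    have i: "integrable LG (\<lambda>y. indicator {0<..A} y * ccdf N (x / y))" if "real_distribution N" for N
      by (rule ind_integrable[OF that LG]) simp
    have "\<bar>?J N x - (a * ?J LF x + b * ?J LG x)\<bar> =
      \<bar>\<integral>y. indicator {0<..A} y * ccdf N (x / y) - (a * (indicator {0<..A} y * ccdf LF (x / y)) + b * (indicator {0<..A} y * ccdf LG (x / y))) \<partial>LG\<bar>"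
      by (simp add: i N LF LG)
    also have "\<dots> \<le> (\<integral>y. (D + \<eta>) * (indicator {0<..A} y * h (x / y)) \<partial>LG)"
    proof (rule integral_abs_bound_integral)
      fix y
      show "\<bar>indicator {0<..A} y * ccdf N (x / y) - (a * (indicator {0<..A} y * ccdf LF (x / y)) + b * (indicator {0<..A} y * ccdf LG (x / y)))\<bar>
        \<le> (D + \<eta>) * (indicator {0<..A} y * h (x / y))"
      proof (cases "y \<in> {0<..A}")
        case True
        then have "x1 * y \<le> x"
        proof (cases "x1 \<ge> 0")
          case True
          then have "x1 * y \<le> x1 * A" using \<open>y \<in> {0<..A}\<close> by (intro mult_left_mono) auto
          then show ?thesis using elim(4) by (simp add: mult.commute)
        next
          case False
          then have "x1 * y \<le> 0" using \<open>y \<in> {0<..A}\<close> by (simp add: mult_nonpos_nonneg)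
          then show ?thesis using elim(4) by simp
        qed
        then have "x1 \<le> x / y" using True by (simp add: field_simps)
        then show ?thesis using x1[of "x / y"] True by simp
      qed simp
    qed (auto intro!: i N LF LG H integrable_mult_right Bochner_Integration.integrable_diff Bochner_Integration.integrable_add)
    also have "\<dots> = (D + \<eta>) * ?J H x" by simp
    also have "\<dots> \<le> (D + \<eta>) * ((tmom LG A + \<eta>) * h x)"
      using elim(3) nn \<eta> by (intro mult_left_mono) (auto simp: algebra_simps abs_le_iff)
    finally have 0: "\<bar>?J N x - (a * ?J LF x + b * ?J LG x)\<bar> \<le> (D + \<eta>) * ((tmom LG A + \<eta>) * h x)" .
    have 1: "\<bar>a * ?J LF x - a * (tmom LG A * ccdf LF x)\<bar> \<le> a * (\<eta> * h x)"
      using mult_left_mono[OF elim(1) nn(1)] nn(1) by (simp add: abs_mult right_diff_distrib[symmetric])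
    have 2: "\<bar>b * ?J LG x - b * (tmom LG A * ccdf LG x)\<bar> \<le> b * (\<eta> * h x)"
      using mult_left_mono[OF elim(2) nn(2)] nn(2) by (simp add: abs_mult right_diff_distrib[symmetric])
    have "\<bar>?J N x - tmom LG A * (a * ccdf LF x + b * ccdf LG x)\<bar>
       \<le> \<bar>?J N x - (a * ?J LF x + b * ?J LG x)\<bar> + \<bar>a * ?J LF x - a * (tmom LG A * ccdf LF x)\<bar> + \<bar>b * ?J LG x - b * (tmom LG A * ccdf LG x)\<bar>"
      by (simp add: algebra_simps)
    also have "\<dots> \<le> (D + \<eta>) * ((tmom LG A + \<eta>) * h x) + a * (\<eta> * h x) + b * (\<eta> * h x)"
      using 0 1 2 by linarith
    also have "\<dots> = ((D + \<eta>) * (tmom LG A + \<eta>) + (a + b) * \<eta>) * h x" by (simp add: algebra_simps)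
    finally show ?case .
  qed
qed

text \<open>In \<open>product_split\<close> a moderate Y reproduces the expansion of N, with a
  factor that tends to the moment of LG, and a moderate Z contributes the moment of N times the tail
  of LG. The middle range and the corner become negligible as A grows.\<close>

lemma approx_prod:
  assumes N: "real_distribution N" and ap: "approx N a b D" and nn: "a \<ge> 0" "b \<ge> 0" "D \<ge> 0"
  shows "approx (prod_law LG N) (mom \<alpha> LG * a) (mom \<alpha> LG * b + mom \<alpha> N) (mom \<alpha> LG * D)"
  unfolding approx_def
proof (intro allI impI)
  fix \<eta> :: real assume \<eta>: "\<eta> > 0"
  interpret N: real_distribution N by fact
  let ?\<mu> = "mom \<alpha> LG" and ?m = "mom \<alpha> N"
  have IN: "integrable N (\<lambda>z. max z 0 powr \<alpha>)" by (rule approx_moment[OF N ap nn(1,2)])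
  have \<mu>0: "?\<mu> \<ge> 0" unfolding pos_moment_def by (intro integral_nonneg_AE) auto
  define K where "K = 2 * a + 2 * b + D + 1"
  have K0: "K \<ge> 1" using nn by (simp add: K_def)
  obtain x1 where x1: "\<And>x. x \<ge> x1 \<Longrightarrow> ccdf N x \<le> K * h x"
    using approx_bound[OF ap nn(1,2)] by (auto simp: eventually_at_top_linorder K_def)
  \<comment> \<open>The error terms below add up to \<open>3 * a + 3 * b + \<mu> + D + K + 8\<close>
    times \<open>\<eta>1\<close>, with \<mu> the moment of LG.\<close>
  define C where "C = 3 * a + 3 * b + ?\<mu> + D + K + 10"
  define \<eta>1 where "\<eta>1 = min 1 (\<eta> / C)"
  have C0: "C > 0" using nn \<mu>0 K0 unfolding C_def by linarith
  have \<eta>1: "\<eta>1 > 0" "\<eta>1 \<le> 1" using \<eta> C0 by (auto simp: \<eta>1_def)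
  have C: "\<eta>1 * C \<le> \<eta>"
  proof -
    have "\<eta>1 \<le> \<eta> / C" by (simp add: \<eta>1_def)
    then show ?thesis using C0 by (simp only: pos_le_divide_eq)
  qed
  have "\<forall>\<^sub>F A in at_top. tmom LG A > ?\<mu> - \<eta>1"
    by (rule order_tendstoD(1)[OF tmom_tendsto[OF LG LG_moment]]) (use \<eta>1 in simp)
  moreover have "\<forall>\<^sub>F A in at_top. tmom N A > ?m - \<eta>1"
    by (rule order_tendstoD(1)[OF tmom_tendsto[OF N IN]]) (use \<eta>1 in simp)
  ultimately have "\<forall>\<^sub>F A in at_top. tmom LG A > ?\<mu> - \<eta>1 \<and> tmom N A > ?m - \<eta>1 \<and> A \<ge> 1 \<and> A \<ge> x1 \<and>
     (\<forall>\<^sub>F x in at_top. mconv LG h {A<..x / A} x \<le> \<eta>1 * h x)"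
    using middle_eventually[OF \<eta>1(1)] eventually_ge_at_top[of 1] eventually_ge_at_top[of x1]
    by eventually_elim auto
  then obtain A where A: "tmom LG A > ?\<mu> - \<eta>1" "tmom N A > ?m - \<eta>1" "A \<ge> 1" "A \<ge> x1"
    and mid: "\<forall>\<^sub>F x in at_top. mconv LG h {A<..x / A} x \<le> \<eta>1 * h x"
    using eventually_happens'[OF trivial_limit_at_top_linorder] by blast
  have A0: "A > 0" using A by simp
  have tl: "tmom LG A \<le> ?\<mu>" "0 \<le> tmom LG A" using tmom_le[OF LG LG_moment] A0 by auto
  have tn: "tmom N A \<le> ?m" "0 \<le> tmom N A" "A powr \<alpha> * ccdf N A \<le> ?m - tmom N A" using tmom_le[OF N IN] A0 by auto
  have Ap: "A powr \<alpha> \<ge> 1" using A \<alpha>_nonneg by (simp add: ge_one_powr_ge_zero)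
  have hA: "\<forall>\<^sub>F x in at_top. h (x / A) \<le> (2 * A powr \<alpha>) * h x"
    using A0 Ap by (intro h_scale_le) auto
  show "\<forall>\<^sub>F x in at_top. \<bar>ccdf (prod_law LG N) x - (?\<mu> * a * ccdf LF x + (?\<mu> * b + ?m) * ccdf LG x)\<bar> \<le> (?\<mu> * D + \<eta>) * h x"
    using mid hA head_approx[OF N ap nn A0 \<eta>1(1)]
      restricted_LG[OF N A0 \<eta>1(1)]
      eventually_gt_at_top[of "A\<^sup>2"]
  proof eventually_elim
    case (elim x)
    have x0: "x > 0" using elim(5) by (smt (verit) zero_le_power2)
    let ?I1 = "mconv LG (ccdf N) {0<..A} x" and ?I2 = "mconv LG (ccdf N) {A<..x / A} x"
    and ?I3 = "mconv N (ccdf LG) {0<..A} x" and ?I4 = "ccdf LG (x / A) * ccdf N A"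
    let ?G = "a * ccdf LF x + b * ccdf LG x"
    have split: "ccdf (prod_law LG N) x = ?I1 + ?I2 + ?I3 + ?I4" by (rule product_split[OF N A(3) elim(5)])
    have h0: "h x \<ge> 0" by simp
    have G: "0 \<le> ?G" "?G \<le> (2 * a + 2 * b) * h x"
    proof -
      have "a * ccdf LF x \<le> a * (2 * h x)" "b * ccdf LG x \<le> b * (2 * h x)"
        by (intro mult_left_mono TF_le TG_le nn)+
      then show "?G \<le> (2 * a + 2 * b) * h x" by (simp add: algebra_simps)
    qed (use nn in auto)
    have i1: "\<bar>?I1 - tmom LG A * ?G\<bar> \<le> (?\<mu> * D + \<eta>1 * (?\<mu> + D + 1 + a + b)) * h x"
    proof -
      have "(D + \<eta>1) * (tmom LG A + \<eta>1) \<le> (D + \<eta>1) * (?\<mu> + \<eta>1)"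
        using tl nn \<eta>1 by (intro mult_left_mono) auto
      also have "\<dots> = ?\<mu> * D + \<eta>1 * (?\<mu> + D + \<eta>1)" by (simp add: algebra_simps)
      also have "\<dots> \<le> ?\<mu> * D + \<eta>1 * (?\<mu> + D + 1)" using \<eta>1 by (intro add_left_mono mult_left_mono) auto
      finally have "(D + \<eta>1) * (tmom LG A + \<eta>1) + (a + b) * \<eta>1 \<le> ?\<mu> * D + \<eta>1 * (?\<mu> + D + 1 + a + b)"
        by (simp add: algebra_simps)
      then have "((D + \<eta>1) * (tmom LG A + \<eta>1) + (a + b) * \<eta>1) * h x \<le> (?\<mu> * D + \<eta>1 * (?\<mu> + D + 1 + a + b)) * h x"
        by (rule mult_right_mono) simp
      then show ?thesis using elim(3) by linarith
    qed
    have i1': "\<bar>tmom LG A * ?G - ?\<mu> * ?G\<bar> \<le> \<eta>1 * (2 * a + 2 * b) * h x"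
    proof -
      have "\<bar>tmom LG A * ?G - ?\<mu> * ?G\<bar> = (?\<mu> - tmom LG A) * ?G"
        using tl G(1) unfolding left_diff_distrib[symmetric] by (simp add: abs_mult)
      also have "\<dots> \<le> \<eta>1 * ((2 * a + 2 * b) * h x)" using tl A(1) G \<eta>1 by (intro mult_mono) auto
      finally show ?thesis by (simp only: mult.assoc)
    qed
    have i2: "0 \<le> ?I2" "?I2 \<le> K * \<eta>1 * h x"
    proof -
      show "0 \<le> ?I2" by (intro integral_nonneg_AE) auto
      have "?I2 \<le> K * mconv LG h {A<..x / A} x"
        by (rule ind_mono[OF N _ x1[OF order_trans[OF A(4) middle_arg[OF A(3) x0]]]]) auto
      also have "\<dots> \<le> K * (\<eta>1 * h x)" using elim(1) K0 by (intro mult_left_mono) auto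
      finally show "?I2 \<le> K * \<eta>1 * h x" by (simp only: mult.assoc)
    qed
    have i3: "\<bar>?I3 - tmom N A * ccdf LG x\<bar> \<le> \<eta>1 * h x" by (rule elim(4))
    have i3': "\<bar>tmom N A * ccdf LG x - ?m * ccdf LG x\<bar> \<le> \<eta>1 * 2 * h x"
    proof -
      have "\<bar>tmom N A * ccdf LG x - ?m * ccdf LG x\<bar> = (?m - tmom N A) * ccdf LG x"
        using tn unfolding left_diff_distrib[symmetric] by (simp add: abs_mult)
      also have "\<dots> \<le> \<eta>1 * (2 * h x)" using tn A(2) TG_le \<eta>1 by (intro mult_mono) auto
      finally show ?thesis by (simp only: mult.assoc)
    qed
    \<comment> \<open>The growth of \<open>h (x / A)\<close> with A is absorbed by the small tail of
      N at A: by Markov's estimate their product is bounded by the part of the moment of N beyond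
      A.\<close>
    have i4: "0 \<le> ?I4" "?I4 \<le> \<eta>1 * 4 * h x"
    proof -
      have "ccdf LG (x / A) \<le> 2 * ((2 * A powr \<alpha>) * h x)" using TG_le[of "x / A"] elim(2) by linarith
      then have "?I4 \<le> 2 * ((2 * A powr \<alpha>) * h x) * ccdf N A" by (rule mult_right_mono) simp
      also have "\<dots> = 4 * (A powr \<alpha> * ccdf N A) * h x" by simp
      also have "\<dots> \<le> 4 * \<eta>1 * h x" using tn A(2) by (intro mult_right_mono mult_left_mono) auto
      finally show "?I4 \<le> \<eta>1 * 4 * h x" by (simp add: ac_simps)
    qed auto
    have "\<bar>?I1 + ?I2 + ?I3 + ?I4 - (?\<mu> * ?G + ?m * ccdf LG x)\<bar>
      \<le> (?\<mu> * D + \<eta>1 * (?\<mu> + D + 1 + a + b)) * h x + \<eta>1 * (2 * a + 2 * b) * h x + K * \<eta>1 * h x + \<eta>1 * h x + \<eta>1 * 2 * h x + \<eta>1 * 4 * h x"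
      using i1 i1' i2 i3 i3' i4 by linarith
    also have "\<dots> = (?\<mu> * D + \<eta>1 * (3 * a + 3 * b + ?\<mu> + D + K + 8)) * h x" by (simp add: algebra_simps)
    also have "\<dots> \<le> (?\<mu> * D + \<eta>) * h x"
    proof -
      have "\<eta>1 * (3 * a + 3 * b + ?\<mu> + D + K + 8) \<le> \<eta>1 * C" using \<eta>1 by (intro mult_left_mono) (auto simp: C_def)
      then show ?thesis using C by (intro mult_right_mono) auto
    qed
    finally show ?case unfolding split by (simp add: algebra_simps)
  qed
qed

text \<open>To be iterated, the bound has to hold for all x > 0 with constants that do not depend on
  N. For large x, adding X costs a factor at most 1 + 3 \<eta> and multiplying by Y a factor \<mu> +
  2 \<eta>, with \<mu> the moment of LG; \<eta> is chosen so that their product \<rho> is below 1.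
  The tails of X and Y themselves and all small x go into the additive constant C.\<close>

lemma uniform_step:
  assumes \<mu>: "mom \<alpha> LG < 1"
  shows "\<exists>\<rho> C. 0 \<le> \<rho> \<and> \<rho> < 1 \<and> 0 \<le> C \<and> (\<forall>N K. real_distribution N \<longrightarrow> K \<ge> 0 \<longrightarrow> (\<forall>x>0. ccdf N x \<le> K * h x) \<longrightarrow>
     (\<forall>x>0. ccdf (prod_law LG (LF \<star> N)) x \<le> (\<rho> * K + C) * h x))"
proof -
  let ?\<mu> = "mom \<alpha> LG"
  have \<mu>0: "?\<mu> \<ge> 0" unfolding pos_moment_def by (intro integral_nonneg_AE) auto
  have "((\<lambda>\<eta>. (1 + 3 * \<eta>) * (?\<mu> + 2 * \<eta>)) \<longlongrightarrow> (1 + 3 * 0) * (?\<mu> + 2 * 0)) (at_right 0)"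
    by (intro tendsto_intros)
  then have "\<forall>\<^sub>F \<eta> in at_right 0. (1 + 3 * \<eta>) * (?\<mu> + 2 * \<eta>) < 1 \<and> \<eta> \<in> {0<..<1::real}"
    using \<mu> by (intro eventually_conj order_tendstoD(2)[where a=1] eventually_at_right_real) auto
  then obtain \<eta> where \<eta>: "(1 + 3 * \<eta>) * (?\<mu> + 2 * \<eta>) < 1" "0 < \<eta>" "\<eta> < 1"
    by (auto dest!: eventually_happens'[rotated])
  have half: "0 \<le> 1 / (2::real)" by simp
  have "\<forall>\<^sub>F \<delta> in at_right 0. \<delta> \<in> {0<..<1::real}" by (rule eventually_at_right_real) simp
  then have "\<forall>\<^sub>F \<delta> in at_right 0. \<delta> \<in> {0<..<1} \<and> (\<forall>\<^sub>F x in at_top. h ((1 - \<delta>) * x) \<le> (1 + \<eta>) * h x)"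
    using approx_near[OF approx_H half half order_refl \<eta>(2)]
  proof eventually_elim
    case (elim \<delta>)
    then have "\<forall>\<^sub>F x in at_top. \<bar>h ((1 - \<delta>) * x) - (1 / 2 * ccdf LF x + 1 / 2 * ccdf LG x)\<bar> \<le> (0 + \<eta>) * h x"
      by simp
    then have "\<forall>\<^sub>F x in at_top. h ((1 - \<delta>) * x) \<le> (1 + \<eta>) * h x"
    proof eventually_elim
      case (elim x)
      have eq: "1 / 2 * ccdf LF x + 1 / 2 * ccdf LG x = h x" by (simp add: H_eq)
      show ?case using elim unfolding eq distrib_right by linarith
    qed
    then show ?case using elim by simp
  qed
  then obtain \<delta> where \<delta>: "0 < \<delta>" "\<delta> < 1" and sc: "\<forall>\<^sub>F x in at_top. h ((1 - \<delta>) * x) \<le> (1 + \<eta>) * h x"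
    using eventually_happens'[OF trivial_limit_at_right_real] by (metis (no_types, lifting) greaterThanLessThan_iff)
  have e: "x / (1 / \<delta>) = \<delta> * x" for x using \<delta> by (auto simp: field_simps)
  have "\<forall>\<^sub>F x in at_top. ccdf LF (x / (1 / \<delta>)) * h (x / (1 / \<delta>)) \<le> \<eta> * h x"
    by (rule product_small[OF H always_eventually[where P="\<lambda>x. h x \<le> 1 * h x"] _ \<eta>(2)]) (use \<delta> in auto)
  with sc have "\<forall>\<^sub>F x in at_top. h ((1 - \<delta>) * x) \<le> (1 + \<eta>) * h x \<and> ccdf LF (\<delta> * x) * h (\<delta> * x) \<le> \<eta> * h x"
    unfolding e by eventually_elim auto
  then obtain x0 where x0: "\<And>x. x \<ge> x0 \<Longrightarrow> h ((1 - \<delta>) * x) \<le> (1 + \<eta>) * h x \<and> ccdf LF (\<delta> * x) * h (\<delta> * x) \<le> \<eta> * h x"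
    by (auto simp: eventually_at_top_linorder)
  \<comment> \<open>4 accounts for the tail of LF; below x0 the trivial bound 1 is at most
    \<open>h x / h x0\<close>.\<close>
  define C1 where "C1 = 4 + 1 / h x0"
  have C1: "C1 \<ge> 0" "C1 \<ge> 4" "C1 \<ge> 1 / h x0" using H_pos[of x0] by (auto simp: C1_def)
  have step1: "ccdf (LF \<star> N) x \<le> ((1 + 3 * \<eta>) * K + C1) * h x"
    if N: "real_distribution N" and K: "K \<ge> 0" "\<And>x. x > 0 \<Longrightarrow> ccdf N x \<le> K * h x" and x: "x > 0" for N K x
  proof (cases "x \<ge> x0")
    case True
    have hh: "h ((1 - \<delta>) * x) \<le> (1 + \<eta>) * h x" and hp: "ccdf LF (\<delta> * x) * h (\<delta> * x) \<le> \<eta> * h x" using x0[OF True] by auto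
    have "ccdf N ((1 - \<delta>) * x) \<le> K * h ((1 - \<delta>) * x)" using K(2) \<delta> x by simp
    also have "\<dots> \<le> K * ((1 + \<eta>) * h x)" using hh K by (intro mult_left_mono) auto
    finally have 1: "ccdf N ((1 - \<delta>) * x) \<le> K * ((1 + \<eta>) * h x)" .
    have "ccdf LF ((1 - \<delta>) * x) \<le> 2 * ((1 + \<eta>) * h x)" using TF_le[of "(1 - \<delta>) * x"] hh by linarith
    also have "\<dots> \<le> 4 * h x" using \<eta> H_pos[of x] by simp
    finally have 2: "ccdf LF ((1 - \<delta>) * x) \<le> 4 * h x" .
    have "ccdf LF (\<delta> * x) * ccdf N (\<delta> * x) \<le> ccdf LF (\<delta> * x) * (K * h (\<delta> * x))"
      using K(2) \<delta> x by (intro mult_left_mono) auto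
    also have "\<dots> = K * (ccdf LF (\<delta> * x) * h (\<delta> * x))" by simp
    also have "\<dots> \<le> K * (\<eta> * h x)" using hp K by (intro mult_left_mono) auto
    finally have 3: "ccdf LF (\<delta> * x) * ccdf N (\<delta> * x) \<le> K * (\<eta> * h x)" .
    have "ccdf (LF \<star> N) x \<le> K * ((1 + \<eta>) * h x) + 4 * h x + K * (\<eta> * h x)"
      using sum_upper[OF N \<delta>(1,2), of x] 1 2 3 by linarith
    also have "\<dots> = ((1 + 2 * \<eta>) * K + 4) * h x" by (simp add: algebra_simps)
    also have "\<dots> \<le> ((1 + 3 * \<eta>) * K + C1) * h x"
      using C1 \<eta> K by (intro mult_right_mono add_mono) auto
    finally show ?thesis .
  next
    case False
    have "ccdf (LF \<star> N) x \<le> 1" by (intro ccdf_le_1 real_distribution_conv LF N)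
    also have "1 \<le> (1 / h x0) * h x"
      using False H_pos[of x0] ccdf_mono[OF H, of x x0] by (simp add: field_simps)
    also have "\<dots> \<le> ((1 + 3 * \<eta>) * K + C1) * h x"
      using C1 \<eta> K by (intro mult_right_mono) (auto intro: add_increasing)
    finally show ?thesis .
  qed
  obtain A where A: "A \<ge> 1" "\<forall>\<^sub>F x in at_top. mconv LG h {A<..x / A} x \<le> \<eta> * h x"
    using middle[OF \<eta>(2)] by blast
  have A0: "A > 0" using A by simp
  have tl: "tmom LG A \<le> ?\<mu>" using tmom_le[OF LG LG_moment] A0 by auto
  have "\<forall>\<^sub>F x in at_top. mconv LG h {A<..x / A} x \<le> \<eta> * h x \<and>
    mconv LG h {0<..A} x \<le> (?\<mu> + \<eta>) * h x \<and> h (x / A) \<le> (A powr \<alpha> + 1) * h x \<and> x > A\<^sup>2"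
    using A(2) restricted_H[OF LG A0 \<eta>(2)]
      h_scale_le[OF A0, of "A powr \<alpha> + 1", simplified] eventually_gt_at_top[of "A\<^sup>2"]
  proof eventually_elim
    case (elim x)
    have "tmom LG A * h x \<le> ?\<mu> * h x" using tl by (intro mult_right_mono) auto
    then show ?case using elim by (simp add: algebra_simps abs_le_iff)
  qed
  then obtain x2 where x2: "\<And>x. x \<ge> x2 \<Longrightarrow> mconv LG h {A<..x / A} x \<le> \<eta> * h x \<and>
    mconv LG h {0<..A} x \<le> (?\<mu> + \<eta>) * h x \<and> h (x / A) \<le> (A powr \<alpha> + 1) * h x \<and> x > A\<^sup>2"
    by (auto simp: eventually_at_top_linorder)
  \<comment> \<open>Two terms of at most \<open>2 * (A powr \<alpha> + 1) * h x\<close> come from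
    large Y, with moderate or large second factor; \<open>1 / h x2\<close> covers x below
    x2.\<close>
  define C2 where "C2 = 4 * (A powr \<alpha> + 1) + 1 / h x2"
  have C2: "C2 \<ge> 0" "C2 \<ge> 4 * (A powr \<alpha> + 1)" "C2 \<ge> 1 / h x2" using H_pos[of x2] by (auto simp: C2_def)
  have step2: "ccdf (prod_law LG N) x \<le> ((?\<mu> + 2 * \<eta>) * K + C2) * h x"
    if N: "real_distribution N" and K: "K \<ge> 0" "\<And>x. x > 0 \<Longrightarrow> ccdf N x \<le> K * h x" and x: "x > 0" for N K x
  proof (cases "x \<ge> x2")
    case True
    note X = x2[OF True]
    interpret N: real_distribution N by fact
    have 1: "mconv LG (ccdf N) {0<..A} x \<le> K * ((?\<mu> + \<eta>) * h x)"
    proof -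
      have "mconv LG (ccdf N) {0<..A} x \<le> K * mconv LG h {0<..A} x"
        by (rule ind_mono[OF N]) (use K(2) x in auto)
      also have "\<dots> \<le> K * ((?\<mu> + \<eta>) * h x)" using X K by (intro mult_left_mono) auto
      finally show ?thesis .
    qed
    have "mconv LG (ccdf N) {A<..x / A} x \<le> K * mconv LG h {A<..x / A} x"
      by (rule ind_mono[OF N _ K(2)[OF less_le_trans[OF A0 middle_arg[OF A(1) x]]]]) auto
    also have "\<dots> \<le> K * (\<eta> * h x)" using X K by (intro mult_left_mono) auto
    finally have 2: "mconv LG (ccdf N) {A<..x / A} x \<le> K * (\<eta> * h x)" .
    have g: "ccdf LG (x / A) \<le> 2 * ((A powr \<alpha> + 1) * h x)" using TG_le[of "x / A"] X by linarith
    \<comment> \<open>A is fixed here, so the tail of LG is bounded by its value at x/A. Using the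
      moment of N instead would make the constant depend on N.\<close>
    have 3: "mconv N (ccdf LG) {0<..A} x \<le> 2 * ((A powr \<alpha> + 1) * h x)"
    proof -
      have "mconv N (ccdf LG) {0<..A} x \<le> (\<integral>z. 2 * ((A powr \<alpha> + 1) * h x) \<partial>N)"
      proof (rule integral_mono)
        fix z show "indicator {0<..A} z * ccdf LG (x / z) \<le> 2 * ((A powr \<alpha> + 1) * h x)"
        proof (cases "z \<in> {0<..A}")
          case True
          then have "ccdf LG (x / z) \<le> ccdf LG (x / A)" using x A0 by (intro ccdf_mono[OF LG] divide_left_mono) auto
          then show ?thesis using True g by simp
        qed (use g in \<open>auto intro: order_trans[OF measure_nonneg]\<close>)
      qed (auto intro!: ind_integrable N LG)
      then show ?thesis using N.prob_space by simp
    qed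
    have 4: "ccdf LG (x / A) * ccdf N A \<le> 2 * ((A powr \<alpha> + 1) * h x)"
      using g mult_left_mono[OF ccdf_le_1[OF N], of "ccdf LG (x / A)" A] by simp
    have "ccdf (prod_law LG N) x \<le> K * ((?\<mu> + \<eta>) * h x) + K * (\<eta> * h x) + 2 * ((A powr \<alpha> + 1) * h x) + 2 * ((A powr \<alpha> + 1) * h x)"
      using 1 2 3 4 X unfolding product_split[OF N A(1) conjunct2[OF conjunct2[OF conjunct2[OF X]]]] by linarith
    also have "\<dots> = ((?\<mu> + 2 * \<eta>) * K + 4 * (A powr \<alpha> + 1)) * h x" by (simp add: algebra_simps)
    also have "\<dots> \<le> ((?\<mu> + 2 * \<eta>) * K + C2) * h x" using C2 by (intro mult_right_mono add_left_mono) auto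
    finally show ?thesis .
  next
    case False
    have "ccdf (prod_law LG N) x \<le> 1" by (intro ccdf_le_1 real_distribution_prod_law LG N)
    also have "1 \<le> (1 / h x2) * h x"
      using False H_pos[of x2] ccdf_mono[OF H, of x x2] by (simp add: field_simps)
    also have "\<dots> \<le> ((?\<mu> + 2 * \<eta>) * K + C2) * h x"
      using C2 \<eta> K \<mu>0 by (intro mult_right_mono) (auto intro: add_increasing)
    finally show ?thesis .
  qed
  define \<rho> where "\<rho> = (1 + 3 * \<eta>) * (?\<mu> + 2 * \<eta>)"
  define C where "C = (?\<mu> + 2 * \<eta>) * C1 + C2"
  show ?thesis
  proof (intro exI conjI allI impI)
    show "0 \<le> \<rho>" "\<rho> < 1" "0 \<le> C" using \<eta> \<mu>0 C1 C2 by (auto simp: \<rho>_def C_def intro!: add_nonneg_nonneg mult_nonneg_nonneg)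
    fix N K x assume a: "real_distribution N" "(0::real) \<le> K" "\<forall>x>0. ccdf N x \<le> K * h x" "(0::real) < x"
    have "ccdf (prod_law LG (LF \<star> N)) x \<le> ((?\<mu> + 2 * \<eta>) * ((1 + 3 * \<eta>) * K + C1) + C2) * h x"
    proof (rule step2[OF real_distribution_conv[OF LF a(1)] _ _ a(4)])
      show "0 \<le> (1 + 3 * \<eta>) * K + C1" using a \<eta> C1 by (intro add_nonneg_nonneg mult_nonneg_nonneg) auto
      show "ccdf (LF \<star> N) x \<le> ((1 + 3 * \<eta>) * K + C1) * h x" if "x > 0" for x
        using step1[OF a(1,2) _ that] a(3) by auto
    qed
    then show "ccdf (prod_law LG (LF \<star> N)) x \<le> (\<rho> * K + C) * h x" by (simp add: \<rho>_def C_def algebra_simps)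
  qed
qed

end

section \<open>Strong regular variation\<close>

lemma interval_measure_cdf:
  assumes "real_distribution N" shows "interval_measure (cdf N) = N"
proof -
  interpret real_distribution N by fact
  have c: "cdf (interval_measure (cdf N)) = cdf N"
    by (intro cdf_interval_measure cdf_nondecreasing cdf_is_right_cont cdf_lim_at_bot)
  have "real_distribution (interval_measure (cdf N))"
    by (intro real_distribution_interval_measure cdf_nondecreasing cdf_is_right_cont cdf_lim_at_bot cdf_lim_at_top_prob)
  then show ?thesis using assms c by (rule cdf_unique)
qed

text \<open>The identity of distribution functions extends from half-lines to Borel sets by Dynkin's
  argument. It serves to dominate LG by a multiple of the mixture as a measure.\<close>

lemma cdf_convex_comb_measure:
  assumes LF: "real_distribution LF" and LG: "real_distribution LG" and D: "real_distribution D"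
    and eq: "\<And>x. cdf D x = p * cdf LF x + (1 - p) * cdf LG x" and B: "B \<in> sets borel"
  shows "measure D B = p * measure LF B + (1 - p) * measure LG B"
proof -
  interpret LF: real_distribution LF by fact
  interpret LG: real_distribution LG by fact
  interpret D: real_distribution D by fact
  have sb: "sets borel = sigma_sets UNIV (range (\<lambda>a::real. {..a}))"
    unfolding borel_eq_atMost by simp
  have st: "Int_stable (range (\<lambda>a::real. {..a}))"
    by (auto simp: Int_stable_def)
  have mem: "B \<in> sigma_sets UNIV (range (\<lambda>a::real. {..a}))" using B sb by simp
  have pw: "range (\<lambda>a::real. {..a}) \<subseteq> Pow UNIV" by simp
  from st pw mem show ?thesis
  proof (induction rule: sigma_sets_induct_disjoint)
    case (basic A)
    then show ?case using eq by (auto simp: cdf_def)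
  next
    case empty
    then show ?case by simp
  next
    case (compl A)
    then have A: "A \<in> sets borel" using sb by simp
    have cm: "measure N (UNIV - A) = 1 - measure N A" if "real_distribution N" for N
    proof -
      interpret N: real_distribution N by fact
      show ?thesis using N.prob_compl[of A] A by simp
    qed
    show ?case unfolding cm[OF LF] cm[OF LG] cm[OF D] compl(2) by (simp add: algebra_simps)
  next
    case (union A)
    then have "range A \<subseteq> sets borel" using sb by auto
    then have A: "range A \<subseteq> sets D" "range A \<subseteq> sets LF" "range A \<subseteq> sets LG" by auto
    have "(\<lambda>i. measure D (A i)) sums measure D (\<Union> (range A))"
      by (rule D.finite_measure_UNION[OF A(1) union(1)])
    moreover have "(\<lambda>i. p * measure LF (A i) + (1 - p) * measure LG (A i)) sums
        (p * measure LF (\<Union> (range A)) + (1 - p) * measure LG (\<Union> (range A)))"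
      by (intro sums_add sums_mult LF.finite_measure_UNION[OF A(2) union(1)] LG.finite_measure_UNION[OF A(3) union(1)])
    ultimately show ?case using union(3) by (metis (no_types, lifting) sums_cong sums_unique2)
  qed
qed

locale strong_reg_var_law = real_distribution D for D :: "real measure" +
  fixes \<alpha> :: real
  assumes \<alpha>_nonneg: "\<alpha> \<ge> 0" and srv: "cdf D \<in> strong_reg_var \<alpha>"
begin

definition "c = ccdf D 0"
text \<open>The function obtained from \<open>cdf D\<close> by the logarithmic transformation and
  then cut off at 0, as the two nested class definitions prescribe.\<close>

definition V :: "real \<Rightarrow> real" where "V x = (if x \<ge> 0 then 1 - ccdf D (exp x) / c else 0)"
definition "\<nu> = interval_measure V"

lemma tail_cdf: "tail (cdf D) = ccdf D"
  by (rule ext) (simp add: tail_def ccdf_eq[OF real_distribution_axioms])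

lemma V_conv: "V \<in> conv_equiv_nonneg \<alpha>"
proof -
  have "(\<lambda>x. if x \<ge> 0 then 1 - tail (cdf D) (exp x) / tail (cdf D) 0 else 0) \<in> conv_equiv_nonneg \<alpha>"
    using srv by (auto simp: strong_reg_var_def conv_equiv_def)
  then show ?thesis unfolding tail_cdf V_def[abs_def] c_def .
qed

lemma c_pos: "c > 0" and D_pos: "ccdf D x > 0" and c_le_1: "c \<le> 1"
proof -
  have p: "1 - V x > 0" for x using V_conv by (auto simp: conv_equiv_nonneg_def tail_def)
  \<comment> \<open>For c = 0 the division by zero would give V 0 = 1, whereas members of the class
    have a positive tail.\<close>
  have "c \<noteq> 0" using p[of 0] by (auto simp: V_def)
  then show "c > 0" using measure_nonneg[of D "{0<..}"] by (auto simp: c_def less_le)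
  have "ccdf D (exp (max x 0)) / c > 0" using p[of "max x 0"] by (auto simp: V_def)
  then have "ccdf D (exp (max x 0)) > 0" using \<open>c > 0\<close> by (simp add: zero_less_divide_iff)
  moreover have "x \<le> exp (max x 0)" using exp_ge_add_one_self[of "max x 0"] by linarith
  ultimately show "ccdf D x > 0" using ccdf_mono[OF real_distribution_axioms, of x "exp (max x 0)"] by linarith
  show "c \<le> 1" by (simp add: c_def)
qed

lemma nu: "real_distribution \<nu>" and cdf_nu: "cdf \<nu> = V"
proof -
  obtain N where N: "real_distribution N" "cdf N = V" using V_conv by (auto simp: conv_equiv_nonneg_def distribution_def)
  then have "\<nu> = N" unfolding \<nu>_def using interval_measure_cdf by metis
  then show "real_distribution \<nu>" "cdf \<nu> = V" using N by auto
qed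

lemma ccdf_nu: "ccdf \<nu> x = 1 - V x"
  using ccdf_eq[OF nu] cdf_nu by simp

lemma ccdf_nu_exp: "x \<ge> 0 \<Longrightarrow> ccdf \<nu> x = ccdf D (exp x) / c"
  by (simp add: ccdf_nu V_def)

lemma conv_law: "\<exists>L. conv_equiv_law \<nu> \<alpha> L"
proof -
  interpret N: real_distribution \<nu> by (rule nu)
  have "((\<lambda>x. tail (conv2 V) x / tail V x) \<longlongrightarrow> L) at_top \<Longrightarrow> conv_equiv_law \<nu> \<alpha> L" for L
  proof (unfold_locales)
    assume L: "((\<lambda>x. tail (conv2 V) x / tail V x) \<longlongrightarrow> L) at_top"
    have t: "tail V x = ccdf \<nu> x" for x by (simp add: tail_def ccdf_nu)
    have t2: "tail (conv2 V) x = ccdf (\<nu> \<star> \<nu>) x" for x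
      by (simp add: tail_def conv2_def \<nu>_def[symmetric] ccdf_eq[OF real_distribution_conv[OF nu nu]])
    show "0 \<le> \<alpha>" by (rule \<alpha>_nonneg)
    show "((\<lambda>x. ccdf (\<nu> \<star> \<nu>) x / ccdf \<nu> x) \<longlongrightarrow> L) at_top" using L by (simp add: t t2)
    show "ccdf \<nu> x > 0" for x using V_conv by (auto simp: conv_equiv_nonneg_def t)
    show "((\<lambda>x. ccdf \<nu> (x - y) / ccdf \<nu> x) \<longlongrightarrow> exp (\<alpha> * y)) at_top" for y
      using V_conv by (auto simp: conv_equiv_nonneg_def t)
    have "(cdf \<nu> \<longlongrightarrow> N.prob {..<0}) (at_left 0)" by (rule N.cdf_at_left)
    moreover have "\<forall>\<^sub>F x in at_left 0. cdf \<nu> x = 0"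
      unfolding cdf_nu by (auto simp: eventually_at_filter V_def)
    then have "(cdf \<nu> \<longlongrightarrow> 0) (at_left 0)" by (rule tendsto_eventually)
    ultimately show "N.prob {..<0} = 0" by (intro tendsto_unique[of "at_left (0::real)"]) auto
  qed
  then show ?thesis using V_conv by (auto simp: conv_equiv_nonneg_def)
qed

lemma RV:
  assumes y: "y > 0" shows "((\<lambda>x. ccdf D (x / y) / ccdf D x) \<longlongrightarrow> y powr \<alpha>) at_top"
proof -
  have "((\<lambda>x. tail V (x - ln y) / tail V x) \<longlongrightarrow> exp (\<alpha> * ln y)) at_top"
    using V_conv by (auto simp: conv_equiv_nonneg_def)
  then have "((\<lambda>x. ccdf \<nu> (ln x - ln y) / ccdf \<nu> (ln x)) \<longlongrightarrow> exp (\<alpha> * ln y)) at_top"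
    using filterlim_compose[OF _ ln_at_top] by (simp add: tail_def ccdf_nu)
  moreover have "\<forall>\<^sub>F x in at_top. ccdf \<nu> (ln x - ln y) / ccdf \<nu> (ln x) = ccdf D (x / y) / ccdf D x"
    using eventually_ge_at_top[of "max 1 y"]
  proof eventually_elim
    case (elim x)
    have "ln x - ln y \<ge> 0" "ln x \<ge> 0" using elim y by auto
    then show ?case using elim y c_pos by (simp add: ccdf_nu_exp exp_diff)
  qed
  ultimately have "((\<lambda>x. ccdf D (x / y) / ccdf D x) \<longlongrightarrow> exp (\<alpha> * ln y)) at_top"
    by (rule Lim_transform_eventually)
  then show ?thesis using y by (simp add: powr_def)
qed

text \<open>The cut-off at 0 collects the mass that the logarithm sends below 0 in an atom at 0,
  hence the maximum.\<close>

lemma nu_eq: "\<nu> = distr (uniform_measure D {0<..}) borel (\<lambda>x. max 0 (ln x))"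
proof (rule cdf_unique[OF nu])
  have e: "emeasure D {0<..} \<noteq> 0" "emeasure D {0<..} \<noteq> \<infinity>"
    using c_pos by (auto simp: emeasure_eq_measure c_def)
  interpret U: prob_space "uniform_measure D {0<..}" by (rule prob_space_uniform_measure[OF e])
  have [measurable]: "(\<lambda>x. max 0 (ln x)) \<in> borel_measurable D" by measurable
  show "real_distribution (distr (uniform_measure D {0<..}) borel (\<lambda>x. max 0 (ln x)))"
    by (rule U.real_distribution_distr) simp
  show "cdf \<nu> = cdf (distr (uniform_measure D {0<..}) borel (\<lambda>x. max 0 (ln x)))"
  proof (rule ext)
    fix v :: real
    have "cdf (distr (uniform_measure D {0<..}) borel (\<lambda>x. max 0 (ln x))) v
       = measure (uniform_measure D {0<..}) {x. max 0 (ln x) \<le> v}"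
      unfolding cdf_def by (subst measure_distr) (auto simp: vimage_def)
    also have "\<dots> = prob ({0<..} \<inter> {x. max 0 (ln x) \<le> v}) / c"
      unfolding c_def by (rule measure_uniform_measure[OF e]) measurable
    also have "\<dots> = V v"
    proof (cases "v \<ge> 0")
      case True
      have "{0<..} \<inter> {x. max 0 (ln x) \<le> v} = {0<..} - {exp v<..}"
      proof (intro set_eqI iffI)
        fix x assume "x \<in> {0<..} \<inter> {x. max 0 (ln x) \<le> v}"
        then show "x \<in> {0<..} - {exp v<..}" using ln_le_cancel_iff[of x "exp v"] by auto
      next
        fix x assume "x \<in> {0<..} - {exp v<..}"
        then show "x \<in> {0<..} \<inter> {x. max 0 (ln x) \<le> v}" using True ln_le_cancel_iff[of x "exp v"] by auto
      qed
      moreover have "prob ({0<..} - {exp v<..}) = c - ccdf D (exp v)"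
        unfolding c_def by (rule finite_measure_Diff) (auto intro: less_trans[OF exp_gt_zero])
      ultimately show ?thesis using True c_pos by (simp add: V_def diff_divide_distrib)
    qed (auto simp: V_def)
    finally show "cdf \<nu> v = cdf (distr (uniform_measure D {0<..}) borel (\<lambda>x. max 0 (ln x))) v"
      by (simp add: cdf_nu)
  qed
qed

lemma nn_integral_nu:
  assumes [measurable]: "f \<in> borel_measurable borel"
  shows "ennreal c * (\<integral>\<^sup>+v. f v \<partial>\<nu>) = (\<integral>\<^sup>+x. f (max 0 (ln x)) * indicator {0<..} x \<partial>D)"
proof -
  have [measurable]: "(\<lambda>x. max 0 (ln x)) \<in> borel_measurable D" by measurable
  have "(\<integral>\<^sup>+v. f v \<partial>\<nu>) = (\<integral>\<^sup>+x. f (max 0 (ln x)) * indicator {0<..} x \<partial>D) / emeasure D {0<..}"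
    unfolding nu_eq by (subst nn_integral_distr) (auto simp: nn_integral_uniform_measure)
  also have "emeasure D {0<..} = ennreal c" by (simp add: c_def emeasure_eq_measure)
  finally have eq: "(\<integral>\<^sup>+v. f v \<partial>\<nu>) = (\<integral>\<^sup>+x. f (max 0 (ln x)) * indicator {0<..} x \<partial>D) / ennreal c" .
  show ?thesis unfolding eq using c_pos
    by (subst ennreal_times_divide, subst mult.commute) (rule mult_divide_eq_ennreal, auto)
qed

lemma moment: "integrable D (\<lambda>z. max z 0 powr \<alpha>)"
proof -
  obtain L where "conv_equiv_law \<nu> \<alpha> L" using conv_law by blast
  then interpret C: conv_equiv_law \<nu> \<alpha> L .
  have "(\<integral>\<^sup>+z. ennreal (max z 0 powr \<alpha>) \<partial>D) \<le> (\<integral>\<^sup>+x. ennreal (exp (\<alpha> * max 0 (ln x))) * indicator {0<..} x \<partial>D)"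
  proof (intro nn_integral_mono)
    fix z :: real
    show "ennreal (max z 0 powr \<alpha>) \<le> ennreal (exp (\<alpha> * max 0 (ln z))) * indicator {0<..} z"
    proof (cases "z > 0")
      case True
      then have "max z 0 powr \<alpha> = exp (\<alpha> * ln z)" by (simp add: powr_def)
      also have "\<dots> \<le> exp (\<alpha> * max 0 (ln z))" using \<alpha>_nonneg by (auto intro: mult_left_mono)
      finally show ?thesis using True by (simp add: ennreal_leI)
    qed simp
  qed
  also have "\<dots> = ennreal c * (\<integral>\<^sup>+v. ennreal (exp (\<alpha> * v)) \<partial>\<nu>)"
    by (rule nn_integral_nu[symmetric]) simp
  also have "\<dots> = ennreal c * ennreal (\<integral>v. exp (\<alpha> * v) \<partial>\<nu>)"
    by (subst nn_integral_eq_integral[OF C.exp_integrable]) auto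
  also have "\<dots> < \<infinity>" by (simp add: ennreal_mult_less_top)
  finally show ?thesis by (intro integrableI_bounded) auto
qed

text \<open>The additive statement \<open>C.middle_negligible\<close>, transported by the logarithm:
  with A = exp a \<ge> 1 only y > 1 occurs, where the atom of \<open>\<nu>\<close> at 0 does not
  interfere. The nonnegative integral makes the later replacement of D by a dominated measure
  immediate.\<close>

lemma middle:
  assumes "\<epsilon> > 0"
  shows "\<exists>A\<ge>1. \<forall>\<^sub>F x in at_top. (\<integral>\<^sup>+y. ennreal (indicator {A<..x / A} y * ccdf D (x / y)) \<partial>D) \<le> ennreal (\<epsilon> * ccdf D x)"
proof -
  obtain L where "conv_equiv_law \<nu> \<alpha> L" using conv_law by blast
  then interpret C: conv_equiv_law \<nu> \<alpha> L .
  obtain a where a: "a \<ge> 0" and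
    E: "\<forall>\<^sub>F x in at_top. measure (\<nu> \<Otimes>\<^sub>M \<nu>) {(u, v). a < u \<and> u \<le> x - a \<and> u + v > x} \<le> \<epsilon> * ccdf \<nu> x"
    using C.middle_negligible[OF assms] by blast
  have "\<forall>\<^sub>F x in at_top. measure (\<nu> \<Otimes>\<^sub>M \<nu>) {(u, v). a < u \<and> u \<le> ln x - a \<and> u + v > ln x} \<le> \<epsilon> * ccdf \<nu> (ln x)"
    by (rule eventually_compose_filterlim[OF E ln_at_top])
  then have "\<forall>\<^sub>F x in at_top. (\<integral>\<^sup>+y. ennreal (indicator {exp a<..x / exp a} y * ccdf D (x / y)) \<partial>D) \<le> ennreal (\<epsilon> * ccdf D x)"
    using eventually_ge_at_top[of 1]
  proof eventually_elim
    case (elim x)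
    let ?Q = "{(u, v). a < u \<and> u \<le> ln x - a \<and> u + v > ln x}"
    let ?g = "\<lambda>u. indicator {a<..ln x - a} u * ccdf \<nu> (ln x - u)"
    have Q: "?Q \<in> sets (\<nu> \<Otimes>\<^sub>M \<nu>)" by (rule sets_pair_Collect[OF nu nu]) measurable
    have [measurable]: "?g \<in> borel_measurable borel" using ccdf_measurable[OF nu] by measurable
    have "Pair u -` ?Q = (if u \<in> {a<..ln x - a} then {ln x - u<..} else {})" for u by auto
    then have "measure \<nu> (Pair u -` ?Q) = ?g u" for u by (auto split: split_indicator)
    then have ig: "measure (\<nu> \<Otimes>\<^sub>M \<nu>) ?Q = (\<integral>u. ?g u \<partial>\<nu>)"
      using measure_pair_eq_integral[OF C.prob_space_axioms C.prob_space_axioms Q] by simp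
    have igi: "integrable \<nu> ?g"
      by (rule C.integrable_const_bound[where B=1]) (auto split: split_indicator)
    have "(\<integral>\<^sup>+y. ennreal (indicator {exp a<..x / exp a} y * ccdf D (x / y)) \<partial>D)
       = (\<integral>\<^sup>+y. ennreal c * (ennreal (?g (max 0 (ln y))) * indicator {0<..} y) \<partial>D)"
    proof (intro nn_integral_cong)
      fix y :: real
      show "ennreal (indicator {exp a<..x / exp a} y * ccdf D (x / y)) = ennreal c * (ennreal (?g (max 0 (ln y))) * indicator {0<..} y)"
      proof (cases "y > 1")
        case y: True
        have iff1: "exp a < y \<longleftrightarrow> a < ln y" using y by (metis exp_gt_zero exp_less_cancel_iff exp_ln less_trans zero_less_one)
        have "ln (x / exp a) = ln x - a" using elim by (simp add: ln_div)
        then have iff2: "y \<le> x / exp a \<longleftrightarrow> ln y \<le> ln x - a" using y elim ln_le_cancel_iff[of y "x / exp a"] by auto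
        show ?thesis
        proof (cases "a < ln y \<and> ln y \<le> ln x - a")
          case True
          have "ccdf \<nu> (ln x - ln y) = ccdf D (exp (ln x - ln y)) / c" using True a by (intro ccdf_nu_exp) auto
          also have "exp (ln x - ln y) = x / y" using y elim by (simp add: exp_diff)
          finally have "c * ccdf \<nu> (ln x - ln y) = ccdf D (x / y)" using c_pos by simp
          then show ?thesis using True y iff1 iff2 c_pos by (simp add: ennreal_mult'[symmetric])
        next
          case False
          then show ?thesis using y iff1 iff2 by auto
        qed
      next
        case y: False
        have "1 \<le> exp a" using a by simp
        then have "\<not> exp a < y" using y by linarith
        then have "y \<notin> {exp a<..x / exp a}" by simp
        moreover have "?g (max 0 (ln y)) * indicator {0<..} y = 0"
          using y a by (cases "y > 0") (auto simp: max_def)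
        ultimately show ?thesis using y a by (cases "y > 0") (auto simp: max_def)
      qed
    qed
    also have "\<dots> = ennreal c * (\<integral>\<^sup>+y. ennreal (?g (max 0 (ln y))) * indicator {0<..} y \<partial>D)"
      by (rule nn_integral_cmult) measurable
    also have "\<dots> = ennreal c * (ennreal c * (\<integral>\<^sup>+u. ennreal (?g u) \<partial>\<nu>))"
      by (subst nn_integral_nu[where f="\<lambda>u. ennreal (?g u)"]) auto
    also have "(\<integral>\<^sup>+u. ennreal (?g u) \<partial>\<nu>) = ennreal (measure (\<nu> \<Otimes>\<^sub>M \<nu>) ?Q)"
      unfolding ig by (rule nn_integral_eq_integral[OF igi]) auto
    also have "ennreal c * (ennreal c * ennreal (measure (\<nu> \<Otimes>\<^sub>M \<nu>) ?Q)) = ennreal (c * (c * measure (\<nu> \<Otimes>\<^sub>M \<nu>) ?Q))"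
      using c_pos by (simp add: ennreal_mult')
    also have "\<dots> \<le> ennreal (\<epsilon> * ccdf D x)"
    proof (rule ennreal_leI)
      have "c * measure (\<nu> \<Otimes>\<^sub>M \<nu>) ?Q \<le> c * (\<epsilon> * ccdf \<nu> (ln x))" using elim c_pos by (intro mult_left_mono) auto
      also have "\<dots> = \<epsilon> * ccdf D x" using elim c_pos ccdf_nu_exp[of "ln x"] by simp
      finally have 1: "c * measure (\<nu> \<Otimes>\<^sub>M \<nu>) ?Q \<le> \<epsilon> * ccdf D x" .
      \<comment> \<open>Each of the two conditional laws contributes one normalising c. One of them
        turns the tail of \<open>\<nu>\<close> into that of D, the other is dropped because c \<le>
        1.\<close>
      have "c * (c * measure (\<nu> \<Otimes>\<^sub>M \<nu>) ?Q) \<le> 1 * (c * measure (\<nu> \<Otimes>\<^sub>M \<nu>) ?Q)"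
        using c_pos c_le_1 by (intro mult_right_mono) auto
      then show "c * (c * measure (\<nu> \<Otimes>\<^sub>M \<nu>) ?Q) \<le> \<epsilon> * ccdf D x" using 1 by simp
    qed
    finally show ?case .
  qed
  then show ?thesis using a by (intro exI[of _ "exp a"]) auto
qed

end

text \<open>H is the mixture with p = 1/2. Regular variation of any mixture relative to its own tail
  carries over to h because that tail is at most 2 h. The middle estimate is available only for H
  against H; one factor is changed to LG by domination.\<close>

lemma tail_pairI:
  assumes LF: "real_distribution LF" and LG: "real_distribution LG" and \<alpha>: "\<alpha> \<ge> 0" and G0: "cdf LG 0 = 0"
    and srv: "\<And>p. 0 < p \<Longrightarrow> p < 1 \<Longrightarrow> (\<lambda>x. p * cdf LF x + (1 - p) * cdf LG x) \<in> strong_reg_var \<alpha>"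
  shows "\<exists>H. tail_pair LF LG H \<alpha>"
proof -
  have "\<exists>D. strong_reg_var_law D \<alpha> \<and> (\<forall>x. cdf D x = p * cdf LF x + (1 - p) * cdf LG x)" if "0 < p" "p < 1" for p
  proof -
    have s: "(\<lambda>x. p * cdf LF x + (1 - p) * cdf LG x) \<in> strong_reg_var \<alpha>" by (rule srv[OF that])
    then obtain D where D: "real_distribution D" "cdf D = (\<lambda>x. p * cdf LF x + (1 - p) * cdf LG x)"
      by (auto simp: strong_reg_var_def distribution_def)
    then have "strong_reg_var_law D \<alpha>"
      using s \<alpha> by (simp add: strong_reg_var_law_def strong_reg_var_law_axioms_def)
    then show ?thesis using D by auto
  qed
  then obtain D where D: "\<And>p. 0 < p \<Longrightarrow> p < 1 \<Longrightarrow> strong_reg_var_law (D p) \<alpha>"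
    and cdf_D: "\<And>p x. 0 < p \<Longrightarrow> p < 1 \<Longrightarrow> cdf (D p) x = p * cdf LF x + (1 - p) * cdf LG x" by metis
  have rd: "real_distribution (D p)" if "0 < p" "p < 1" for p
    using D[OF that] by (simp add: strong_reg_var_law_def)
  define H where "H = D (1/2)"
  have H: "real_distribution H" unfolding H_def by (rule rd) auto
  interpret H: strong_reg_var_law H \<alpha> unfolding H_def by (rule D) auto
  interpret LG: real_distribution LG by (rule LG)
  have ccdf_D: "ccdf (D p) x = p * ccdf LF x + (1 - p) * ccdf LG x" if "0 < p" "p < 1" for p x
    unfolding ccdf_eq[OF rd[OF that]] ccdf_eq[OF LF] ccdf_eq[OF LG] cdf_D[OF that] by (simp add: algebra_simps)
  have H_eq: "ccdf H x = (ccdf LF x + ccdf LG x) / 2" for x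
    unfolding H_def using ccdf_D[of "1/2" x] by simp
  have RVD: "((\<lambda>x. (ccdf (D p) (x / y) - y powr \<alpha> * ccdf (D p) x) / ccdf H x) \<longlongrightarrow> 0) at_top"
    if p: "0 < p" "p < 1" and y: "y > 0" for p y
  proof (rule Lim_null_comparison)
    interpret Dp: strong_reg_var_law "D p" \<alpha> by (rule D) fact+
    have "((\<lambda>x. ccdf (D p) (x / y) / ccdf (D p) x - y powr \<alpha>) \<longlongrightarrow> y powr \<alpha> - y powr \<alpha>) at_top"
      by (intro tendsto_intros Dp.RV y)
    then have "((\<lambda>x. \<bar>ccdf (D p) (x / y) / ccdf (D p) x - y powr \<alpha>\<bar> * 2) \<longlongrightarrow> \<bar>y powr \<alpha> - y powr \<alpha>\<bar> * 2) at_top"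
      by (rule tendsto_mult[OF tendsto_rabs tendsto_const])
    then show "((\<lambda>x. \<bar>ccdf (D p) (x / y) / ccdf (D p) x - y powr \<alpha>\<bar> * 2) \<longlongrightarrow> 0) at_top" by simp
    show "\<forall>\<^sub>F x in at_top. norm ((ccdf (D p) (x / y) - y powr \<alpha> * ccdf (D p) x) / ccdf H x)
        \<le> \<bar>ccdf (D p) (x / y) / ccdf (D p) x - y powr \<alpha>\<bar> * 2"
    proof (intro always_eventually allI)
      fix x
      have "ccdf (D p) x \<le> ccdf LF x + ccdf LG x"
        using p mult_right_mono[of p 1 "ccdf LF x"] mult_right_mono[of "1 - p" 1 "ccdf LG x"] by (simp add: ccdf_D)
      then have "ccdf (D p) x / ccdf H x \<le> 2" using H.D_pos[of x] H_eq[of x] by (simp add: field_simps)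
      then have "\<bar>ccdf (D p) (x / y) / ccdf (D p) x - y powr \<alpha>\<bar> * (ccdf (D p) x / ccdf H x)
         \<le> \<bar>ccdf (D p) (x / y) / ccdf (D p) x - y powr \<alpha>\<bar> * 2" by (rule mult_left_mono) simp
      moreover have "norm ((ccdf (D p) (x / y) - y powr \<alpha> * ccdf (D p) x) / ccdf H x)
         = \<bar>ccdf (D p) (x / y) / ccdf (D p) x - y powr \<alpha>\<bar> * (ccdf (D p) x / ccdf H x)"
      proof -
        have "ccdf (D p) (x / y) - y powr \<alpha> * ccdf (D p) x = (ccdf (D p) (x / y) / ccdf (D p) x - y powr \<alpha>) * ccdf (D p) x"
          using Dp.D_pos[of x] by (simp add: field_simps)
        then show ?thesis by (simp add: abs_mult abs_divide)
      qed
      ultimately show "norm ((ccdf (D p) (x / y) - y powr \<alpha> * ccdf (D p) x) / ccdf H x)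
        \<le> \<bar>ccdf (D p) (x / y) / ccdf (D p) x - y powr \<alpha>\<bar> * 2" by (simp only:)
    qed
  qed
  \<comment> \<open>Two mixing proportions suffice to solve for the tails of \<open>LF\<close> and \<open>LG\<close> separately.\<close>
  have F_eq: "ccdf LF x = 2 * ccdf (D (2/3)) x - ccdf (D (1/3)) x"
    and G_eq: "ccdf LG x = 2 * ccdf (D (1/3)) x - ccdf (D (2/3)) x" for x
    by (simp_all add: ccdf_D)
  have zero: "2 * 0 - 0 = (0::real)" by simp
  have comb: "2 * ((A - k * B) / t) - (C - k * E) / t = ((2 * A - C) - k * (2 * B - E)) / t" for A B C E k t :: real
    by (simp add: divide_inverse algebra_simps)
  have "tail_pair LF LG H \<alpha>"
  proof (rule tail_pair.intro)
    show "measure LG {..0} = 0" using G0 by (simp add: cdf_def)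
    show "((\<lambda>x. (ccdf LF (x / y) - y powr \<alpha> * ccdf LF x) / ccdf H x) \<longlongrightarrow> 0) at_top" if y: "y > 0" for y
    proof -
      have "((\<lambda>x. 2 * ((ccdf (D (2/3)) (x / y) - y powr \<alpha> * ccdf (D (2/3)) x) / ccdf H x)
          - (ccdf (D (1/3)) (x / y) - y powr \<alpha> * ccdf (D (1/3)) x) / ccdf H x) \<longlongrightarrow> 2 * 0 - 0) at_top"
        by (intro tendsto_intros RVD y) auto
      then show ?thesis unfolding F_eq comb zero .
    qed
    show "((\<lambda>x. (ccdf LG (x / y) - y powr \<alpha> * ccdf LG x) / ccdf H x) \<longlongrightarrow> 0) at_top" if y: "y > 0" for y
    proof -
      have "((\<lambda>x. 2 * ((ccdf (D (1/3)) (x / y) - y powr \<alpha> * ccdf (D (1/3)) x) / ccdf H x)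
          - (ccdf (D (2/3)) (x / y) - y powr \<alpha> * ccdf (D (2/3)) x) / ccdf H x) \<longlongrightarrow> 2 * 0 - 0) at_top"
        by (intro tendsto_intros RVD y) auto
      then show ?thesis unfolding G_eq comb zero .
    qed
    show "\<exists>A\<ge>1. \<forall>\<^sub>F x in at_top. mconv LG (ccdf H) {A<..x / A} x \<le> \<epsilon> * ccdf H x"
      if \<epsilon>: "\<epsilon> > 0" for \<epsilon>
    proof -
      obtain A where A: "A \<ge> 1" "\<forall>\<^sub>F x in at_top. (\<integral>\<^sup>+y. ennreal (indicator {A<..x / A} y * ccdf H (x / y)) \<partial>H) \<le> ennreal (\<epsilon> / 2 * ccdf H x)"
        using H.middle[of "\<epsilon> / 2"] \<epsilon> by auto
      \<comment> \<open>LG makes up half of the mixture H.\<close>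
      have sc: "LG \<le> scale_measure 2 H"
      proof -
        have "emeasure LG B \<le> 2 * emeasure H B" if B: "B \<in> sets borel" for B
        proof -
          have "measure H B = 1/2 * measure LF B + (1 - 1/2) * measure LG B"
            unfolding H_def by (rule cdf_convex_comb_measure[OF LF LG rd cdf_D B]) auto
          then have "measure LG B \<le> 2 * measure H B" by simp
          then have "ennreal (measure LG B) \<le> ennreal (2 * measure H B)" by (rule ennreal_leI)
          then show ?thesis by (simp add: LG.emeasure_eq_measure H.emeasure_eq_measure ennreal_mult')
        qed
        then show ?thesis by (auto simp: le_measure)
      qed
      have "\<forall>\<^sub>F x in at_top. mconv LG (ccdf H) {A<..x / A} x \<le> \<epsilon> * ccdf H x"
        using A(2)
      proof eventually_elim
        case (elim x)
        let ?g = "\<lambda>y. indicator {A<..x / A} y * ccdf H (x / y)"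
        have [measurable]: "?g \<in> borel_measurable borel" using ccdf_measurable[OF H] by measurable
        have "(\<integral>\<^sup>+y. ennreal (?g y) \<partial>LG) \<le> (\<integral>\<^sup>+y. ennreal (?g y) \<partial>scale_measure 2 H)"
          by (rule nn_integral_mono_measure[OF _ sc]) simp
        also have "\<dots> = 2 * (\<integral>\<^sup>+y. ennreal (?g y) \<partial>H)" by (rule nn_integral_scale_measure) measurable
        also have "\<dots> \<le> 2 * ennreal (\<epsilon> / 2 * ccdf H x)" using elim by (intro mult_left_mono) auto
        also have "\<dots> = ennreal (2 * (\<epsilon> / 2 * ccdf H x))" using \<epsilon> by (subst ennreal_mult') auto
        finally have "(\<integral>\<^sup>+y. ennreal (?g y) \<partial>LG) \<le> ennreal (\<epsilon> * ccdf H x)" by simp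
        then have "enn2real (\<integral>\<^sup>+y. ennreal (?g y) \<partial>LG) \<le> \<epsilon> * ccdf H x"
          using \<epsilon> by (intro enn2real_leI) auto
        then show ?case by (subst integral_eq_nn_integral) auto
      qed
      then show ?thesis using A(1) by blast
    qed
  qed (rule LF LG H \<alpha> H_eq H.D_pos H.moment)+
  then show ?thesis by blast
qed

section \<open>Fixed points of the recursion\<close>

lemma mom_nonneg: "mom \<alpha> N \<ge> 0"
  unfolding pos_moment_def by (intro integral_nonneg_AE) auto

text \<open>For y > 0 the positive part and the power both factor, and Tonelli applies. The
  computation stays with extended integrals until the end, where \<open>enn2real\<close> is
  multiplicative.\<close>

lemma mom_prod_law:
  assumes LG: "real_distribution LG" and N: "real_distribution N" and pos: "measure LG {..0} = 0"
  shows "mom \<alpha> (prod_law LG N) = mom \<alpha> LG * mom \<alpha> N"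
proof -
  interpret LG: real_distribution LG by fact
  interpret N: real_distribution N by fact
  interpret P: pair_prob_space LG N ..
  have m: "(\<lambda>(y, z). y * z) \<in> borel_measurable (LG \<Otimes>\<^sub>M N)" by measurable
  have ae: "AE y in LG. y > 0"
  proof -
    have "AE y in LG. y \<notin> {..0}"
      by (rule AE_not_in) (use pos in \<open>auto simp: null_sets_def LG.emeasure_eq_measure\<close>)
    then show ?thesis by eventually_elim auto
  qed
  have nn: "mom \<alpha> K = enn2real (\<integral>\<^sup>+z. ennreal (max z 0 powr \<alpha>) \<partial>K)" if "real_distribution K" for K
  proof -
    interpret K: real_distribution K by fact
    show ?thesis unfolding pos_moment_def by (rule integral_eq_nn_integral) auto
  qed
  have "(\<integral>\<^sup>+z. ennreal (max z 0 powr \<alpha>) \<partial>prod_law LG N) = (\<integral>\<^sup>+q. ennreal (max (fst q * snd q) 0 powr \<alpha>) \<partial>(LG \<Otimes>\<^sub>M N))"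
    unfolding prod_law_def by (subst nn_integral_distr[OF m]) (auto simp: case_prod_beta)
  also have "\<dots> = (\<integral>\<^sup>+y. \<integral>\<^sup>+z. ennreal (max (y * z) 0 powr \<alpha>) \<partial>N \<partial>LG)"
  proof -
    have "(\<lambda>q. ennreal (max (fst q * snd q) 0 powr \<alpha>)) \<in> borel_measurable (LG \<Otimes>\<^sub>M N)" by measurable
    from N.nn_integral_fst[OF this, symmetric] show ?thesis by simp
  qed
  also have "\<dots> = (\<integral>\<^sup>+y. ennreal (max y 0 powr \<alpha>) * (\<integral>\<^sup>+z. ennreal (max z 0 powr \<alpha>) \<partial>N) \<partial>LG)"
  proof (rule nn_integral_cong_AE, use ae in eventually_elim)
    fix y :: real assume y: "y > 0"
    have "(\<integral>\<^sup>+z. ennreal (max (y * z) 0 powr \<alpha>) \<partial>N) = (\<integral>\<^sup>+z. ennreal (max y 0 powr \<alpha>) * ennreal (max z 0 powr \<alpha>) \<partial>N)"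
    proof (intro nn_integral_cong)
      fix z :: real
      have "max (y * z) 0 = y * max z 0" using y by (auto simp: max_def zero_le_mult_iff mult_le_0_iff)
      then show "ennreal (max (y * z) 0 powr \<alpha>) = ennreal (max y 0 powr \<alpha>) * ennreal (max z 0 powr \<alpha>)"
        using y by (simp add: powr_mult ennreal_mult')
    qed
    also have "\<dots> = ennreal (max y 0 powr \<alpha>) * (\<integral>\<^sup>+z. ennreal (max z 0 powr \<alpha>) \<partial>N)"
      by (rule nn_integral_cmult) measurable
    finally show "(\<integral>\<^sup>+z. ennreal (max (y * z) 0 powr \<alpha>) \<partial>N) = ennreal (max y 0 powr \<alpha>) * (\<integral>\<^sup>+z. ennreal (max z 0 powr \<alpha>) \<partial>N)" .
  qed
  also have "\<dots> = (\<integral>\<^sup>+y. ennreal (max y 0 powr \<alpha>) \<partial>LG) * (\<integral>\<^sup>+z. ennreal (max z 0 powr \<alpha>) \<partial>N)"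
    by (rule nn_integral_multc) measurable
  finally show ?thesis
    unfolding nn[OF LG] nn[OF N] nn[OF real_distribution_prod_law[OF LG N]] by (simp add: enn2real_mult)
qed

lemma ccdf_distr_max:
  assumes "real_distribution N" "x \<ge> 0" shows "ccdf (distr N borel (max 0)) x = ccdf N x"
proof -
  interpret N: real_distribution N by fact
  have "ccdf (distr N borel (max 0)) x = measure N (max 0 -` {x<..} \<inter> space N)"
    by (rule measure_distr) (auto)
  also have "max 0 -` {x<..} \<inter> space N = {x<..}" using assms(2) by auto
  finally show ?thesis .
qed

lemma mom_distr_max:
  assumes "real_distribution N" shows "mom \<alpha> (distr N borel (max 0)) = mom \<alpha> N"
proof -
  interpret N: real_distribution N by fact
  show ?thesis unfolding pos_moment_def by (subst integral_distr) (auto simp: max.commute max_def intro!: Bochner_Integration.integral_cong)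
qed

section \<open>One step of the recursion, its fixed points, and the degenerate case\<close>

context tail_pair
begin

interpretation LF: real_distribution LF by (rule LF)
interpretation LG: real_distribution LG by (rule LG)
interpretation H: real_distribution H by (rule H)

definition \<mu> :: real where "\<mu> = mom \<alpha> LG"

lemma AE_LG_pos: "AE y in LG. y > 0"
proof -
  have "AE y in LG. y \<notin> {..0}"
    by (rule AE_not_in) (use LG_pos in \<open>auto simp: null_sets_def LG.emeasure_eq_measure\<close>)
  then show ?thesis by eventually_elim auto
qed

lemma ccdf_LG_0: "ccdf LG 0 = 1"
  using LG_pos ccdf_eq[OF LG, of 0] by (simp add: cdf_def)

text \<open>\<open>max z 0 powr \<alpha>\<close> vanishes exactly for z \<le> 0, also when \<alpha>
  = 0, because \<open>0 powr 0 = 0\<close>.\<close>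

lemma mom_zero_imp:
  assumes N: "real_distribution N" and I: "integrable N (\<lambda>z. max z 0 powr \<alpha>)" and z: "mom \<alpha> N = 0"
  shows "ccdf N 0 = 0"
proof -
  interpret N: real_distribution N by fact
  have "AE z in N. max z 0 powr \<alpha> = 0"
    using integral_nonneg_eq_0_iff_AE[OF I] z by (simp add: pos_moment_def)
  then have "AE z in N. z \<notin> {0<..}" by eventually_elim (auto simp: max_def split: if_splits)
  then have "emeasure N {0<..} = 0" by (subst (asm) AE_iff_measurable[where N="{0<..}"]) auto
  then show ?thesis by (simp add: measure_def)
qed

lemma \<mu>_pos: "\<mu> > 0"
proof -
  have "\<mu> \<noteq> 0" using mom_zero_imp[OF LG LG_moment] ccdf_LG_0 by (auto simp: \<mu>_def)
  then show ?thesis using mom_nonneg[of LG \<alpha>] by (simp add: \<mu>_def)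
qed

text \<open>If either conclusion failed, the \<alpha>-th power of Y would be at least 1 almost
  surely: for \<alpha> = 0 because Y > 0, in the other case because Y \<ge> 1. Its mean could not be
  below 1 then.\<close>

lemma \<mu>_lt_1D:
  assumes "\<mu> < 1"
  shows "\<alpha> > 0" and "measure LG {..<1} > 0"
proof -
  have I: "integrable LG (\<lambda>z. max z 0 powr \<alpha>)" by (rule LG_moment)
  have *: False if "AE z in LG. max z 0 powr \<alpha> \<ge> 1"
  proof -
    have "(\<integral>z. 1 \<partial>LG) \<le> \<mu>" unfolding \<mu>_def pos_moment_def
      by (rule integral_mono_AE[OF _ I that]) simp
    then show False using assms LG.prob_space by simp
  qed
  show "\<alpha> > 0"
  proof (rule ccontr)
    assume "\<not> \<alpha> > 0"
    then have "\<alpha> = 0" using \<alpha>_nonneg by simp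
    moreover have "AE z in LG. max z 0 powr 0 \<ge> 1" using AE_LG_pos by eventually_elim auto
    ultimately show False using * by simp
  qed
  show "measure LG {..<1} > 0"
  proof (rule ccontr)
    assume "\<not> measure LG {..<1} > 0"
    then have "measure LG {..<1} = 0" using measure_nonneg[of LG "{..<1}"] by linarith
    then have "AE y in LG. y \<notin> {..<1}"
      by (intro AE_not_in) (auto simp: null_sets_def LG.emeasure_eq_measure)
    then have "AE z in LG. max z 0 powr \<alpha> \<ge> 1"
      by eventually_elim (auto intro!: ge_one_powr_ge_zero \<alpha>_nonneg simp: max_def)
    then show False by (rule *)
  qed
qed

definition step :: "real measure \<Rightarrow> real measure" where "step N = prod_law LG (LF \<star> N)"

lemma real_distribution_step: "real_distribution N \<Longrightarrow> real_distribution (step N)"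
  unfolding step_def by (intro real_distribution_prod_law real_distribution_conv LF LG)

lemma mom_step: "real_distribution N \<Longrightarrow> mom \<alpha> (step N) = \<mu> * mom \<alpha> (LF \<star> N)"
  unfolding step_def \<mu>_def by (intro mom_prod_law LG real_distribution_conv LF LG_pos)

text \<open>The moment of X + W is rewritten as the moment of the new law divided by \<mu>. This is
  the origin of the exponent -1 at i = 1 in \<open>BC_coeff\<close>.\<close>

lemma approx_step:
  assumes N: "real_distribution N" and ap: "approx N a b D" and nn: "a \<ge> 0" "b \<ge> 0" "D \<ge> 0"
  shows "approx (step N) (\<mu> * (a + 1)) (\<mu> * b + mom \<alpha> (step N) / \<mu>) (\<mu> * D)"
proof -
  have "approx (LF \<star> N) (a + 1) b D" by (rule approx_sum[OF N ap nn])
  then have "approx (prod_law LG (LF \<star> N)) (\<mu> * (a + 1)) (\<mu> * b + mom \<alpha> (LF \<star> N)) (\<mu> * D)"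
    unfolding \<mu>_def using nn by (intro approx_prod real_distribution_conv LF N) auto
  moreover have "mom \<alpha> (LF \<star> N) = mom \<alpha> (step N) / \<mu>" using mom_step[OF N] \<mu>_pos by simp
  ultimately show ?thesis by (simp add: step_def)
qed

lemma approx_cong:
  assumes "approx N a b D" "\<And>x. x > 0 \<Longrightarrow> ccdf N' x = ccdf N x"
  shows "approx N' a b D"
  unfolding approx_def
proof (intro allI impI)
  fix \<eta> :: real assume "\<eta> > 0"
  then have "\<forall>\<^sub>F x in at_top. \<bar>ccdf N x - (a * ccdf LF x + b * ccdf LG x)\<bar> \<le> (D + \<eta>) * h x"
    using assms(1) by (simp add: approx_def)
  then show "\<forall>\<^sub>F x in at_top. \<bar>ccdf N' x - (a * ccdf LF x + b * ccdf LG x)\<bar> \<le> (D + \<eta>) * h x"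
    using eventually_gt_at_top[of 0] by eventually_elim (simp add: assms(2))
qed

text \<open>The fixed point satisfies the approximation with some finite error \<open>D0\<close>, and every further
  application of \<open>step\<close> multiplies this error by \<open>\<mu> < 1\<close>.\<close>

lemma fixpoint_approx:
  assumes N: "real_distribution N" and \<mu>: "\<mu> < 1"
    and K: "\<And>x. x > 0 \<Longrightarrow> ccdf N x \<le> K * h x" "K \<ge> 0"
    and fix_tail: "\<And>x. x > 0 \<Longrightarrow> ccdf N x = ccdf (step N) x"
    and fix_mom: "mom \<alpha> N = mom \<alpha> (step N)"
  shows "approx N (\<mu> / (1 - \<mu>)) (mom \<alpha> N / (\<mu> * (1 - \<mu>))) 0"
proof -
  let ?a = "\<mu> / (1 - \<mu>)" and ?b = "mom \<alpha> N / (\<mu> * (1 - \<mu>))"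
  have a: "?a \<ge> 0" and b: "?b \<ge> 0" using \<mu> \<mu>_pos mom_nonneg[of N \<alpha>] by auto
  \<comment> \<open>\<open>?a\<close> and \<open>?b\<close> solve the fixed-point equations of the
    coefficient recursion in \<open>approx_step\<close>.\<close>
  have ea: "\<mu> * (?a + 1) = ?a" using \<mu> by (simp add: field_simps)
  have eb: "\<mu> * ?b + mom \<alpha> (step N) / \<mu> = ?b"
    unfolding fix_mom[symmetric] using \<mu> \<mu>_pos by (simp add: divide_simps) (simp add: algebra_simps)
  \<comment> \<open>K bounds the tail of N relative to h; the other terms bound the proposed
    expansion, since the tails of LF and LG are at most 2 h.\<close>
  define D0 where "D0 = K + 2 * ?a + 2 * ?b"
  have D0: "D0 \<ge> 0" using a b K by (simp add: D0_def)
  have "approx N ?a ?b (\<mu> ^ k * D0)" for k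
  proof (induction k)
    case 0
    show ?case unfolding approx_def
    proof (intro allI impI)
      fix \<eta> :: real assume \<eta>: "\<eta> > 0"
      show "\<forall>\<^sub>F x in at_top. \<bar>ccdf N x - (?a * ccdf LF x + ?b * ccdf LG x)\<bar> \<le> (\<mu> ^ 0 * D0 + \<eta>) * h x"
        using eventually_gt_at_top[of 0]
      proof eventually_elim
        case (elim x)
        have 1: "?a * ccdf LF x \<le> ?a * (2 * h x)" "?b * ccdf LG x \<le> ?b * (2 * h x)"
          by (intro mult_left_mono TF_le TG_le a b)+
        have 2: "0 \<le> ?a * ccdf LF x" "0 \<le> ?b * ccdf LG x" by (intro mult_nonneg_nonneg a b measure_nonneg)+
        have "\<bar>ccdf N x - (?a * ccdf LF x + ?b * ccdf LG x)\<bar> \<le> K * h x + (?a * (2 * h x) + ?b * (2 * h x))"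
          using 1 2 K(1)[OF elim] measure_nonneg[of N "{x<..}"] by linarith
        also have "\<dots> = D0 * h x" unfolding D0_def by (simp only: algebra_simps)
        also have "\<dots> \<le> (\<mu> ^ 0 * D0 + \<eta>) * h x" using \<eta> by (intro mult_right_mono) auto
        finally show ?case .
      qed
    qed
  next
    case (Suc k)
    have "approx (step N) (\<mu> * (?a + 1)) (\<mu> * ?b + mom \<alpha> (step N) / \<mu>) (\<mu> * (\<mu> ^ k * D0))"
      using D0 \<mu>_pos by (intro approx_step[OF N Suc a b]) auto
    then have "approx (step N) ?a ?b (\<mu> ^ Suc k * D0)" unfolding ea eb by (simp only: power_Suc mult.assoc)
    then show ?case by (rule approx_cong) (rule fix_tail)
  qed
  note ap = this
  show ?thesis unfolding approx_def
  proof (intro allI impI)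
    fix \<eta> :: real assume \<eta>: "\<eta> > 0"
    have "(\<lambda>k. \<mu> ^ k * D0) \<longlonglongrightarrow> 0 * D0"
      using \<mu> \<mu>_pos by (intro tendsto_mult tendsto_const LIMSEQ_power_zero) auto
    then have "\<forall>\<^sub>F k in sequentially. \<mu> ^ k * D0 < \<eta> / 2" by (rule order_tendstoD(2)) (use \<eta> in simp)
    then obtain k where k: "\<mu> ^ k * D0 < \<eta> / 2" by (auto simp: eventually_sequentially)
    have "\<forall>\<^sub>F x in at_top. \<bar>ccdf N x - (?a * ccdf LF x + ?b * ccdf LG x)\<bar> \<le> (\<mu> ^ k * D0 + \<eta> / 2) * h x"
      using ap[of k] \<eta> half_gt_zero[OF \<eta>] unfolding approx_def by blast
    then show "\<forall>\<^sub>F x in at_top. \<bar>ccdf N x - (?a * ccdf LF x + ?b * ccdf LG x)\<bar> \<le> (0 + \<eta>) * h x"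
    proof eventually_elim
      case (elim x)
      have "(\<mu> ^ k * D0 + \<eta> / 2) * h x \<le> (0 + \<eta>) * h x" using k by (intro mult_right_mono) auto
      then show ?case using elim by linarith
    qed
  qed
qed

text \<open>For b > 0 the right-hand side is at least \<open>2 * min a b * h x\<close>, so an o(h)
  error is negligible against it. For b = 0 the tail of LF alone need not control h; there
  \<open>zero\<close> makes both sides vanish for x \<ge> 0.\<close>

lemma approx_imp_asymp_equiv:
  assumes ap: "approx N a b 0" and a: "a > 0" and b: "b \<ge> 0"
    and zero: "b = 0 \<Longrightarrow> ccdf N 0 = 0 \<and> ccdf LF 0 = 0" and N: "real_distribution N"
  shows "(\<lambda>x. ccdf N x) \<sim>[at_top] (\<lambda>x. a * ccdf LF x + b * ccdf LG x)"
proof (cases "b = 0")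
  case True
  have "\<forall>\<^sub>F x in at_top. ccdf N x = a * ccdf LF x + b * ccdf LG x"
    using eventually_ge_at_top[of 0]
  proof eventually_elim
    case (elim x)
    have "ccdf N x = 0" "ccdf LF x = 0"
      using zero[OF True] ccdf_mono[OF N elim] ccdf_mono[OF LF elim] measure_nonneg[of N "{x<..}"] measure_nonneg[of LF "{x<..}"] by linarith+
    then show ?case using True by simp
  qed
  then show ?thesis by (rule asymp_equiv_refl_ev)
next
  case False
  define c where "c = min a b"
  have c: "c > 0" using a b False by (simp add: c_def)
  have low: "2 * c * h x \<le> a * ccdf LF x + b * ccdf LG x" for x
  proof -
    have "c * ccdf LF x \<le> a * ccdf LF x" "c * ccdf LG x \<le> b * ccdf LG x"
      by (intro mult_right_mono; simp add: c_def)+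
    then show ?thesis by (simp add: H_eq algebra_simps)
  qed
  have "(\<lambda>x. ccdf N x - (a * ccdf LF x + b * ccdf LG x)) \<in> o[at_top](\<lambda>x. a * ccdf LF x + b * ccdf LG x)"
  proof (rule landau_o.smallI)
    fix e :: real assume e: "e > 0"
    have "2 * c * e > 0" using c e by simp
    then have "\<forall>\<^sub>F x in at_top. \<bar>ccdf N x - (a * ccdf LF x + b * ccdf LG x)\<bar> \<le> (0 + 2 * c * e) * h x"
      using ap unfolding approx_def by blast
    then show "\<forall>\<^sub>F x in at_top. norm (ccdf N x - (a * ccdf LF x + b * ccdf LG x)) \<le> e * norm (a * ccdf LF x + b * ccdf LG x)"
    proof eventually_elim
      case (elim x)
      have "(0 + 2 * c * e) * h x = e * (2 * c * h x)" by simp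
      also have "\<dots> \<le> e * (a * ccdf LF x + b * ccdf LG x)" using low e by (intro mult_left_mono) auto
      finally show ?case using elim a b by simp
    qed
  qed
  then show ?thesis by (simp add: asymp_equiv_altdef)
qed

text \<open>With W \<ge> 0 and Y > 0, a positive X makes Y (X + W) positive. This settles the
  degenerate case for the maxima, and for the sums at n = 1, where W = 0.\<close>

lemma step_zero_imp:
  assumes N: "real_distribution N" and z: "ccdf (step N) 0 = 0" and nn: "measure N {0..} = 1"
  shows "ccdf LF 0 = 0"
proof -
  interpret N: real_distribution N by fact
  interpret C: real_distribution "LF \<star> N" by (rule real_distribution_conv[OF LF N])
  interpret P1: pair_prob_space LG "LF \<star> N" ..
  interpret P2: pair_prob_space LF N ..
  have "measure (LG \<Otimes>\<^sub>M (LF \<star> N)) ({0<..} \<times> {0<..}) \<le> ccdf (step N) 0"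
    unfolding step_def ccdf_prod_law[OF LG C.real_distribution_axioms]
  proof (rule P1.finite_measure_mono)
    show "{(y, z). y * z > 0} \<in> P1.events" by (rule sets_pair_Collect[OF LG C.real_distribution_axioms]) measurable
  qed auto
  then have "ccdf (LF \<star> N) 0 \<le> 0"
    using z ccdf_LG_0 measure_pair_Times[OF LG.prob_space_axioms C.prob_space_axioms, of "{0<..}" "{0<..}"] by simp
  moreover have "measure (LF \<Otimes>\<^sub>M N) ({0<..} \<times> {0..}) \<le> ccdf (LF \<star> N) 0"
    unfolding ccdf_conv[OF LF N]
  proof (rule P2.finite_measure_mono)
    show "{(y, z). y + z > 0} \<in> P2.events" by (rule sets_pair_Collect[OF LF N]) measurable
  qed auto
  ultimately have "ccdf LF 0 \<le> 0"
    using nn measure_pair_Times[OF LF.prob_space_axioms N.prob_space_axioms, of "{0<..}" "{0..}"] by simp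
  then show ?thesis using measure_nonneg[of LF "{0<..}"] by linarith
qed

text \<open>If \<open>X > \<delta>\<close> and \<open>Y < 1\<close> have positive probability, an upper bound \<open>c \<le> 0\<close> of the support of a
  fixed point can be improved to \<open>c - \<delta> / 2\<close>, and so on indefinitely.\<close>

lemma fixpoint_zero_imp:
  assumes N: "real_distribution N" and fp: "step N = N" and z: "ccdf N 0 = 0" and \<mu>: "\<mu> < 1"
  shows "ccdf LF 0 = 0"
proof (rule ccontr)
  interpret N: real_distribution N by fact
  interpret C: real_distribution "LF \<star> N" by (rule real_distribution_conv[OF LF N])
  interpret P1: pair_prob_space LG "LF \<star> N" ..
  interpret P2: pair_prob_space LF N ..
  assume "ccdf LF 0 \<noteq> 0"
  then have "cdf LF 0 < 1" using ccdf_eq[OF LF, of 0] measure_nonneg[of LF "{0<..}"] by linarith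
  moreover have "(cdf LF \<longlongrightarrow> cdf LF 0) (at_right 0)"
    using LF.cdf_is_right_cont[of 0] by (simp add: continuous_within)
  ultimately have "\<forall>\<^sub>F d in at_right 0. cdf LF d < 1" by (auto dest: order_tendstoD(2))
  then have "\<forall>\<^sub>F d in at_right 0. cdf LF d < 1 \<and> d > 0"
    by (intro eventually_conj) (auto simp: eventually_at_right_less)
  then have "\<exists>d. cdf LF d < 1 \<and> d > 0" by (rule eventually_happens'[rotated]) simp
  then obtain \<delta> where \<delta>: "cdf LF \<delta> < 1" "\<delta> > 0" by blast
  then have F: "ccdf LF \<delta> > 0" by (simp add: ccdf_eq[OF LF])
  have G: "measure LG {0<..<1} > 0"
  proof -
    have "measure LG {..<1} = measure LG {0<..<1}"
      using AE_LG_pos by (intro LG.finite_measure_eq_AE) auto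
    then show ?thesis using \<mu>_lt_1D(2)[OF \<mu>] by simp
  qed
  have desc: "ccdf N (c - \<delta> / 2) = 0" if c: "c \<le> 0" "ccdf N c = 0" for c
  proof (rule ccontr)
    assume "ccdf N (c - \<delta> / 2) \<noteq> 0"
    then have n: "ccdf N (c - \<delta> / 2) > 0" using measure_nonneg[of N "{c - \<delta>/2<..}"] by linarith
    have "measure (LF \<Otimes>\<^sub>M N) ({\<delta><..} \<times> {c - \<delta> / 2<..}) \<le> ccdf (LF \<star> N) (c + \<delta> / 2)"
      unfolding ccdf_conv[OF LF N]
    proof (rule P2.finite_measure_mono)
      show "{(y, z). y + z > c + \<delta> / 2} \<in> P2.events" by (rule sets_pair_Collect[OF LF N]) measurable
    qed auto
    moreover have "measure (LF \<Otimes>\<^sub>M N) ({\<delta><..} \<times> {c - \<delta> / 2<..}) = ccdf LF \<delta> * ccdf N (c - \<delta> / 2)"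
      by (rule measure_pair_Times) (auto simp: LF.prob_space_axioms N.prob_space_axioms)
    ultimately have C: "ccdf (LF \<star> N) (c + \<delta> / 2) > 0" using F n by (smt (verit) mult_pos_pos)
    \<comment> \<open>A factor below 1 moves a negative threshold towards 0, so the gain of \<delta>
      / 2 survives the multiplication.\<close>
    have sub: "y * z > c" if yz: "0 < y" "y < 1" "z > c + \<delta> / 2" for y z :: real
    proof (cases "c + \<delta> / 2 \<ge> 0")
      case True
      then have "y * z > 0" using yz by (intro mult_pos_pos) auto
      then show ?thesis using c by simp
    next
      case False
      have "y * z > y * (c + \<delta> / 2)" using yz by simp
      moreover have "y * (c + \<delta> / 2) \<ge> 1 * (c + \<delta> / 2)"
        using yz False by (intro mult_right_mono_neg) auto
      moreover have "c < 1 * (c + \<delta> / 2)" using \<delta>(2) by simp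
      ultimately show ?thesis by (meson less_le_trans less_trans)
    qed
    have "measure (LG \<Otimes>\<^sub>M (LF \<star> N)) ({0<..<1} \<times> {c + \<delta> / 2<..}) \<le> ccdf (step N) c"
      unfolding step_def ccdf_prod_law[OF LG C.real_distribution_axioms]
    proof (rule P1.finite_measure_mono)
      show "{(y, z). y * z > c} \<in> P1.events" by (rule sets_pair_Collect[OF LG C.real_distribution_axioms]) measurable
    qed (auto intro: sub)
    moreover have "measure (LG \<Otimes>\<^sub>M (LF \<star> N)) ({0<..<1} \<times> {c + \<delta> / 2<..}) = measure LG {0<..<1} * ccdf (LF \<star> N) (c + \<delta> / 2)"
      by (rule measure_pair_Times) (auto simp: LG.prob_space_axioms C.prob_space_axioms)
    ultimately show False using G C c(2) unfolding fp by (smt (verit) mult_pos_pos)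
  qed
  have "ccdf N (- (real k * (\<delta> / 2))) = 0" for k
  proof (induction k)
    case (Suc k)
    have "ccdf N (- (real k * (\<delta> / 2)) - \<delta> / 2) = 0" using \<delta> by (intro desc Suc) auto
    moreover have "- (real k * (\<delta> / 2)) - \<delta> / 2 = - (real (Suc k) * (\<delta> / 2))" by (simp add: field_simps)
    ultimately show ?case by (simp only:)
  qed (simp add: z)
  then have one: "cdf N (- (real k * (\<delta> / 2))) = 1" for k using ccdf_eq[OF N] by (metis diff_eq_eq add_0 eq_iff_diff_eq_0)
  have "filterlim (\<lambda>k::nat. - (real k * (\<delta> / 2))) at_bot sequentially" using \<delta> by real_asymp
  then have "(\<lambda>k. cdf N (- (real k * (\<delta> / 2)))) \<longlonglongrightarrow> 0" by (rule filterlim_compose[OF N.cdf_lim_at_bot])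
  then show False unfolding one by (simp add: LIMSEQ_const_iff)
qed

end

section \<open>Laws of recursive functionals\<close>

text \<open>The recursions are studied on the canonical space of pairs of sequences, where dropping
  the first coordinates is a measure-preserving map.\<close>

locale law_pair =
  fixes LF LG :: "real measure"
  assumes LF: "real_distribution LF" and LG: "real_distribution LG"
begin

interpretation LF: real_distribution LF by (rule LF)
interpretation LG: real_distribution LG by (rule LG)

definition SF :: "(nat \<Rightarrow> real) measure" where "SF = (\<Pi>\<^sub>M i\<in>UNIV. LF)"
definition SG :: "(nat \<Rightarrow> real) measure" where "SG = (\<Pi>\<^sub>M i\<in>UNIV. LG)"
definition Q :: "((nat \<Rightarrow> real) \<times> (nat \<Rightarrow> real)) measure" where "Q = SF \<Otimes>\<^sub>M SG"

interpretation SF: sequence_space LF by unfold_locales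
interpretation SG: sequence_space LG by unfold_locales

lemma prob_SF: "prob_space SF" and prob_SG: "prob_space SG"
  unfolding SF_def SG_def by unfold_locales

interpretation PSF: prob_space SF by (rule prob_SF)
interpretation PSG: prob_space SG by (rule prob_SG)
interpretation Q: pair_prob_space SF SG ..

lemma prob_Q: "prob_space Q" unfolding Q_def by unfold_locales

lemma sets_SF [measurable_cong]: "sets SF = sets (\<Pi>\<^sub>M i\<in>UNIV. borel)"
  and sets_SG [measurable_cong]: "sets SG = sets (\<Pi>\<^sub>M i\<in>UNIV. borel)"
  unfolding SF_def SG_def by (intro sets_PiM_cong; simp)+

lemma sets_Q [measurable_cong]: "sets Q = sets ((\<Pi>\<^sub>M i\<in>UNIV. borel) \<Otimes>\<^sub>M (\<Pi>\<^sub>M i\<in>UNIV. borel))"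
  unfolding Q_def by (intro sets_pair_measure_cong sets_SF sets_SG)

lemma space_Q [simp]: "space Q = UNIV"
  unfolding Q_def SF_def SG_def by (simp add: space_pair_measure space_PiM)

definition shift :: "(nat \<Rightarrow> real) \<times> (nat \<Rightarrow> real) \<Rightarrow> (nat \<Rightarrow> real) \<times> (nat \<Rightarrow> real)" where
  "shift p = (\<lambda>i. fst p (Suc i), \<lambda>i. snd p (Suc i))"

definition glue :: "(real \<times> (nat \<Rightarrow> real)) \<times> (real \<times> (nat \<Rightarrow> real)) \<Rightarrow> (nat \<Rightarrow> real) \<times> (nat \<Rightarrow> real)" where
  "glue = (\<lambda>(u, v). (case u of (s, \<omega>) \<Rightarrow> case_nat s \<omega>, case v of (s, \<omega>) \<Rightarrow> case_nat s \<omega>))"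

abbreviation "R \<equiv> (LF \<Otimes>\<^sub>M SF) \<Otimes>\<^sub>M (LG \<Otimes>\<^sub>M SG)"

lemma measurable_case_nat_F: "(\<lambda>(s, \<omega>). case_nat s \<omega>) \<in> LF \<Otimes>\<^sub>M SF \<rightarrow>\<^sub>M SF"
  unfolding SF_def by measurable

lemma measurable_case_nat_G: "(\<lambda>(s, \<omega>). case_nat s \<omega>) \<in> LG \<Otimes>\<^sub>M SG \<rightarrow>\<^sub>M SG"
  unfolding SG_def by measurable

lemma glue_measurable [measurable]: "glue \<in> R \<rightarrow>\<^sub>M Q"
  unfolding glue_def Q_def using measurable_case_nat_F measurable_case_nat_G by measurable

text \<open>This expresses that the first coordinates of both sequences are independent of each
  other and of the shifted pair, which again has law Q.\<close>

lemma distr_glue: "distr R Q glue = Q"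
proof -
  have F: "distr (LF \<Otimes>\<^sub>M SF) SF (\<lambda>(s, \<omega>). case_nat s \<omega>) = SF" unfolding SF_def by (rule SF.PiM_iter)
  have G: "distr (LG \<Otimes>\<^sub>M SG) SG (\<lambda>(s, \<omega>). case_nat s \<omega>) = SG" unfolding SG_def by (rule SG.PiM_iter)
  have "distr (LF \<Otimes>\<^sub>M SF) SF (\<lambda>(s, \<omega>). case_nat s \<omega>) \<Otimes>\<^sub>M distr (LG \<Otimes>\<^sub>M SG) SG (\<lambda>(s, \<omega>). case_nat s \<omega>)
     = distr R (SF \<Otimes>\<^sub>M SG) (\<lambda>(u, v). ((\<lambda>(s, \<omega>). case_nat s \<omega>) u, (\<lambda>(s, \<omega>). case_nat s \<omega>) v))"
    by (rule pair_measure_distr[OF measurable_case_nat_F measurable_case_nat_G])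
       (simp add: G PSG.sigma_finite_measure_axioms)
  then show ?thesis unfolding F G by (simp add: Q_def glue_def)
qed

lemma shift_measurable [measurable]: "shift \<in> Q \<rightarrow>\<^sub>M Q"
proof -
  have 1: "(\<lambda>p i. fst p (Suc i)) \<in> Q \<rightarrow>\<^sub>M (\<Pi>\<^sub>M i\<in>UNIV. borel)"
    by (rule measurable_PiM_single') (measurable; simp)+
  have 2: "(\<lambda>p i. snd p (Suc i)) \<in> Q \<rightarrow>\<^sub>M (\<Pi>\<^sub>M i\<in>UNIV. borel)"
    by (rule measurable_PiM_single') (measurable; simp)+
  have "shift \<in> Q \<rightarrow>\<^sub>M ((\<Pi>\<^sub>M i\<in>UNIV. borel) \<Otimes>\<^sub>M (\<Pi>\<^sub>M i\<in>UNIV. borel))"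
    unfolding shift_def using 1 2 by measurable
  then show ?thesis by (simp cong: measurable_cong_sets add: sets_Q)
qed

lemma shift_glue: "shift (glue ((a, x), (b, y))) = (x, y)"
  by (simp add: shift_def glue_def)

lemma fst_glue: "fst (glue ((a, x), (b, y))) 0 = a" and snd_glue: "snd (glue ((a, x), (b, y))) 0 = b"
  by (simp_all add: glue_def)

text \<open>After composition with \<open>glue\<close> the shift becomes the projection of each
  factor of R to its sequence part.\<close>

lemma distr_shift: "distr Q Q shift = Q"
proof -
  interpret A: pair_prob_space LF SF ..
  interpret B: pair_prob_space LG SG ..
  have F: "distr (LF \<Otimes>\<^sub>M SF) SF snd = SF"
  proof (rule measure_eqI)
    fix A assume "A \<in> sets (distr (LF \<Otimes>\<^sub>M SF) SF snd)"
    then have A: "A \<in> sets SF" by simp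
    then have "emeasure (distr (LF \<Otimes>\<^sub>M SF) SF snd) A = emeasure (LF \<Otimes>\<^sub>M SF) (space LF \<times> A)"
      using sets.sets_into_space[OF A] by (subst emeasure_distr) (auto intro!: arg_cong2[where f=emeasure] simp: space_pair_measure)
    also have "\<dots> = emeasure SF A" using A LF.emeasure_space_1 by (subst PSF.emeasure_pair_measure_Times) auto
    finally show "emeasure (distr (LF \<Otimes>\<^sub>M SF) SF snd) A = emeasure SF A" .
  qed simp
  have G: "distr (LG \<Otimes>\<^sub>M SG) SG snd = SG"
  proof (rule measure_eqI)
    fix A assume "A \<in> sets (distr (LG \<Otimes>\<^sub>M SG) SG snd)"
    then have A: "A \<in> sets SG" by simp
    then have "emeasure (distr (LG \<Otimes>\<^sub>M SG) SG snd) A = emeasure (LG \<Otimes>\<^sub>M SG) (space LG \<times> A)"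
      using sets.sets_into_space[OF A] by (subst emeasure_distr) (auto intro!: arg_cong2[where f=emeasure] simp: space_pair_measure)
    also have "\<dots> = emeasure SG A" using A LG.emeasure_space_1 by (subst PSG.emeasure_pair_measure_Times) auto
    finally show "emeasure (distr (LG \<Otimes>\<^sub>M SG) SG snd) A = emeasure SG A" .
  qed simp
  have "distr Q Q shift = distr (distr R Q glue) Q shift" by (simp add: distr_glue)
  also have "\<dots> = distr R Q (shift \<circ> glue)" by (rule distr_distr) measurable
  also have "shift \<circ> glue = (\<lambda>(u, v). (snd u, snd v))" by (auto simp: fun_eq_iff shift_glue)
  also have "distr R Q (\<lambda>(u, v). (snd u, snd v)) = distr (LF \<Otimes>\<^sub>M SF) SF snd \<Otimes>\<^sub>M distr (LG \<Otimes>\<^sub>M SG) SG snd"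
    unfolding Q_def by (rule pair_measure_distr[symmetric]) (auto simp: G PSG.sigma_finite_measure_axioms)
  finally show ?thesis unfolding F G by (simp add: Q_def)
qed

lemma component_measurable [measurable]: "(\<lambda>p. fst p i) \<in> borel_measurable Q" "(\<lambda>p. snd p i) \<in> borel_measurable Q"
  by measurable

text \<open>The integral is written over R and its order rearranged by Tonelli until both sequences
  are innermost. They then collapse to the law of f, the sum with the first X to a convolution, and
  the factor Y to \<open>prod_law\<close>. The outer \<phi> is the identity for sums and the
  positive part for maxima.\<close>

lemma law_step:
  assumes [measurable]: "f \<in> borel_measurable Q" "g \<in> borel_measurable Q" "\<phi> \<in> borel_measurable borel"
    and rec: "AE p in Q. g p = \<phi> (snd p 0 * (fst p 0 + f (shift p)))"
  shows "distr Q borel g = distr (prod_law LG (LF \<star> distr Q borel f)) borel \<phi>"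
proof (rule measure_eqI)
  let ?N = "distr Q borel f"
  interpret QQ: prob_space Q by (rule prob_Q)
  interpret N: prob_space ?N by (rule QQ.prob_space_distr) measurable
  interpret LFN: real_distribution "LF \<star> ?N"
    by (rule real_distribution_conv[OF LF QQ.real_distribution_distr]) measurable
  interpret PL: pair_prob_space LG "LF \<star> ?N" ..
  interpret A: pair_prob_space LF SF ..
  interpret B: pair_prob_space LG SG ..
  interpret AB: pair_prob_space "LF \<Otimes>\<^sub>M SF" "LG \<Otimes>\<^sub>M SG" ..
  interpret AL: pair_prob_space "LF \<Otimes>\<^sub>M SF" LG ..
  fix S assume "S \<in> sets (distr Q borel g)"
  then have S [measurable]: "S \<in> sets borel" by simp
  have mk [measurable]: "(\<lambda>t. indicator S (\<phi> t) :: ennreal) \<in> borel_measurable borel" by measurable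
  have f2 [measurable]: "f \<in> borel_measurable (SF \<Otimes>\<^sub>M SG)"
    using assms(1) unfolding Q_def .
  have "emeasure (distr Q borel g) S = (\<integral>\<^sup>+z. indicator S z \<partial>distr Q borel g)" by simp
  also have "\<dots> = (\<integral>\<^sup>+p. indicator S (g p) \<partial>Q)" by (rule nn_integral_distr) measurable
  also have "\<dots> = (\<integral>\<^sup>+p. indicator S (\<phi> (snd p 0 * (fst p 0 + f (shift p)))) \<partial>Q)"
    by (rule nn_integral_cong_AE) (use rec in \<open>eventually_elim, simp\<close>)
  also have "\<dots> = (\<integral>\<^sup>+p. indicator S (\<phi> (snd p 0 * (fst p 0 + f (shift p)))) \<partial>distr R Q glue)"
    unfolding distr_glue ..
  also have "\<dots> = (\<integral>\<^sup>+r. indicator S (\<phi> (snd (glue r) 0 * (fst (glue r) 0 + f (shift (glue r))))) \<partial>R)"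
    by (rule nn_integral_distr) measurable
  also have "\<dots> = (\<integral>\<^sup>+r. indicator S (\<phi> (fst (snd r) * (fst (fst r) + f (snd (fst r), snd (snd r))))) \<partial>R)"
    by (intro nn_integral_cong) (auto simp: shift_glue fst_glue snd_glue)
  also have "\<dots> = (\<integral>\<^sup>+u. \<integral>\<^sup>+v. indicator S (\<phi> (fst v * (fst u + f (snd u, snd v)))) \<partial>(LG \<Otimes>\<^sub>M SG) \<partial>(LF \<Otimes>\<^sub>M SF))"
  proof -
    have "(\<lambda>r. indicator S (\<phi> (fst (snd r) * (fst (fst r) + f (snd (fst r), snd (snd r))))) :: ennreal) \<in> borel_measurable R"
      by measurable
    from B.nn_integral_fst[OF this, symmetric] show ?thesis by simp
  qed
  also have "\<dots> = (\<integral>\<^sup>+u. \<integral>\<^sup>+b. \<integral>\<^sup>+y. indicator S (\<phi> (b * (fst u + f (snd u, y)))) \<partial>SG \<partial>LG \<partial>(LF \<Otimes>\<^sub>M SF))"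
  proof (intro nn_integral_cong)
    fix u assume "u \<in> space (LF \<Otimes>\<^sub>M SF)"
    then have [measurable]: "(\<lambda>y. f (snd u, y)) \<in> borel_measurable SG"
      using assms(1) unfolding Q_def by (auto simp: space_pair_measure)
    show "(\<integral>\<^sup>+v. indicator S (\<phi> (fst v * (fst u + f (snd u, snd v)))) \<partial>(LG \<Otimes>\<^sub>M SG))
       = (\<integral>\<^sup>+b. \<integral>\<^sup>+y. indicator S (\<phi> (b * (fst u + f (snd u, y)))) \<partial>SG \<partial>LG)"
    proof -
      have "(\<lambda>v. indicator S (\<phi> (fst v * (fst u + f (snd u, snd v)))) :: ennreal) \<in> borel_measurable (LG \<Otimes>\<^sub>M SG)"
        by measurable
      from PSG.nn_integral_fst[OF this, symmetric] show ?thesis by simp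
    qed
  qed
  also have "\<dots> = (\<integral>\<^sup>+b. \<integral>\<^sup>+u. \<integral>\<^sup>+y. indicator S (\<phi> (b * (fst u + f (snd u, y)))) \<partial>SG \<partial>(LF \<Otimes>\<^sub>M SF) \<partial>LG)"
    by (rule AL.Fubini'[symmetric]) measurable
  also have "\<dots> = (\<integral>\<^sup>+b. \<integral>\<^sup>+a. \<integral>\<^sup>+x. \<integral>\<^sup>+y. indicator S (\<phi> (b * (a + f (x, y)))) \<partial>SG \<partial>SF \<partial>LF \<partial>LG)"
  proof (intro nn_integral_cong)
    fix b :: real
    have "(\<lambda>u. \<integral>\<^sup>+y. indicator S (\<phi> (b * (fst u + f (snd u, y)))) \<partial>SG) \<in> borel_measurable (LF \<Otimes>\<^sub>M SF)"
      by measurable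
    from PSF.nn_integral_fst[OF this, symmetric]
    show "(\<integral>\<^sup>+u. \<integral>\<^sup>+y. indicator S (\<phi> (b * (fst u + f (snd u, y)))) \<partial>SG \<partial>(LF \<Otimes>\<^sub>M SF))
      = (\<integral>\<^sup>+a. \<integral>\<^sup>+x. \<integral>\<^sup>+y. indicator S (\<phi> (b * (a + f (x, y)))) \<partial>SG \<partial>SF \<partial>LF)" by simp
  qed
  also have "\<dots> = (\<integral>\<^sup>+b. \<integral>\<^sup>+a. \<integral>\<^sup>+p. indicator S (\<phi> (b * (a + f p))) \<partial>Q \<partial>LF \<partial>LG)"
    unfolding Q_def by (intro nn_integral_cong, subst PSG.nn_integral_fst[symmetric]) (use assms(1) in \<open>simp add: Q_def\<close>, simp)
  also have "\<dots> = (\<integral>\<^sup>+b. \<integral>\<^sup>+a. \<integral>\<^sup>+w. indicator S (\<phi> (b * (a + w))) \<partial>?N \<partial>LF \<partial>LG)"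
    by (intro nn_integral_cong, subst nn_integral_distr) (measurable)
  also have "\<dots> = (\<integral>\<^sup>+b. \<integral>\<^sup>+c. indicator S (\<phi> (b * c)) \<partial>(LF \<star> ?N) \<partial>LG)"
    by (intro nn_integral_cong, subst nn_integral_convolution)
       (auto simp: LF.finite_measure_axioms N.finite_measure_axioms)
  also have "\<dots> = (\<integral>\<^sup>+z. indicator S (\<phi> z) \<partial>prod_law LG (LF \<star> ?N))"
  proof -
    have m: "(\<lambda>(y, z). y * z) \<in> borel_measurable (LG \<Otimes>\<^sub>M (LF \<star> ?N))" by measurable
    have "(\<integral>\<^sup>+z. indicator S (\<phi> z) \<partial>prod_law LG (LF \<star> ?N)) = (\<integral>\<^sup>+q. indicator S (\<phi> (fst q * snd q)) \<partial>(LG \<Otimes>\<^sub>M (LF \<star> ?N)))"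
      unfolding prod_law_def by (subst nn_integral_distr[OF m]) (auto simp: case_prod_beta)
    also have "\<dots> = (\<integral>\<^sup>+b. \<integral>\<^sup>+c. indicator S (\<phi> (b * c)) \<partial>(LF \<star> ?N) \<partial>LG)"
    proof -
      have "(\<lambda>q. indicator S (\<phi> (fst q * snd q)) :: ennreal) \<in> borel_measurable (LG \<Otimes>\<^sub>M (LF \<star> ?N))"
        by measurable
      from LFN.nn_integral_fst[OF this, symmetric] show ?thesis by simp
    qed
    finally show ?thesis by simp
  qed
  also have "\<dots> = (\<integral>\<^sup>+z. indicator S z \<partial>distr (prod_law LG (LF \<star> ?N)) borel \<phi>)"
  proof (rule nn_integral_distr[symmetric])
    show "\<phi> \<in> borel_measurable (prod_law LG (LF \<star> ?N))" by (simp add: prod_law_def)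
  qed measurable
  also have "\<dots> = emeasure (distr (prod_law LG (LF \<star> ?N)) borel \<phi>) S" by simp
  finally show "emeasure (distr Q borel g) S = emeasure (distr (prod_law LG (LF \<star> ?N)) borel \<phi>) S" .
qed simp

end

section \<open>Randomly weighted sums and maxima\<close>

text \<open>Coordinates are numbered from 0 here, whereas \<open>S_sum\<close> and \<open>M_max\<close> start with index 1.\<close>

definition perp_sum :: "nat \<Rightarrow> (nat \<Rightarrow> real) \<times> (nat \<Rightarrow> real) \<Rightarrow> real" where
  "perp_sum n p = (\<Sum>i<n. fst p i * (\<Prod>j<Suc i. snd p j))"

definition perp_max :: "nat \<Rightarrow> (nat \<Rightarrow> real) \<times> (nat \<Rightarrow> real) \<Rightarrow> real" where
  "perp_max n p = Max ((\<lambda>k. perp_sum k p) ` {0..n})"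

lemma perp_sum_0 [simp]: "perp_sum 0 p = 0" by (simp add: perp_sum_def)

lemma perp_max_0 [simp]: "perp_max 0 p = 0" by (simp add: perp_max_def)

lemma perp_sum_le_perp_max: "perp_sum n p \<le> perp_max n p"
  unfolding perp_max_def by (rule Max_ge) auto

lemma perp_max_mono: "m \<le> n \<Longrightarrow> perp_max m p \<le> perp_max n p"
  unfolding perp_max_def by (rule Max_mono) auto

lemma A_coeff_Suc: "A_coeff \<mu> (Suc n) = \<mu> * (A_coeff \<mu> n + 1)"
proof -
  have rec: "A_coeff \<mu> (Suc n) = A_coeff \<mu> n + \<mu> ^ Suc n" for n by (simp add: A_coeff_def)
  show ?thesis
  proof (induction n)
    case (Suc n)
    have "A_coeff \<mu> (Suc (Suc n)) = A_coeff \<mu> (Suc n) + \<mu> * \<mu> ^ Suc n" by (simp only: rec[of "Suc n"] power_Suc)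
    also have "\<dots> = \<mu> * (A_coeff \<mu> n + \<mu> ^ Suc n + 1)" unfolding Suc by (simp add: algebra_simps)
    finally show ?case by (simp only: rec[of n])
  qed (simp add: A_coeff_def)
qed

text \<open>The summand i = 1 yields \<open>m (Suc n) / \<mu>\<close>. In the others, lowering i by
  one extracts a factor \<mu> and leaves the index of m unchanged.\<close>

lemma BC_coeff_Suc:
  assumes "\<mu> \<noteq> 0"
  shows "BC_coeff \<mu> m (Suc n) = \<mu> * BC_coeff \<mu> m n + m (Suc n) / \<mu>"
proof -
  have p: "\<mu> powi (int (Suc i) - 2) = \<mu> * \<mu> powi (int i - 2)" for i
  proof -
    have "\<mu> powi (int (Suc i) - 2) = \<mu> powi (1 + (int i - 2))" by (simp add: algebra_simps)
    also have "\<dots> = \<mu> * \<mu> powi (int i - 2)" using assms by (subst power_int_add) auto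
    finally show ?thesis .
  qed
  have "BC_coeff \<mu> m (Suc n) = (\<Sum>i\<in>insert 1 (Suc ` {1..n}). \<mu> powi (int i - 2) * m (Suc n - i + 1))"
  proof -
    have "{1..Suc n} = insert 1 (Suc ` {1..n})" unfolding image_Suc_atLeastAtMost by auto
    then show ?thesis by (simp add: BC_coeff_def)
  qed
  also have "\<dots> = \<mu> powi (int 1 - 2) * m (Suc n - 1 + 1) + (\<Sum>i\<in>Suc ` {1..n}. \<mu> powi (int i - 2) * m (Suc n - i + 1))"
    by (rule sum.insert) auto
  also have "(\<Sum>i\<in>Suc ` {1..n}. \<mu> powi (int i - 2) * m (Suc n - i + 1)) = (\<Sum>i\<in>{1..n}. \<mu> * (\<mu> powi (int i - 2) * m (n - i + 1)))"
    by (subst sum.reindex) (auto simp only: o_def p mult.assoc diff_Suc_Suc inj_Suc)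
  also have "\<dots> = \<mu> * BC_coeff \<mu> m n" by (simp add: BC_coeff_def sum_distrib_left)
  finally show ?thesis by (simp add: power_int_minus divide_inverse)
qed

lemma A_coeff_0 [simp]: "A_coeff \<mu> 0 = 0" and BC_coeff_0 [simp]: "BC_coeff \<mu> m 0 = 0"
  by (simp_all add: A_coeff_def BC_coeff_def)

lemma A_coeff_nonneg: "\<mu> > 0 \<Longrightarrow> A_coeff \<mu> n \<ge> 0"
  unfolding A_coeff_def by (intro sum_nonneg) auto

lemma BC_coeff_nonneg: "\<mu> > 0 \<Longrightarrow> (\<And>k. m k \<ge> 0) \<Longrightarrow> BC_coeff \<mu> m n \<ge> 0"
  unfolding BC_coeff_def by (intro sum_nonneg mult_nonneg_nonneg) auto

lemma BC_coeff_zeroD: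
  assumes \<mu>: "\<mu> > 0" and m: "\<And>k. m k \<ge> 0" and z: "BC_coeff \<mu> m n = 0" and k: "k \<in> {1..n}"
  shows "m k = 0"
proof -
  have "\<mu> powi (int i - 2) * m (n - i + 1) = 0" if "i \<in> {1..n}" for i
    using z that \<mu> m unfolding BC_coeff_def by (subst (asm) sum_nonneg_eq_0_iff) auto
  from this[of "n - k + 1"] show ?thesis using k \<mu> by auto
qed

section \<open>The sums and maxima on the given probability space\<close>

locale perpetuity = prob_space M + tail_pair LF LG H \<alpha> + law_pair LF LG
  for M :: "'a measure" and LF LG H :: "real measure" and \<alpha> :: real +
  fixes X Y :: "nat \<Rightarrow> 'a \<Rightarrow> real"
  assumes X_indep: "indep_vars (\<lambda>_. borel) X UNIV"
    and Y_indep: "indep_vars (\<lambda>_. borel) Y UNIV"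
    and XY_indep: "indep_var (\<Pi>\<^sub>M i\<in>(UNIV :: nat set). borel) (\<lambda>\<omega> i. X i \<omega>)
           (\<Pi>\<^sub>M i\<in>(UNIV :: nat set). borel) (\<lambda>\<omega> i. Y i \<omega>)"
    and X_law: "\<And>i. distr M borel (X i) = LF"
    and Y_law: "\<And>i. distr M borel (Y i) = LG"
begin

interpretation LF: real_distribution LF by (rule LF)
interpretation LG: real_distribution LG by (rule LG)
interpretation QQ: prob_space Q by (rule prob_Q)

lemma X_meas [measurable]: "X i \<in> borel_measurable M" and Y_meas [measurable]: "Y i \<in> borel_measurable M"
  using X_indep Y_indep by (auto simp: indep_vars_def)

definition Z0 :: "'a \<Rightarrow> (nat \<Rightarrow> real) \<times> (nat \<Rightarrow> real)" where
  "Z0 \<omega> = (\<lambda>i. X i \<omega>, \<lambda>i. Y i \<omega>)"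

text \<open>The generic variables of index 0 are dropped, since they do not enter the sums. The
  independence assumptions determine the law of \<open>Z0\<close>; shift invariance carries it over
  to \<open>Z\<close>.\<close>

definition Z :: "'a \<Rightarrow> (nat \<Rightarrow> real) \<times> (nat \<Rightarrow> real)" where
  "Z \<omega> = (\<lambda>i. X (Suc i) \<omega>, \<lambda>i. Y (Suc i) \<omega>)"

lemma Z_eq: "Z = shift \<circ> Z0"
  by (simp add: fun_eq_iff Z_def Z0_def shift_def)

lemma distr_Z0: "distr M Q Z0 = Q" and Z0_meas [measurable]: "Z0 \<in> M \<rightarrow>\<^sub>M Q"
proof -
  let ?P = "\<Pi>\<^sub>M i\<in>(UNIV :: nat set). (borel :: real measure)"
  have F: "distr M ?P (\<lambda>\<omega> i. X i \<omega>) = SF"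
    using indep_vars_iff_distr_eq_PiM[where I=UNIV and M'="\<lambda>_. borel" and X=X] X_indep X_law by (simp add: SF_def restrict_def)
  have G: "distr M ?P (\<lambda>\<omega> i. Y i \<omega>) = SG"
    using indep_vars_iff_distr_eq_PiM[where I=UNIV and M'="\<lambda>_. borel" and X=Y] Y_indep Y_law by (simp add: SG_def restrict_def)
  have J: "(\<lambda>\<omega> i. X i \<omega>) \<in> M \<rightarrow>\<^sub>M ?P" "(\<lambda>\<omega> i. Y i \<omega>) \<in> M \<rightarrow>\<^sub>M ?P"
    "distr M ?P (\<lambda>\<omega> i. X i \<omega>) \<Otimes>\<^sub>M distr M ?P (\<lambda>\<omega> i. Y i \<omega>) = distr M (?P \<Otimes>\<^sub>M ?P) Z0"
    using XY_indep unfolding indep_var_distribution_eq Z0_def by auto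
  have "Z0 \<in> M \<rightarrow>\<^sub>M ?P \<Otimes>\<^sub>M ?P" unfolding Z0_def using J(1,2) by measurable
  then show "Z0 \<in> M \<rightarrow>\<^sub>M Q" by (simp cong: measurable_cong_sets add: sets_Q)
  have "distr M Q Z0 = distr M (?P \<Otimes>\<^sub>M ?P) Z0" by (rule distr_cong) (auto simp: sets_Q)
  then show "distr M Q Z0 = Q" using J(3) F G by (simp add: Q_def)
qed

lemma Z_meas [measurable]: "Z \<in> M \<rightarrow>\<^sub>M Q"
  unfolding Z_eq by measurable

lemma distr_Z: "distr M Q Z = Q"
proof -
  have "distr M Q Z = distr (distr M Q Z0) Q shift" unfolding Z_eq by (rule distr_distr[symmetric]) measurable
  then show ?thesis by (simp add: distr_Z0 distr_shift)
qed

lemma AE_Z: "AE p in Q. P p \<Longrightarrow> AE \<omega> in M. P (Z \<omega>)"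
  by (rule AE_distrD[OF Z_meas], subst distr_Z)

lemma AE_shift: "AE p in Q. P p \<Longrightarrow> AE p in Q. P (shift p)"
  by (rule AE_distrD[OF shift_measurable], subst distr_shift)

lemma S_sum_eq: "S_sum X Y n \<omega> = perp_sum n (Z \<omega>)"
  unfolding S_sum_def perp_sum_def Z_def by (simp add: sum.atLeast1_atMost_eq prod.atLeast1_atMost_eq)

lemma M_max_eq: "M_max X Y n \<omega> = perp_max n (Z \<omega>)"
  unfolding M_max_def perp_max_def by (simp add: S_sum_eq)

lemma perp_sum_meas [measurable]: "perp_sum n \<in> borel_measurable Q"
  unfolding perp_sum_def[abs_def] by measurable

lemma perp_max_meas [measurable]: "perp_max n \<in> borel_measurable Q"
  unfolding perp_max_def[abs_def] by (rule borel_measurable_Max) auto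

text \<open>The first Y is a common factor of all summands. Peeling off the first rather than the
  last term leaves a remainder that depends only on the later variables, and the identity holds
  pathwise, so it passes to the limit.\<close>

lemma perp_sum_Suc: "perp_sum (Suc n) p = snd p 0 * (fst p 0 + perp_sum n (shift p))"
  unfolding perp_sum_def shift_def
  by (subst sum.lessThan_Suc_shift, subst prod.lessThan_Suc_shift) (simp add: sum_distrib_left algebra_simps)

text \<open>The index 0 contributes the value 0; for the other indices the recursion of the sums
  applies, and its affine map is increasing because the first Y is positive, so it commutes with the
  maximum.\<close>

lemma perp_max_Suc:
  assumes "snd p 0 > 0" shows "perp_max (Suc n) p = max 0 (snd p 0 * (fst p 0 + perp_max n (shift p)))"
proof -
  let ?f = "\<lambda>t. snd p 0 * (fst p 0 + t)"
  have "{0..Suc n} = insert 0 (Suc ` {0..n})" unfolding image_Suc_atLeastAtMost by auto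
  then have "(\<lambda>k. perp_sum k p) ` {0..Suc n} = insert 0 (?f ` ((\<lambda>k. perp_sum k (shift p)) ` {0..n}))"
    by (simp add: image_image perp_sum_Suc del: image_Suc_atLeastAtMost)
  then have "perp_max (Suc n) p = max 0 (Max (?f ` ((\<lambda>k. perp_sum k (shift p)) ` {0..n})))"
    unfolding perp_max_def by simp
  also have "Max (?f ` ((\<lambda>k. perp_sum k (shift p)) ` {0..n})) = ?f (perp_max n (shift p))"
    unfolding perp_max_def using assms by (intro mono_Max_commute[symmetric] monoI) auto
  finally show ?thesis .
qed

lemma AE_snd_pos: "AE p in Q. snd p 0 > 0"
proof -
  have "AE \<omega> in M. Y 0 \<omega> > 0"
    by (rule AE_distrD[OF Y_meas], subst Y_law, rule AE_LG_pos)
  then have "AE \<omega> in M. snd (Z0 \<omega>) 0 > 0" by (simp add: Z0_def)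
  moreover have "{p \<in> space Q. snd p 0 > 0} \<in> sets Q" by measurable
  ultimately have "AE p in distr M Q Z0. snd p 0 > 0" by (subst AE_distr_iff) auto
  then show ?thesis unfolding distr_Z0 .
qed

definition law :: "((nat \<Rightarrow> real) \<times> (nat \<Rightarrow> real) \<Rightarrow> real) \<Rightarrow> real measure" where
  "law f = distr Q borel f"

lemma real_distribution_law [simp]: "f \<in> borel_measurable Q \<Longrightarrow> real_distribution (law f)"
  unfolding law_def by (rule QQ.real_distribution_distr)

lemma ccdf_law: "f \<in> borel_measurable Q \<Longrightarrow> ccdf (law f) x = measure Q {p. f p > x}"
  unfolding law_def by (subst measure_distr) (auto simp: vimage_def)

lemma law_Z: "f \<in> borel_measurable Q \<Longrightarrow> law f = distr M borel (\<lambda>\<omega>. f (Z \<omega>))"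
proof -
  assume [measurable]: "f \<in> borel_measurable Q"
  have "law f = distr (distr M Q Z) borel f" by (simp add: law_def distr_Z)
  also have "\<dots> = distr M borel (f \<circ> Z)" by (rule distr_distr) measurable
  finally show ?thesis by (simp add: o_def)
qed

lemma prob_law: "f \<in> borel_measurable Q \<Longrightarrow> \<P>(\<omega> in M. f (Z \<omega>) > x) = ccdf (law f) x"
proof -
  assume [measurable]: "f \<in> borel_measurable Q"
  have "ccdf (law f) x = measure M ((\<lambda>\<omega>. f (Z \<omega>)) -` {x<..} \<inter> space M)"
    by (subst law_Z, simp, rule measure_distr) measurable
  also have "(\<lambda>\<omega>. f (Z \<omega>)) -` {x<..} \<inter> space M = {\<omega> \<in> space M. f (Z \<omega>) > x}" by auto
  finally show ?thesis by simp
qed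

lemma pos_moment_law: "f \<in> borel_measurable Q \<Longrightarrow> pos_moment M \<alpha> (\<lambda>\<omega>. f (Z \<omega>)) = mom \<alpha> (law f)"
proof -
  assume [measurable]: "f \<in> borel_measurable Q"
  show ?thesis unfolding pos_moment_def by (subst law_Z, simp, subst integral_distr) auto
qed

lemma law_rec:
  assumes "f \<in> borel_measurable Q" "g \<in> borel_measurable Q"
    and "AE p in Q. g p = snd p 0 * (fst p 0 + f (shift p))"
  shows "law g = step (law f)"
proof -
  have "law g = distr (step (law f)) borel (\<lambda>x. x)"
    unfolding law_def step_def by (rule law_step[OF assms(1,2) _ assms(3)]) simp
  also have "\<dots> = step (law f)" by (rule distr_id2) (simp add: step_def prod_law_def)
  finally show ?thesis .
qed

lemma law_rec_max:
  assumes "f \<in> borel_measurable Q" "g \<in> borel_measurable Q"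
    and "AE p in Q. g p = max 0 (snd p 0 * (fst p 0 + f (shift p)))"
  shows "law g = distr (step (law f)) borel (max 0)"
  unfolding law_def step_def by (rule law_step[OF assms(1,2) _ assms(3)]) simp

lemma law_perp_sum_Suc: "law (perp_sum (Suc n)) = step (law (perp_sum n))"
  by (rule law_rec) (auto simp: perp_sum_Suc)

lemma law_perp_max_Suc: "law (perp_max (Suc n)) = distr (step (law (perp_max n))) borel (max 0)"
  by (rule law_rec_max) (use AE_snd_pos in \<open>auto simp: perp_max_Suc\<close>)

text \<open>Tails and moments have to agree with those of \<open>step\<close> only on the positive
  side, so that the sums and the maxima, whose recursion takes a positive part, are treated
  together.\<close>

lemma approx_iterate:
  assumes N: "\<And>n. real_distribution (N n)" and N0: "\<And>x. x > 0 \<Longrightarrow> ccdf (N 0) x = 0"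
    and tail: "\<And>n x. x > 0 \<Longrightarrow> ccdf (N (Suc n)) x = ccdf (step (N n)) x"
    and mom: "\<And>n. mom \<alpha> (N (Suc n)) = mom \<alpha> (step (N n))"
  shows "approx (N n) (A_coeff \<mu> n) (BC_coeff \<mu> (\<lambda>k. mom \<alpha> (N k)) n) 0"
proof (induction n)
  case 0
  show ?case unfolding approx_def
    by (auto intro!: eventually_mono[OF eventually_gt_at_top[of 0]] simp: N0)
next
  case (Suc n)
  have "approx (step (N n)) (\<mu> * (A_coeff \<mu> n + 1))
    (\<mu> * BC_coeff \<mu> (\<lambda>k. mom \<alpha> (N k)) n + mom \<alpha> (step (N n)) / \<mu>) (\<mu> * 0)"
    by (rule approx_step[OF N Suc]) (auto intro: A_coeff_nonneg BC_coeff_nonneg \<mu>_pos mom_nonneg)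
  then have "approx (N (Suc n)) (\<mu> * (A_coeff \<mu> n + 1))
    (\<mu> * BC_coeff \<mu> (\<lambda>k. mom \<alpha> (N k)) n + mom \<alpha> (step (N n)) / \<mu>) (\<mu> * 0)"
    by (rule approx_cong) (rule tail)
  then show ?case using \<mu>_pos by (simp add: A_coeff_Suc BC_coeff_Suc mom)
qed

lemma A_coeff_pos: "n \<ge> 1 \<Longrightarrow> A_coeff \<mu> n > 0"
  using \<mu>_pos A_coeff_nonneg[OF \<mu>_pos, of "n - 1"] A_coeff_Suc[of \<mu> "n - 1"] by (auto intro!: mult_pos_pos)

text \<open>A vanishing coefficient of LG forces all moments up to n to vanish. At index 1 this says
  that one step from a nonnegative law is almost surely nonpositive, and X must be so too.\<close>

lemma asymp_iterate:
  assumes N: "\<And>n. real_distribution (N n)" and N0: "\<And>x. x > 0 \<Longrightarrow> ccdf (N 0) x = 0" "measure (N 0) {0..} = 1"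
    and tail: "\<And>n x. x \<ge> 0 \<Longrightarrow> ccdf (N (Suc n)) x = ccdf (step (N n)) x"
    and mom: "\<And>n. mom \<alpha> (N (Suc n)) = mom \<alpha> (step (N n))" and n: "n \<ge> 1"
  shows "(\<lambda>x. ccdf (N n) x) \<sim>[at_top]
    (\<lambda>x. A_coeff \<mu> n * ccdf LF x + BC_coeff \<mu> (\<lambda>k. mom \<alpha> (N k)) n * ccdf LG x)"
proof -
  have ap: "approx (N k) (A_coeff \<mu> k) (BC_coeff \<mu> (\<lambda>k. mom \<alpha> (N k)) k) 0" for k
    by (rule approx_iterate[OF N N0(1) _ mom]) (auto simp: tail)
  show ?thesis
  proof (rule approx_imp_asymp_equiv[OF ap A_coeff_pos[OF n] BC_coeff_nonneg[OF \<mu>_pos mom_nonneg] _ N])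
    assume z: "BC_coeff \<mu> (\<lambda>k. mom \<alpha> (N k)) n = 0"
    have c: "ccdf (N k) 0 = 0" if "k \<in> {1..n}" for k
      using BC_coeff_zeroD[OF \<mu>_pos mom_nonneg z that]
      by (intro mom_zero_imp[OF N approx_moment[OF N ap]]) (auto intro: A_coeff_nonneg BC_coeff_nonneg \<mu>_pos mom_nonneg)
    have "ccdf LF 0 = 0"
      by (rule step_zero_imp[OF N _ N0(2)]) (use c[of 1] n tail[of 0 0] in simp)
    then show "ccdf (N n) 0 = 0 \<and> ccdf LF 0 = 0" using c n by simp
  qed
qed

lemma law_nonneg: "f \<in> borel_measurable Q \<Longrightarrow> AE p in Q. f p \<ge> 0 \<Longrightarrow> measure (law f) {0..} = 1"
proof -
  assume [measurable]: "f \<in> borel_measurable Q" and ae: "AE p in Q. f p \<ge> 0"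
  have "measure (law f) {0..} = measure Q {p \<in> space Q. f p \<ge> 0}"
    unfolding law_def by (subst measure_distr) (auto intro!: arg_cong[where f="measure Q"])
  also have "\<dots> = 1"
  proof -
    have S: "{p \<in> space Q. f p \<ge> 0} \<in> sets Q" by measurable
    show ?thesis using QQ.prob_Collect_eq_1[OF S] ae by blast
  qed
  finally show ?thesis .
qed

lemma perp_max_nonneg: "perp_max n p \<ge> 0"
  using perp_max_mono[of 0 n p] by simp

lemma asymp_perp_sum:
  assumes "n \<ge> 1"
  shows "(\<lambda>x. ccdf (law (perp_sum n)) x) \<sim>[at_top]
    (\<lambda>x. A_coeff \<mu> n * ccdf LF x + BC_coeff \<mu> (\<lambda>k. mom \<alpha> (law (perp_sum k))) n * ccdf LG x)"
proof (rule asymp_iterate[OF _ _ _ _ _ assms])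
  show "ccdf (law (perp_sum 0)) x = 0" if "x > 0" for x using that by (subst ccdf_law) auto
  show "measure (law (perp_sum 0)) {0..} = 1" by (rule law_nonneg) auto
qed (simp_all only: real_distribution_law perp_sum_meas law_perp_sum_Suc)

lemma asymp_perp_max:
  assumes "n \<ge> 1"
  shows "(\<lambda>x. ccdf (law (perp_max n)) x) \<sim>[at_top]
    (\<lambda>x. A_coeff \<mu> n * ccdf LF x + BC_coeff \<mu> (\<lambda>k. mom \<alpha> (law (perp_max k))) n * ccdf LG x)"
proof (rule asymp_iterate[OF _ _ _ _ _ assms])
  show "ccdf (law (perp_max 0)) x = 0" if "x > 0" for x using that by (subst ccdf_law) auto
  show "measure (law (perp_max 0)) {0..} = 1" by (rule law_nonneg) auto
qed (simp_all only: real_distribution_law real_distribution_step perp_max_meas law_perp_max_Suc ccdf_distr_max mom_distr_max)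

end

text \<open>The sum is the mean number of n with W > c (n + 1), and this number is at most W /
  c.\<close>

lemma summable_tail_probabilities:
  assumes "prob_space N" and W: "integrable N W" "\<And>x. W x \<ge> 0" and c: "c > (0::real)"
  shows "summable (\<lambda>n. measure N {x \<in> space N. W x > c * real (Suc n)})"
proof (rule summableI_nonneg_bounded)
  interpret N: prob_space N by fact
  have [measurable]: "W \<in> borel_measurable N" using W by auto
  fix n :: nat
  \<comment> \<open>The additional bound by n carries the induction: if W > c (n + 1), the new count
    is at most n + 1, hence below W / c.\<close>
  have count: "(\<Sum>i<n. indicator {x \<in> space N. W x > c * real (Suc i)} x) \<le> min (real n) (W x / c)" if x: "x \<in> space N" for x
  proof (induction n)
    case (Suc n)
    show ?case
    proof (cases "W x > c * real (Suc n)")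
      case True
      then have "real (Suc n) \<le> W x / c" using c by (simp add: field_simps)
      then show ?thesis using Suc True x by simp
    next
      case False
      then show ?thesis using Suc by simp
    qed
  qed (use W c in simp)
  have i: "integrable N (indicator {x \<in> space N. W x > c * real (Suc i)} :: _ \<Rightarrow> real)" for i
    by (rule N.integrable_const_bound[where B=1]) auto
  have "(\<Sum>i<n. measure N {x \<in> space N. W x > c * real (Suc i)})
      = (\<Sum>i<n. \<integral>x. indicator {x \<in> space N. W x > c * real (Suc i)} x \<partial>N)"
    by (intro sum.cong refl) (simp add: Int_absorb2 Collect_conj_eq)
  also have "\<dots> = (\<integral>x. (\<Sum>i<n. indicator {x \<in> space N. W x > c * real (Suc i)} x) \<partial>N)"
    by (rule Bochner_Integration.integral_sum[symmetric]) (rule i)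
  also have "\<dots> \<le> (\<integral>x. W x / c \<partial>N)"
  proof (rule integral_mono)
    show "integrable N (\<lambda>x. \<Sum>i<n. indicator {x \<in> space N. W x > c * real (Suc i)} x :: real)"
      by (rule Bochner_Integration.integrable_sum) (rule i)
    show "integrable N (\<lambda>x. W x / c)" using W by simp
    show "(\<Sum>i<n. indicator {x \<in> space N. W x > c * real (Suc i)} x) \<le> W x / c" if "x \<in> space N" for x
      using count[OF that] by linarith
  qed
  finally show "(\<Sum>i<n. measure N {x \<in> space N. W x > c * real (Suc i)}) \<le> (\<integral>x. W x / c \<partial>N)" .
qed simp

section \<open>Almost sure limits for \<mu> < 1\<close>

context perpetuity
begin

interpretation LF: real_distribution LF by (rule LF)
interpretation LG: real_distribution LG by (rule LG)
interpretation QQ: prob_space Q by (rule prob_Q)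

lemma perp_max_uniform:
  assumes "\<mu> < 1"
  shows "\<exists>K\<ge>0. \<forall>n. \<forall>x>0. ccdf (law (perp_max n)) x \<le> K * h x"
proof -
  have "mom \<alpha> LG < 1" using assms by (simp add: \<mu>_def)
  from uniform_step[OF this] obtain \<rho> C where \<rho>: "0 \<le> \<rho>" "\<rho> < 1" "0 \<le> C"
    and st: "\<And>N K x. real_distribution N \<Longrightarrow> K \<ge> 0 \<Longrightarrow> (\<forall>x>0. ccdf N x \<le> K * h x) \<Longrightarrow> x > 0 \<Longrightarrow>
       ccdf (prod_law LG (LF \<star> N)) x \<le> (\<rho> * K + C) * h x" by blast
  \<comment> \<open>The fixed point of the map sending K to \<rho> K + C, so the bound reproduces
    itself at each step.\<close>
  define K where "K = C / (1 - \<rho>)"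
  have K: "K \<ge> 0" "\<rho> * K + C = K" using \<rho> by (auto simp: K_def field_simps)
  have "\<forall>x>0. ccdf (law (perp_max n)) x \<le> K * h x" for n
  proof (induction n)
    case 0
    show ?case
    proof (intro allI impI)
      fix x :: real assume "x > 0"
      then have "ccdf (law (perp_max 0)) x = 0" by (subst ccdf_law) auto
      also have "0 \<le> K * h x" using K by simp
      finally show "ccdf (law (perp_max 0)) x \<le> K * h x" .
    qed
  next
    case (Suc n)
    show ?case
    proof (intro allI impI)
      fix x :: real assume x: "x > 0"
      have "ccdf (law (perp_max (Suc n))) x = ccdf (step (law (perp_max n))) x"
        unfolding law_perp_max_Suc using x by (intro ccdf_distr_max real_distribution_step real_distribution_law) auto
      also have "\<dots> \<le> (\<rho> * K + C) * h x" unfolding step_def by (rule st[OF _ K(1) Suc x]) simp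
      finally show "ccdf (law (perp_max (Suc n))) x \<le> K * h x" by (simp only: K(2))
    qed
  qed
  then show ?thesis using K(1) by blast
qed

lemma exceed_bound:
  assumes K: "\<And>n. ccdf (law (perp_max n)) x \<le> B"
  shows "measure Q {p. \<exists>n. perp_max n p > x} \<le> B" and "{p. \<exists>n. perp_max n p > x} \<in> sets Q"
proof -
  have s: "{p. perp_max n p > x} \<in> sets Q" for n
  proof -
    have "{p \<in> space Q. perp_max n p > x} \<in> sets Q" by measurable
    then show ?thesis by simp
  qed
  have eq: "{p. \<exists>n. perp_max n p > x} = (\<Union>n. {p. perp_max n p > x})" by auto
  then show "{p. \<exists>n. perp_max n p > x} \<in> sets Q" using s by auto
  have "(\<lambda>n. measure Q {p. perp_max n p > x}) \<longlonglongrightarrow> measure Q (\<Union>n. {p. perp_max n p > x})"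
  proof (rule QQ.finite_Lim_measure_incseq)
    show "incseq (\<lambda>n. {p. perp_max n p > x})"
    proof (intro incseq_SucI subsetI)
      fix n p assume "p \<in> {p. perp_max n p > x}"
      then show "p \<in> {p. perp_max (Suc n) p > x}" using perp_max_mono[of n "Suc n" p] by simp
    qed
  qed (use s in auto)
  then have "measure Q (\<Union>n. {p. perp_max n p > x}) \<le> B"
    by (rule LIMSEQ_le_const2) (use K in \<open>auto simp: ccdf_law\<close>)
  then show "measure Q {p. \<exists>n. perp_max n p > x} \<le> B" by (simp add: eq)
qed

text \<open>The maxima increase with n, so only boundedness is at stake; the probability that some
  maximum exceeds k + 1 is at most \<open>K * h (k + 1)\<close>, which tends to 0.\<close>

lemma perp_max_convergent:
  assumes "\<mu> < 1" shows "AE p in Q. convergent (\<lambda>n. perp_max n p)"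
proof -
  obtain K where K: "K \<ge> 0" "\<And>n x. x > 0 \<Longrightarrow> ccdf (law (perp_max n)) x \<le> K * h x"
    using perp_max_uniform[OF assms] by blast
  let ?B = "\<lambda>k::nat. {p. \<exists>n. perp_max n p > real (Suc k)}"
  have b: "measure Q (?B k) \<le> K * h (real (Suc k))" for k by (rule exceed_bound(1)[OF K(2)]) simp
  have s: "?B k \<in> sets Q" for k by (rule exceed_bound(2)[OF K(2)]) simp
  have "(\<lambda>k. K * h (real (Suc k))) \<longlonglongrightarrow> K * 0"
  proof (intro tendsto_mult tendsto_const)
    have "filterlim (\<lambda>k. real (Suc k)) at_top sequentially" by real_asymp
    then show "(\<lambda>k. h (real (Suc k))) \<longlonglongrightarrow> 0" by (rule filterlim_compose[OF h_tendsto_0])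
  qed
  moreover have "measure Q (\<Inter>k. ?B k) \<le> K * h (real (Suc k))" for k
    using s by (intro order_trans[OF QQ.finite_measure_mono b]) auto
  ultimately have "measure Q (\<Inter>k. ?B k) \<le> K * 0" by (intro LIMSEQ_le_const) auto
  then have "measure Q (\<Inter>k. ?B k) = 0" using measure_nonneg[of Q "\<Inter>k. ?B k"] by linarith
  then have "(\<Inter>k. ?B k) \<in> null_sets Q" using s by (auto simp: null_sets_def QQ.emeasure_eq_measure)
  then have "AE p in Q. p \<notin> (\<Inter>k. ?B k)" by (rule AE_not_in)
  then show ?thesis
  proof eventually_elim
    case (elim p)
    then obtain k where "\<And>n. perp_max n p \<le> real (Suc k)" by (auto simp: not_less)
    then show ?case by (intro Bseq_mono_convergent BseqI'[of _ "real (Suc k)"]) (auto simp: perp_max_nonneg perp_max_mono)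
  qed
qed

definition mlim :: "(nat \<Rightarrow> real) \<times> (nat \<Rightarrow> real) \<Rightarrow> real" where "mlim p = lim (\<lambda>n. perp_max n p)"
definition slim :: "(nat \<Rightarrow> real) \<times> (nat \<Rightarrow> real) \<Rightarrow> real" where "slim p = lim (\<lambda>n. perp_sum n p)"

lemma mlim_meas [measurable]: "mlim \<in> borel_measurable Q" and slim_meas [measurable]: "slim \<in> borel_measurable Q"
  unfolding mlim_def[abs_def] slim_def[abs_def] by measurable

lemma mlim_bound:
  assumes "\<mu> < 1"
  shows "\<exists>K\<ge>0. \<forall>x>0. ccdf (law mlim) x \<le> K * h x"
proof -
  obtain K where K: "K \<ge> 0" "\<And>n x. x > 0 \<Longrightarrow> ccdf (law (perp_max n)) x \<le> K * h x"
    using perp_max_uniform[OF assms] by blast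
  have "ccdf (law mlim) x \<le> K * h x" if x: "x > 0" for x
  proof -
    have "ccdf (law mlim) x = measure Q {p. mlim p > x}" by (rule ccdf_law) measurable
    also have "\<dots> \<le> measure Q {p. \<exists>n. perp_max n p > x}"
    proof (rule QQ.finite_measure_mono_AE)
      show "AE p in Q. p \<in> {p. mlim p > x} \<longrightarrow> p \<in> {p. \<exists>n. perp_max n p > x}"
        using perp_max_convergent[OF assms]
      proof eventually_elim
        case (elim p)
        then have l: "(\<lambda>n. perp_max n p) \<longlonglongrightarrow> mlim p" by (simp add: mlim_def convergent_LIMSEQ_iff)
        show ?case using LIMSEQ_le_const2[OF l, of x] by (auto simp: not_less[symmetric])
      qed
    qed (rule exceed_bound(2)[OF K(2)[OF x]])
    also have "\<dots> \<le> K * h x" by (rule exceed_bound(1)[OF K(2)[OF x]])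
    finally show ?thesis .
  qed
  then show ?thesis using K(1) by blast
qed

text \<open>The pathwise recursion passes to the limit by continuity; convergence along the shifted
  sequences holds almost surely because the shift preserves Q.\<close>

lemma law_mlim:
  assumes "\<mu> < 1" shows "law mlim = distr (step (law mlim)) borel (max 0)"
proof (rule law_rec_max)
  show "AE p in Q. mlim p = max 0 (snd p 0 * (fst p 0 + mlim (shift p)))"
    using AE_shift[OF perp_max_convergent[OF assms]] AE_snd_pos
  proof eventually_elim
    case (elim p)
    then have "(\<lambda>n. perp_max n (shift p)) \<longlonglongrightarrow> mlim (shift p)" by (simp add: mlim_def convergent_LIMSEQ_iff)
    then have "(\<lambda>n. max 0 (snd p 0 * (fst p 0 + perp_max n (shift p)))) \<longlonglongrightarrow> max 0 (snd p 0 * (fst p 0 + mlim (shift p)))"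
      by (intro tendsto_intros)
    then have "(\<lambda>n. perp_max (Suc n) p) \<longlonglongrightarrow> max 0 (snd p 0 * (fst p 0 + mlim (shift p)))"
      by (simp add: perp_max_Suc[OF elim(2)])
    then have "(\<lambda>n. perp_max n p) \<longlonglongrightarrow> max 0 (snd p 0 * (fst p 0 + mlim (shift p)))" by (rule LIMSEQ_imp_Suc)
    then show ?case unfolding mlim_def[of p] by (rule limI)
  qed
qed measurable

lemma law_slim:
  assumes "AE p in Q. convergent (\<lambda>n. perp_sum n p)" shows "law slim = step (law slim)"
proof (rule law_rec)
  show "AE p in Q. slim p = snd p 0 * (fst p 0 + slim (shift p))"
    using AE_shift[OF assms]
  proof eventually_elim
    case (elim p)
    then have "(\<lambda>n. perp_sum n (shift p)) \<longlonglongrightarrow> slim (shift p)" by (simp add: slim_def convergent_LIMSEQ_iff)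
    then have "(\<lambda>n. snd p 0 * (fst p 0 + perp_sum n (shift p))) \<longlonglongrightarrow> snd p 0 * (fst p 0 + slim (shift p))"
      by (intro tendsto_intros)
    then have "(\<lambda>n. perp_sum (Suc n) p) \<longlonglongrightarrow> snd p 0 * (fst p 0 + slim (shift p))" by (simp add: perp_sum_Suc)
    then have "(\<lambda>n. perp_sum n p) \<longlonglongrightarrow> snd p 0 * (fst p 0 + slim (shift p))" by (rule LIMSEQ_imp_Suc)
    then show ?case unfolding slim_def[of p] by (rule limI)
  qed
qed measurable

text \<open>Each sum is at most the corresponding maximum, so the bound for the limit of the maxima
  is inherited.\<close>

lemma slim_bound:
  assumes "\<mu> < 1" and conv: "AE p in Q. convergent (\<lambda>n. perp_sum n p)"
  shows "\<exists>K\<ge>0. \<forall>x>0. ccdf (law slim) x \<le> K * h x"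
proof -
  have "ccdf (law slim) x \<le> ccdf (law mlim) x" for x
  proof -
    have "{p \<in> space Q. mlim p > x} \<in> sets Q" by measurable
    then have "measure Q {p. slim p > x} \<le> measure Q {p. mlim p > x}"
    proof (intro QQ.finite_measure_mono_AE)
      show "AE p in Q. p \<in> {p. slim p > x} \<longrightarrow> p \<in> {p. mlim p > x}"
        using perp_max_convergent[OF assms(1)] conv
      proof eventually_elim
        case (elim p)
        then have l: "(\<lambda>n. perp_max n p) \<longlonglongrightarrow> mlim p" "(\<lambda>n. perp_sum n p) \<longlonglongrightarrow> slim p"
          by (simp_all add: mlim_def slim_def convergent_LIMSEQ_iff)
        have "slim p \<le> mlim p" by (rule LIMSEQ_le[OF l(2,1)]) (intro exI allI impI perp_sum_le_perp_max)
        then show ?case by auto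
      qed
    qed simp
    then show ?thesis by (simp add: ccdf_law)
  qed
  then show ?thesis using mlim_bound[OF assms(1)] order_trans by blast
qed

lemma asymp_fixpoint:
  assumes \<mu>: "\<mu> < 1" and N: "real_distribution N"
    and K: "\<exists>K\<ge>0. \<forall>x>0. ccdf N x \<le> K * h x"
    and tail: "\<And>x. x \<ge> 0 \<Longrightarrow> ccdf N x = ccdf (step N) x" and mom: "mom \<alpha> N = mom \<alpha> (step N)"
    and zero: "ccdf (step N) 0 = 0 \<Longrightarrow> ccdf LF 0 = 0"
  shows "(\<lambda>x. ccdf N x) \<sim>[at_top] (\<lambda>x. \<mu> / (1 - \<mu>) * ccdf LF x + mom \<alpha> N / (\<mu> * (1 - \<mu>)) * ccdf LG x)"
proof -
  obtain K where K: "K \<ge> 0" "\<And>x. x > 0 \<Longrightarrow> ccdf N x \<le> K * h x" using K by blast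
  have ap: "approx N (\<mu> / (1 - \<mu>)) (mom \<alpha> N / (\<mu> * (1 - \<mu>))) 0"
    by (rule fixpoint_approx[OF N \<mu> K(2) K(1) _ mom]) (auto simp: tail)
  have a: "\<mu> / (1 - \<mu>) > 0" using \<mu> \<mu>_pos by simp
  have b: "mom \<alpha> N / (\<mu> * (1 - \<mu>)) \<ge> 0" using \<mu> \<mu>_pos mom_nonneg[of N \<alpha>] by simp
  show ?thesis
  proof (rule approx_imp_asymp_equiv[OF ap a b _ N])
    assume "mom \<alpha> N / (\<mu> * (1 - \<mu>)) = 0"
    then have "mom \<alpha> N = 0" using \<mu> \<mu>_pos by simp
    then have "ccdf N 0 = 0"
      using moment_integrable[OF N, of 1 K] K by (intro mom_zero_imp[OF N]) auto
    then show "ccdf N 0 = 0 \<and> ccdf LF 0 = 0" using zero tail[of 0] by simp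
  qed
qed

lemma asymp_mlim:
  assumes \<mu>: "\<mu> < 1"
  shows "(\<lambda>x. ccdf (law mlim) x) \<sim>[at_top] (\<lambda>x. \<mu> / (1 - \<mu>) * ccdf LF x + mom \<alpha> (law mlim) / (\<mu> * (1 - \<mu>)) * ccdf LG x)"
proof (rule asymp_fixpoint[OF \<mu> _ mlim_bound[OF \<mu>]])
  show N: "real_distribution (law mlim)" by simp
  have S: "real_distribution (step (law mlim))" by (rule real_distribution_step[OF N])
  show "ccdf (law mlim) x = ccdf (step (law mlim)) x" if "x \<ge> 0" for x
    using that ccdf_distr_max[OF S] law_mlim[OF \<mu>] by metis
  show "mom \<alpha> (law mlim) = mom \<alpha> (step (law mlim))"
    using mom_distr_max[OF S] law_mlim[OF \<mu>] by metis
  have "AE p in Q. mlim p \<ge> 0" using perp_max_convergent[OF \<mu>]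
  proof eventually_elim
    case (elim p)
    then have "(\<lambda>n. perp_max n p) \<longlonglongrightarrow> mlim p" by (simp add: mlim_def convergent_LIMSEQ_iff)
    then show ?case by (rule LIMSEQ_le_const) (simp add: perp_max_nonneg)
  qed
  then show "ccdf LF 0 = 0" if "ccdf (step (law mlim)) 0 = 0"
    by (intro step_zero_imp[OF N that] law_nonneg) simp_all
qed

text \<open>The limit of the sums may be negative, so the degenerate case is settled by
  \<open>fixpoint_zero_imp\<close>, in contrast to the maxima.\<close>

lemma asymp_slim:
  assumes \<mu>: "\<mu> < 1" and conv: "AE p in Q. convergent (\<lambda>n. perp_sum n p)"
  shows "(\<lambda>x. ccdf (law slim) x) \<sim>[at_top] (\<lambda>x. \<mu> / (1 - \<mu>) * ccdf LF x + mom \<alpha> (law slim) / (\<mu> * (1 - \<mu>)) * ccdf LG x)"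
proof (rule asymp_fixpoint[OF \<mu> _ slim_bound[OF assms]])
  show N: "real_distribution (law slim)" by simp
  show "ccdf LF 0 = 0" if "ccdf (step (law slim)) 0 = 0"
    using fixpoint_zero_imp[OF N law_slim[OF conv, symmetric] _ \<mu>] that by (simp add: law_slim[OF conv, symmetric])
qed (simp_all only: law_slim[OF conv, symmetric])

text \<open>Two applications of Borel-Cantelli: the logarithmic moment keeps the n-th X below
  \<open>exp (c * n)\<close> eventually, and Markov's inequality for the \<alpha>-th moment keeps
  the product of the first n factors Y below \<open>r ^ n\<close>. The terms are then dominated by a
  geometric series of ratio \<open>exp c * r\<close>.\<close>

lemma perp_sum_convergent:
  assumes \<mu>: "\<mu> < 1" and log_moment: "integrable LF (\<lambda>x. ln (max (- min x 0) 1))"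
  shows "AE \<omega> in M. convergent (\<lambda>n. perp_sum n (Z \<omega>))"
proof -
  have \<alpha>: "\<alpha> > 0" by (rule \<mu>_lt_1D(1)[OF \<mu>])
  \<comment> \<open>With t strictly between \<mu> and 1, the Markov bounds
    \<open>(\<mu> / t) ^ n\<close> are summable, and r, the number with
    \<open>r powr \<alpha> = t\<close>, is below 1. Then c is half of - ln r, which leaves
    \<open>exp c * r\<close> below 1.\<close>
  define t where "t = (1 + \<mu>) / 2"
  have t: "\<mu> < t" "t < 1" "0 < t" using \<mu> \<mu>_pos by (auto simp: t_def)
  define r where "r = t powr (1 / \<alpha>)"
  have r\<alpha>: "r powr \<alpha> = t" using \<alpha> t by (simp add: r_def powr_powr)
  have r: "0 < r" "r < 1" using t \<alpha> powr_less_mono2[of "1 / \<alpha>" t 1] by (auto simp: r_def)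
  define c where "c = - ln r / 2"
  have c: "c > 0" using r by (simp add: c_def)
  have q: "exp c * r < 1"
  proof -
    have "exp c * r = exp (c + ln r)" using r by (simp add: exp_add)
    also have "\<dots> < 1" using r by (simp add: c_def)
    finally show ?thesis .
  qed
  \<comment> \<open>The logarithmic moment is assumed only for the negative part. For the positive
    part it follows from \<open>ln x \<le> x powr \<alpha> / \<alpha>\<close> and the finite
    \<alpha>-th moment of X.\<close>
  define W where "W = (\<lambda>x::real. ln (max \<bar>x\<bar> 1))"
  have W_int: "integrable LF W"
  proof (rule Bochner_Integration.integrable_bound)
    show "integrable LF (\<lambda>x. ln (max (- min x 0) 1) + (1 / \<alpha>) * max x 0 powr \<alpha>)"
      by (intro Bochner_Integration.integrable_add integrable_mult_right log_moment moment_integrable[OF LF TF_le])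
    show "AE x in LF. norm (W x) \<le> norm (ln (max (- min x 0) 1) + (1 / \<alpha>) * max x 0 powr \<alpha>)"
    proof (intro always_eventually allI)
      fix x :: real
      have p: "0 \<le> ln (max (- min x 0) 1)" "0 \<le> (1 / \<alpha>) * max x 0 powr \<alpha>" using \<alpha> by auto
      have "W x \<le> ln (max (- min x 0) 1) + (1 / \<alpha>) * max x 0 powr \<alpha>"
      proof (cases "x \<ge> 1")
        case True
        have "\<alpha> * ln x = ln (x powr \<alpha>)" using True by (simp add: ln_powr)
        also have "\<dots> \<le> x powr \<alpha> - 1" using True by (intro ln_le_minus_one) simp
        finally have "ln x \<le> (1 / \<alpha>) * x powr \<alpha>" using \<alpha> by (simp add: field_simps)
        then show ?thesis using True p by (simp add: W_def)
      next
        case False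
        then have "W x \<le> ln (max (- min x 0) 1)" by (auto simp: W_def max_def min_def)
        then show ?thesis using p by linarith
      qed
      moreover have "W x \<ge> 0" by (simp add: W_def)
      ultimately show "norm (W x) \<le> norm (ln (max (- min x 0) 1) + (1 / \<alpha>) * max x 0 powr \<alpha>)" using p by simp
    qed
  qed (simp add: W_def)
  let ?A = "\<lambda>n. {\<omega> \<in> space M. W (X (Suc n) \<omega>) > c * real (Suc n)}"
  have W_meas [measurable]: "W \<in> borel_measurable borel" unfolding W_def by measurable
  have A_eq: "measure M (?A n) = measure LF {x \<in> space LF. W x > c * real (Suc n)}" for n
  proof -
    have "measure LF {x. W x > c * real (Suc n)} = measure (distr M borel (X (Suc n))) {x. W x > c * real (Suc n)}"
      by (simp only: X_law)
    also have "\<dots> = measure M (X (Suc n) -` {x. W x > c * real (Suc n)} \<inter> space M)"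
      by (rule measure_distr) measurable
    also have "X (Suc n) -` {x. W x > c * real (Suc n)} \<inter> space M = ?A n" by auto
    finally show ?thesis by simp
  qed
  have A: "AE \<omega> in M. \<forall>\<^sub>F n in sequentially. \<omega> \<in> space M - ?A n"
  proof (rule borel_cantelli_AE1)
    show "summable (\<lambda>n. measure M (?A n))" unfolding A_eq
      by (rule summable_tail_probabilities[OF LF.prob_space_axioms W_int _ c]) (simp add: W_def)
  qed (auto simp: emeasure_eq_measure)
  define P where "P = (\<lambda>n \<omega>. \<Prod>j\<in>{1..n}. max (Y j \<omega>) 0 powr \<alpha>)"
  have P_meas [measurable]: "P n \<in> borel_measurable M" for n unfolding P_def by measurable
  have P_nonneg: "P n \<omega> \<ge> 0" for n \<omega> unfolding P_def by (intro prod_nonneg) auto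
  have P_mom: "(\<integral>\<^sup>+\<omega>. ennreal (P n \<omega>) \<partial>M) = ennreal (\<mu> ^ n)" for n
  proof -
    have "indep_vars (\<lambda>_. borel) (\<lambda>j \<omega>. max (Y j \<omega>) 0 powr \<alpha>) {1..n}"
      by (rule indep_vars_compose2[OF indep_vars_subset[OF Y_indep]]) auto
    have 1: "(\<integral>\<^sup>+\<omega>. ennreal (max (Y j \<omega>) 0 powr \<alpha>) \<partial>M) = ennreal \<mu>" for j
    proof -
      have "(\<integral>\<^sup>+y. ennreal (max y 0 powr \<alpha>) \<partial>distr M borel (Y j)) = (\<integral>\<^sup>+\<omega>. ennreal (max (Y j \<omega>) 0 powr \<alpha>) \<partial>M)"
        by (rule nn_integral_distr) measurable
      moreover have "(\<integral>\<^sup>+y. ennreal (max y 0 powr \<alpha>) \<partial>LG) = ennreal \<mu>"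
        unfolding \<mu>_def pos_moment_def by (rule nn_integral_eq_integral[OF LG_moment]) auto
      ultimately show ?thesis by (simp add: Y_law)
    qed
    have ind: "indep_vars (\<lambda>_. borel) (\<lambda>j \<omega>. ennreal (max (Y j \<omega>) 0 powr \<alpha>)) {1..n}"
      by (rule indep_vars_compose2[OF indep_vars_subset[OF Y_indep]]) auto
    have "(\<integral>\<^sup>+\<omega>. ennreal (P n \<omega>) \<partial>M) = (\<integral>\<^sup>+\<omega>. (\<Prod>j\<in>{1..n}. ennreal (max (Y j \<omega>) 0 powr \<alpha>)) \<partial>M)"
      unfolding P_def by (intro nn_integral_cong) (simp add: prod_ennreal)
    also have "\<dots> = (\<Prod>j\<in>{1..n}. \<integral>\<^sup>+\<omega>. ennreal (max (Y j \<omega>) 0 powr \<alpha>) \<partial>M)"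
      by (rule indep_vars_nn_integral[OF _ ind]) auto
    also have "\<dots> = ennreal (\<mu> ^ n)" using \<mu>_pos by (simp add: 1 ennreal_power)
    finally show ?thesis .
  qed
  \<comment> \<open>The event that P n is at least t^n, in the form of Markov's inequality.
    \<open>?B n\<close> concerns n factors but \<open>?A n\<close> the variable of index n + 1,
    hence the later passage to \<open>?B (Suc n)\<close>.\<close>
  let ?B = "\<lambda>n. {\<omega> \<in> space M. 1 \<le> ennreal (1 / t ^ n) * ennreal (P n \<omega>)}"
  have B: "AE \<omega> in M. \<forall>\<^sub>F n in sequentially. \<omega> \<in> space M - ?B n"
  proof (rule borel_cantelli_AE1)
    have "measure M (?B n) \<le> (\<mu> / t) ^ n" for n
    proof -
      have "emeasure M (?B n) \<le> ennreal (1 / t ^ n) * (\<integral>\<^sup>+\<omega>. ennreal (P n \<omega>) * indicator (space M) \<omega> \<partial>M)"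
        by (rule nn_integral_Markov_inequality) measurable
      also have "(\<integral>\<^sup>+\<omega>. ennreal (P n \<omega>) * indicator (space M) \<omega> \<partial>M) = ennreal (\<mu> ^ n)"
        unfolding P_mom[symmetric] by (intro nn_integral_cong) simp
      also have "ennreal (1 / t ^ n) * ennreal (\<mu> ^ n) = ennreal ((\<mu> / t) ^ n)"
        using t \<mu>_pos by (subst ennreal_mult'[symmetric]) (auto simp: power_divide)
      finally show ?thesis using t \<mu>_pos by (simp add: emeasure_eq_measure)
    qed
    then show "summable (\<lambda>n. measure M (?B n))"
      using t \<mu>_pos by (intro summable_comparison_test'[OF summable_geometric[of "\<mu> / t"]]) auto
  qed (measurable, simp add: emeasure_eq_measure)
  have pos: "AE \<omega> in M. \<forall>j. Y j \<omega> > 0"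
    unfolding AE_all_countable by (intro allI AE_distrD[OF Y_meas], subst Y_law, rule AE_LG_pos)
  show ?thesis using A B pos
  proof eventually_elim
    case (elim \<omega>)
    have "\<forall>\<^sub>F n in sequentially. \<omega> \<in> space M - ?B (Suc n)"
      using elim(2) by (rule eventually_sequentially_Suc[THEN iffD2])
    then have ev: "\<forall>\<^sub>F n in sequentially. norm (X (Suc n) \<omega> * (\<Prod>j<Suc n. Y (Suc j) \<omega>)) \<le> (exp c * r) ^ Suc n"
      using elim(1)
    proof eventually_elim
      case (elim n)
      have x: "\<bar>X (Suc n) \<omega>\<bar> \<le> exp c ^ Suc n"
      proof -
        have "ln (max \<bar>X (Suc n) \<omega>\<bar> 1) \<le> c * real (Suc n)" using elim(2) by (auto simp: W_def)
        then have "max \<bar>X (Suc n) \<omega>\<bar> 1 \<le> exp (c * real (Suc n))"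
          using exp_le_cancel_iff[of "ln (max \<bar>X (Suc n) \<omega>\<bar> 1)" "c * real (Suc n)"] by (simp del: exp_le_cancel_iff of_nat_Suc)
        moreover have "exp (c * real (Suc n)) = exp c ^ Suc n" by (rule exp_of_nat2_mult)
        ultimately show ?thesis by simp
      qed
      define y where "y = (\<Prod>j\<in>{1..Suc n}. Y j \<omega>)"
      have y0: "y > 0" unfolding y_def using \<open>\<forall>j. Y j \<omega> > 0\<close> by (intro prod_pos) auto
      have Py: "P (Suc n) \<omega> = y powr \<alpha>"
      proof -
        have "max (Y j \<omega>) 0 = Y j \<omega>" for j
          using spec[OF \<open>\<forall>j. Y j \<omega> > 0\<close>, of j] by simp
        then have "P (Suc n) \<omega> = (\<Prod>j\<in>{1..Suc n}. Y j \<omega> powr \<alpha>)" unfolding P_def by simp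
        then show ?thesis by (simp only: y_def prod_powr_distrib)
      qed
      have "\<not> 1 \<le> ennreal (1 / t ^ Suc n) * ennreal (P (Suc n) \<omega>)" using elim(1) by auto
      then have "\<not> 1 \<le> ennreal ((1 / t ^ Suc n) * P (Suc n) \<omega>)" using t by (subst ennreal_mult') auto
      then have "P (Suc n) \<omega> / t ^ Suc n < 1" by (simp add: not_le ennreal_less_one_iff del: power_Suc)
      then have lt: "y powr \<alpha> < t ^ Suc n" using t unfolding Py by (simp add: divide_less_eq del: power_Suc)
      have y: "y \<le> r ^ Suc n"
      proof (rule ccontr)
        assume "\<not> y \<le> r ^ Suc n"
        then have "(r ^ Suc n) powr \<alpha> \<le> y powr \<alpha>" using \<alpha> r by (intro powr_mono2) auto
        moreover have "(r ^ Suc n) powr \<alpha> = t ^ Suc n"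
          using r by (simp add: r\<alpha>[symmetric] powr_power powr_realpow[symmetric] powr_powr mult.commute del: power_Suc of_nat_Suc)
        ultimately show False using lt by simp
      qed
      have "(\<Prod>j<Suc n. Y (Suc j) \<omega>) = y" unfolding y_def by (simp add: prod.atLeast1_atMost_eq)
      then have "norm (X (Suc n) \<omega> * (\<Prod>j<Suc n. Y (Suc j) \<omega>)) = \<bar>X (Suc n) \<omega>\<bar> * y" using y0 by (simp add: abs_mult)
      also have "\<dots> \<le> exp c ^ Suc n * r ^ Suc n" using x y y0 by (intro mult_mono) auto
      finally show ?case by (simp only: power_mult_distrib)
    qed
    have "summable (\<lambda>n. (exp c * r) ^ Suc n)"
      using q r by (subst summable_Suc_iff) (intro summable_geometric, simp)
    then have "summable (\<lambda>n. X (Suc n) \<omega> * (\<Prod>j<Suc n. Y (Suc j) \<omega>))"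
      by (rule summable_comparison_test_ev[OF ev])
    then show ?case by (simp add: summable_iff_convergent perp_sum_def Z_def)
  qed
qed

text \<open>The set of convergence is measurable, so an almost sure statement along \<open>Z\<close>
  can be pulled over to the law of \<open>Z\<close>, which is Q.\<close>

lemma perp_sum_convergent_Q:
  assumes "\<mu> < 1" "integrable LF (\<lambda>x. ln (max (- min x 0) 1))"
  shows "AE p in Q. convergent (\<lambda>n. perp_sum n p)"
proof -
  have "{p \<in> space Q. convergent (\<lambda>n. perp_sum n p)} \<in> sets Q"
    unfolding Cauchy_convergent_iff[symmetric] by (rule sets_Collect_Cauchy) (rule perp_sum_meas)
  then have "AE p in distr M Q Z. convergent (\<lambda>n. perp_sum n p)"
    using perp_sum_convergent[OF assms] by (subst AE_distr_iff[OF Z_meas]) auto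
  then show ?thesis unfolding distr_Z .
qed

end

theorem theorem2p1:
  fixes M :: "'a measure" and X Y :: "nat \<Rightarrow> 'a \<Rightarrow> real"
    and F G :: "real \<Rightarrow> real" and \<alpha> \<mu> :: real
  assumes "prob_space M"
    and "prob_space.indep_vars M (\<lambda>_. borel) X UNIV"
    and "prob_space.indep_vars M (\<lambda>_. borel) Y UNIV"
    and "prob_space.indep_var M
           (\<Pi>\<^sub>M i\<in>(UNIV :: nat set). borel) (\<lambda>\<omega> i. X i \<omega>)
           (\<Pi>\<^sub>M i\<in>(UNIV :: nat set). borel) (\<lambda>\<omega> i. Y i \<omega>)"
    and "\<And>i. cdf (distr M borel (X i)) = F"
    and "\<And>i. cdf (distr M borel (Y i)) = G"
    and "G 0 = 0"
    and "\<alpha> \<ge> 0"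
    and "\<And>p. 0 < p \<Longrightarrow> p < 1 \<Longrightarrow> (\<lambda>x. p * F x + (1 - p) * G x) \<in> strong_reg_var \<alpha>"
    and "\<mu> = pos_moment M \<alpha> (Y 0)"
  shows
    "(\<forall>n\<ge>1.
        (\<lambda>x. \<P>(\<omega> in M. M_max X Y n \<omega> > x)) \<sim>[at_top]
          (\<lambda>x. A_coeff \<mu> n * tail F x
             + BC_coeff \<mu> (\<lambda>k. pos_moment M \<alpha> (M_max X Y k)) n * tail G x) \<and>
        (\<lambda>x. \<P>(\<omega> in M. S_sum X Y n \<omega> > x)) \<sim>[at_top]
          (\<lambda>x. A_coeff \<mu> n * tail F x
             + BC_coeff \<mu> (\<lambda>k. pos_moment M \<alpha> (S_sum X Y k)) n * tail G x)) \<and>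
     (\<mu> < 1 \<longrightarrow>
        (AE \<omega> in M. convergent (\<lambda>n. M_max X Y n \<omega>)) \<and>
        (\<lambda>x. \<P>(\<omega> in M. M_lim X Y \<omega> > x)) \<sim>[at_top]
          (\<lambda>x. \<mu> / (1 - \<mu>) * tail F x
             + pos_moment M \<alpha> (M_lim X Y) / (\<mu> * (1 - \<mu>)) * tail G x)) \<and>
     (\<mu> < 1 \<and> integrable M (\<lambda>\<omega>. ln (max (- min (X 0 \<omega>) 0) 1)) \<longrightarrow>
        (AE \<omega> in M. convergent (\<lambda>n. S_sum X Y n \<omega>)) \<and>
        (\<lambda>x. \<P>(\<omega> in M. S_lim X Y \<omega> > x)) \<sim>[at_top]
          (\<lambda>x. \<mu> / (1 - \<mu>) * tail F x
             + pos_moment M \<alpha> (S_lim X Y) / (\<mu> * (1 - \<mu>)) * tail G x))"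
proof -
  interpret prob_space M by fact
  have X_meas: "X i \<in> borel_measurable M" and Y_meas: "Y i \<in> borel_measurable M" for i
    using assms(2,3) by (auto simp: indep_vars_def)
  define LF where "LF = distr M borel (X 0)"
  define LG where "LG = distr M borel (Y 0)"
  have LF: "real_distribution LF" and LG: "real_distribution LG"
    unfolding LF_def LG_def using X_meas Y_meas by auto
  have cF: "cdf LF = F" and cG: "cdf LG = G" by (simp_all add: LF_def LG_def assms(5,6))
  have X_law: "distr M borel (X i) = LF" for i
    by (rule cdf_unique[OF real_distribution_distr[OF X_meas] LF]) (simp add: cF assms(5))
  have Y_law: "distr M borel (Y i) = LG" for i
    by (rule cdf_unique[OF real_distribution_distr[OF Y_meas] LG]) (simp add: cG assms(6))
  obtain H where H: "tail_pair LF LG H \<alpha>"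
    using tail_pairI[OF LF LG assms(8)] assms(7,9) by (auto simp: cF cG)
  interpret P: perpetuity M LF LG H \<alpha> X Y
    using assms(1-4) H LF LG X_law Y_law
    by (intro perpetuity.intro law_pair.intro perpetuity_axioms.intro)
  have tF: "tail F x = ccdf LF x" and tG: "tail G x = ccdf LG x" for x
    by (simp_all add: tail_def ccdf_eq[OF LF] ccdf_eq[OF LG] cF cG)
  have \<mu>: "\<mu> = P.\<mu>"
  proof -
    have "mom \<alpha> LG = pos_moment M \<alpha> (Y 0)"
      unfolding LG_def pos_moment_def using Y_meas by (subst integral_distr) auto
    then show ?thesis by (simp only: assms(10) P.\<mu>_def)
  qed
  \<comment> \<open>Valid at every point, also without convergence, because both sides are
    \<open>lim\<close> of the same sequence.\<close>
  have MLim: "M_lim X Y \<omega> = P.mlim (P.Z \<omega>)" and SLim: "S_lim X Y \<omega> = P.slim (P.Z \<omega>)" for \<omega>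
    by (simp_all add: M_lim_def S_lim_def P.mlim_def P.slim_def P.M_max_eq P.S_sum_eq)
  have mM: "pos_moment M \<alpha> (M_max X Y k) = mom \<alpha> (P.law (perp_max k))" for k
    unfolding P.pos_moment_law[OF P.perp_max_meas, symmetric] by (simp add: pos_moment_def P.M_max_eq)
  have mS: "pos_moment M \<alpha> (S_sum X Y k) = mom \<alpha> (P.law (perp_sum k))" for k
    unfolding P.pos_moment_law[OF P.perp_sum_meas, symmetric] by (simp add: pos_moment_def P.S_sum_eq)
  have mML: "pos_moment M \<alpha> (M_lim X Y) = mom \<alpha> (P.law P.mlim)"
    unfolding P.pos_moment_law[OF P.mlim_meas, symmetric] by (simp add: pos_moment_def MLim)
  have mSL: "pos_moment M \<alpha> (S_lim X Y) = mom \<alpha> (P.law P.slim)"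
    unfolding P.pos_moment_law[OF P.slim_meas, symmetric] by (simp add: pos_moment_def SLim)
  have lm: "integrable LF (\<lambda>x. ln (max (- min x 0) 1))" if "integrable M (\<lambda>\<omega>. ln (max (- min (X 0 \<omega>) 0) 1))"
    unfolding LF_def using that X_meas by (subst integrable_distr_eq) auto
  have conv: "AE p in P.Q. convergent (\<lambda>n. perp_sum n p)"
    if "P.\<mu> < 1" "integrable M (\<lambda>\<omega>. ln (max (- min (X 0 \<omega>) 0) 1))"
    by (rule P.perp_sum_convergent_Q[OF that(1) lm[OF that(2)]])
  show ?thesis
    unfolding mM mS mML mSL tF tG \<mu> P.M_max_eq P.S_sum_eq MLim SLim
      P.prob_law[OF P.perp_max_meas] P.prob_law[OF P.perp_sum_meas] P.prob_law[OF P.mlim_meas] P.prob_law[OF P.slim_meas]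
    using P.asymp_perp_max P.asymp_perp_sum P.asymp_mlim P.AE_Z[OF P.perp_max_convergent] P.asymp_slim[OF _ conv]
      P.perp_sum_convergent[OF _ lm] by blast
qed

end
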